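(* Let $k$ be a non-negative integer. If $n = 3k+1$, then there are at least $\frac{1}{2}\cdot 6^{k-1}$ simplicial complexes on $n$ vertices that attain the Turán bound, no two of which are isomorphic. If $n = 3k+2$, then there are at least $6^{k-1}$ simplicial complexes on $n$ vertices that attain the Turán bound, no two of which are isomorphic.
   Context: A triangle is a face with exactly three vertices. A simplicial complex $C$ on $n$ vertices is said here to attain the Turán bound if (i) $C$ has no face with four or more vertices, (ii) every minimal non-face of $C$ with fewer than four vertices has exactly three vertices (so all $n$ vertices and all $\binom n2$ edges are faces) and every minimal non-face of $C$ has exactly three vertices (so among any four vertices some three do not form a triangle), and (iii) the number of triangles of $C$ is exactly $$\begin{cases} \frac52 k^3-\frac32 k^2 & \text{if } n=3k,\\ \frac52 k^3+k^2-\frac12 k & \text{if } n=3k+1,\\ \frac52 k^3+\frac72 k^2+k & \text{if } n=3k+2.\end{cases}$$ *)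

theory Defs
  imports Complex_Main
begin

text \<open>
  Abstract simplicial complexes are given by a finite vertex set \<open>V\<close> and a family \<open>C\<close> of faces.
  Not every element of \<open>V\<close> is required to be a face, so that minimal non-faces may a priori
  have any size.
\<close>

definition simplicial_complex_on :: "'a set \<Rightarrow> 'a set set \<Rightarrow> bool" where
  "simplicial_complex_on V C \<longleftrightarrow>
     finite V \<and> C \<subseteq> Pow V \<and> {} \<in> C \<and> (\<forall>F\<in>C. \<forall>G. G \<subseteq> F \<longrightarrow> G \<in> C)"

definition complex_isomorphic ::
    "'a set \<Rightarrow> 'a set set \<Rightarrow> 'b set \<Rightarrow> 'b set set \<Rightarrow> bool" where
  "complex_isomorphic V C W D \<longleftrightarrow>
     (\<exists>f. bij_betw f V W \<and> (\<forall>F. F \<subseteq> V \<longrightarrow> (F \<in> C \<longleftrightarrow> f ` F \<in> D)))"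

definition minimal_nonface :: "'a set \<Rightarrow> 'a set set \<Rightarrow> 'a set \<Rightarrow> bool" where
  "minimal_nonface V C F \<longleftrightarrow> F \<subseteq> V \<and> F \<notin> C \<and> (\<forall>G. G \<subset> F \<longrightarrow> G \<in> C)"

definition triangles :: "'a set set \<Rightarrow> 'a set set" where
  "triangles C = {F \<in> C. card F = 3}"

definition turan_bound :: "nat \<Rightarrow> real" where
  "turan_bound n = (let k = real (n div 3) in
     if n mod 3 = 0 then 5/2 * k ^ 3 - 3/2 * k ^ 2
     else if n mod 3 = 1 then 5/2 * k ^ 3 + k ^ 2 - 1/2 * k
     else 5/2 * k ^ 3 + 7/2 * k ^ 2 + k)"

text \<open>
  The condition on minimal non-faces forces all vertices and all edges to be faces, and, as no
  4-set is a face, forces every 4-set to contain a 3-set that is not a triangle.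
\<close>

definition attains_turan_bound :: "'a set \<Rightarrow> 'a set set \<Rightarrow> bool" where
  "attains_turan_bound V C \<longleftrightarrow>
     simplicial_complex_on V C \<and>
     (\<forall>F\<in>C. card F < 4) \<and>
     (\<forall>F. minimal_nonface V C F \<longrightarrow> card F = 3) \<and>
     real (card (triangles C)) = turan_bound (card V)"

end

theory Submission
  imports Defs
begin

text \<open>Since the complexes in question have no faces beyond triangles, such a complex is given by its
missing triples, and it attains the bound iff every four vertices contain a missing triple
(\<open>four_set\<close>) and the number of missing triples is right (\<open>triangle_count\<close>).

The missing triples come from orientations, as in the constructions of Kostochka and
Fon-Der-Flaass. Let vertices arrive one after another, each at the left or at the right end of a
path, and colour the path periodically with three colours. Two vertices of different colours are
joined by an arc whose direction depends on the colours and on the side chosen by the later one.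
A triple is missing if its vertices have the same colour or if one of them has arcs to the two
others. The sequence of choices, a word in left and right, is encoded by the set of arrival times
of the vertices placed at the right; the vertices themselves are the arrival times. The number of
missing triples is a sum of binomial coefficients over the sizes of the three colour classes and
over the out-degrees. Cutting the path at a vertex and moving one piece to the other end turns its
out-neighbourhood into one residue class modulo 3 in an interval of length \<open>n\<close> (\<open>arcs_unrolled\<close>).
Hence out-degrees differ by at most one, whatever the word is, and the number of missing triples
comes out as required.

Distinct words can give isomorphic complexes. To keep this under control, all words end with three
vertices placed at the right, one of each colour, called the crown. The crown shows the rest of the
word: two vertices below it form a missing triple with two crown vertices if they have the same
colour, and with exactly one otherwise, and which one it is shows the direction of the arc. An
isomorphism may move the crown to another triple with this property, but by the lemma \<open>exchange\<close>
such a triple always contains a vertex that is a twin of a crown vertex, so by swapping twins the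
isomorphism can be made to preserve the crown (\<open>align\<close>). It then preserves equality of colours and
all arcs below the crown, and as the colour classes do not all have the same size, it acts on the
colours as the identity or as one reflection (\<open>class_map\<close>). In the latter case left and right are
exchanged in one of the words.

Now fix two colours. The pairs for which the later vertex is at the left form a down-closed
subset of a product of two chains, that is, a Young diagram, and a Young diagram is
determined by its rows and columns up to permutation (\<open>sign_iso_same_signs\<close>). So the positions of all these
pairs on the path are known, and from them the word can be read off from its last letter
down to its first. The only ambiguity is that two successive arrivals at different ends commute
if they have the same colour, which happens once in three steps. Choosing one order
leaves 6 words for every three letters (\<open>card_normal_1\<close>, \<open>card_normal_2\<close>). With the crown
taking up three vertices there are, for positive \<open>k\<close>, \<open>6 ^ (k - 1)\<close> words for \<open>n = 3 * k + 1\<close> and twice as many for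
\<open>n = 3 * k + 2\<close>, and an isomorphism class contains at most two of them: a word and possibly
another one with the same signs as its mirror image.\<close>

section \<open>Folded paths\<close>

text \<open>The place on the final path of the vertex that arrives at time \<open>t\<close>, counted from the left.
A vertex at the right end is followed only by the later vertices at the right, and a vertex at the
left end is preceded only by the later vertices at the left. Defining the place from the outside
in this manner has the effect that it does not change when letters are added at the right.\<close>

definition idx :: "nat \<Rightarrow> nat set \<Rightarrow> nat \<Rightarrow> nat" where
  "idx n A t = (if t \<in> A then n - 1 - card {s \<in> A. t < s \<and> s < n}
                else card {s. s \<notin> A \<and> t < s \<and> s < n})"

text \<open>The ends of the interval of places taken by the vertices up to \<open>t\<close>.\<close>

definition left_end :: "nat \<Rightarrow> nat set \<Rightarrow> nat \<Rightarrow> nat" where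
  "left_end n A t = card {s. s \<notin> A \<and> t < s \<and> s < n}"
definition right_end :: "nat \<Rightarrow> nat set \<Rightarrow> nat \<Rightarrow> nat" where
  "right_end n A t = n - 1 - card {s \<in> A. t < s \<and> s < n}"

lemma idx_ends: "idx n A t = (if t \<in> A then right_end n A t else left_end n A t)"
  by (simp add: idx_def left_end_def right_end_def)

lemma card_above: "(t::nat) < n \<Longrightarrow>
  card {s. s \<notin> A \<and> t < s \<and> s < n} + card {s \<in> A. t < s \<and> s < n} = n - 1 - t"
proof -
  assume "t < n"
  have "card {s. s \<notin> A \<and> t < s \<and> s < n} + card {s \<in> A. t < s \<and> s < n}
     = card ({s. s \<notin> A \<and> t < s \<and> s < n} \<union> {s \<in> A. t < s \<and> s < n})"
    by (rule card_Un_disjoint[symmetric]) auto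
  also have "{s. s \<notin> A \<and> t < s \<and> s < n} \<union> {s \<in> A. t < s \<and> s < n} = {t<..<n}" by auto
  finally show ?thesis by simp
qed

lemma right_left_end: "t < n \<Longrightarrow> right_end n A t = left_end n A t + t"
  using card_above[of t n A] unfolding right_end_def left_end_def by linarith

lemma left_end_less: assumes "u < t" "t < n" "t \<notin> A" shows "left_end n A t < left_end n A u"
proof -
  have "t \<in> {s. s \<notin> A \<and> u < s \<and> s < n} - {s. s \<notin> A \<and> t < s \<and> s < n}"
    and "{s. s \<notin> A \<and> t < s \<and> s < n} \<subseteq> {s. s \<notin> A \<and> u < s \<and> s < n}" using assms by auto
  then show ?thesis unfolding left_end_def by (intro psubset_card_mono) auto
qed

lemma left_end_mono: assumes "u \<le> t" shows "left_end n A t \<le> left_end n A u"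
  unfolding left_end_def by (rule card_mono) (use assms in auto)

lemma right_end_mono: assumes "u \<le> t" shows "right_end n A u \<le> right_end n A t"
proof -
  have "card {s \<in> A. t < s \<and> s < n} \<le> card {s \<in> A. u < s \<and> s < n}"
    by (rule card_mono) (use assms in auto)
  then show ?thesis unfolding right_end_def by simp
qed

lemma right_end_less: assumes "u < t" "t < n" "t \<in> A" shows "right_end n A u < right_end n A t"
proof -
  have "card {s \<in> A. t < s \<and> s < n} < card {s \<in> A. u < s \<and> s < n}"
  proof -
    have "t \<in> {s \<in> A. u < s \<and> s < n} - {s \<in> A. t < s \<and> s < n}"
      and "{s \<in> A. t < s \<and> s < n} \<subseteq> {s \<in> A. u < s \<and> s < n}" using assms by auto
    then show ?thesis by (intro psubset_card_mono) auto
  qed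
  moreover have "card {s \<in> A. u < s \<and> s < n} \<le> n - 1 - u"
    using card_above[of u n A] assms by linarith
  ultimately show ?thesis unfolding right_end_def using assms by linarith
qed

lemma idx_bounds: assumes "t < n" shows "left_end n A t \<le> idx n A t" "idx n A t \<le> right_end n A t"
  using right_left_end[OF assms, of A] by (auto simp: idx_ends)

text \<open>A vertex lies to the right of all earlier ones iff it was placed at the right. So the
path order determines the side that the later of two vertices has chosen.\<close>

lemma idx_less_iff: assumes "u < t" "t < n" shows "idx n A u < idx n A t \<longleftrightarrow> t \<in> A"
  using idx_bounds[of u n A] left_end_less[OF assms, of A] right_end_less[OF assms, of A] assms
  by (cases "t \<in> A") (auto simp: idx_ends[of n A t])

lemma idx_neq: assumes "u < t" "t < n" shows "idx n A u \<noteq> idx n A t"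
  using idx_bounds[of u n A] left_end_less[OF assms, of A] right_end_less[OF assms, of A] assms
  by (cases "t \<in> A") (auto simp: idx_ends[of n A t])

lemma inj_idx: "inj_on (idx n A) {..<n}"
  unfolding inj_on_def by (metis idx_neq lessThan_iff linorder_neqE_nat)

lemma idx_lt: "t < n \<Longrightarrow> idx n A t < n"
  using idx_bounds(2)[of t n A] unfolding right_end_def by linarith

lemma bij_idx: "bij_betw (idx n A) {..<n} {..<n}"
  using inj_idx idx_lt by (simp add: bij_betw_def endo_inj_surj image_subset_iff)

lemma idx_image: assumes "t < n" shows "idx n A ` {..t} = {left_end n A t..right_end n A t}"
proof (rule card_subset_eq)
  show "idx n A ` {..t} \<subseteq> {left_end n A t..right_end n A t}"
  proof
    fix y assume "y \<in> idx n A ` {..t}"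
    then obtain u where u: "u \<le> t" "y = idx n A u" by auto
    then show "y \<in> {left_end n A t..right_end n A t}"
      using idx_bounds[of u n A] left_end_mono[of u t n A] right_end_mono[of u t n A] assms by auto
  qed
  have "inj_on (idx n A) {..t}" by (rule inj_on_subset[OF inj_idx]) (use assms in auto)
  then show "card (idx n A ` {..t}) = card {left_end n A t..right_end n A t}"
    using right_left_end[OF assms, of A] by (simp add: card_image)
qed simp

text \<open>The factor \<open>n\<close> only matters modulo 3, as a sign: the colours increase along the path if
\<open>n\<close> leaves remainder 1, and decrease if it leaves remainder 2. This choice is what balances the
out-degrees, by \<open>arcs_unrolled\<close>.\<close>

definition cls where "cls n A t = (n * idx n A t) mod 3"

text \<open>Adding 2 is lowering the colour by 1, so the side of the later endpoint appears as a sign.\<close>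

definition arc :: "nat \<Rightarrow> nat set \<Rightarrow> nat \<Rightarrow> nat \<Rightarrow> bool" where
  "arc n A u v \<longleftrightarrow> cls n A v = (cls n A u + (if max u v \<in> A then 2 else 1)) mod 3"

definition miss :: "nat \<Rightarrow> nat set \<Rightarrow> nat \<Rightarrow> nat \<Rightarrow> nat \<Rightarrow> bool" where
  "miss n A u v w \<longleftrightarrow> distinct [u, v, w] \<and>
     (cls n A u = cls n A v \<and> cls n A v = cls n A w \<or>
      arc n A u v \<and> arc n A u w \<or> arc n A v u \<and> arc n A v w \<or> arc n A w u \<and> arc n A w v)"

definition missing :: "nat \<Rightarrow> nat set \<Rightarrow> nat set set" where
  "missing n A = {{u, v, w} | u v w. u < n \<and> v < n \<and> w < n \<and> miss n A u v w}"

lemma cls_cases: "cls n A t = 0 \<or> cls n A t = 1 \<or> cls n A t = 2"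
  unfolding cls_def by auto

lemma arc_not_sym: "arc n A u v \<Longrightarrow> \<not> arc n A v u"
  using cls_cases[of n A u] cls_cases[of n A v] by (auto simp: arc_def max.commute split: if_splits)

lemma arc_cls: "arc n A u v \<Longrightarrow> cls n A u \<noteq> cls n A v"
  using cls_cases[of n A u] cls_cases[of n A v] by (auto simp: arc_def max.commute split: if_splits)

lemma arc_total: "cls n A u \<noteq> cls n A v \<Longrightarrow> arc n A u v \<or> arc n A v u"
  using cls_cases[of n A u] cls_cases[of n A v] by (auto simp: arc_def max.commute split: if_splits)

lemma miss_perm: "miss n A u v w = miss n A v u w" "miss n A u v w = miss n A u w v"
  unfolding miss_def by auto

lemma miss_perms: "miss n A u v w \<Longrightarrow>
    miss n A u w v \<and> miss n A v u w \<and> miss n A v w u \<and> miss n A w u v \<and> miss n A w v u"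
  unfolding miss_def by auto

lemma miss_missing:
  assumes "distinct [u, v, w]" "u < n" "v < n" "w < n"
  shows "{u, v, w} \<in> missing n A \<longleftrightarrow> miss n A u v w"
proof
  assume "{u, v, w} \<in> missing n A"
  then obtain a b c where abc: "{u, v, w} = {a, b, c}" "miss n A a b c"
    unfolding missing_def by blast
  have "u \<in> {a, b, c}" "v \<in> {a, b, c}" "w \<in> {a, b, c}" using abc(1) by blast+
  then show "miss n A u v w"
    using assms(1) abc(2) miss_perms[OF abc(2)] by auto
qed (use assms in \<open>unfold missing_def, blast\<close>)

lemma missing_card3: "F \<in> missing n A \<Longrightarrow> card F = 3 \<and> F \<subseteq> {..<n}"
  by (auto simp: missing_def miss_def)

lemma arc_top:
  assumes "x < d" "y < d" "cls n A x = cls n A y"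
  shows "arc n A d x \<longleftrightarrow> arc n A d y" "arc n A x d \<longleftrightarrow> arc n A y d"
  using assms by (simp_all add: arc_def max_def)

lemma missI:
  assumes "distinct [u, v, w]"
  shows "cls n A u = cls n A v \<Longrightarrow> cls n A v = cls n A w \<Longrightarrow> miss n A u v w"
    "arc n A u v \<Longrightarrow> arc n A u w \<Longrightarrow> miss n A u v w"
    "arc n A v u \<Longrightarrow> arc n A v w \<Longrightarrow> miss n A u v w"
    "arc n A w u \<Longrightarrow> arc n A w v \<Longrightarrow> miss n A u v w"
  using assms unfolding miss_def by auto

text \<open>The last vertex \<open>d\<close> treats equally coloured vertices in the same way. If it has the colour of \<open>x\<close> and
\<open>y\<close>, or arcs to both of them, these three form a missing triple. Otherwise \<open>x\<close> and \<open>y\<close> have arcs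
to \<open>d\<close>; then an arc from one of them to \<open>z\<close> gives a missing triple with \<open>d\<close>, and in the absence of such arcs
\<open>x\<close>, \<open>y\<close>, \<open>z\<close> are a missing triple.\<close>

lemma four_two_same:
  assumes "x < d" "y < d" "z < d" "distinct [x, y, z]" "cls n A x = cls n A y"
  shows "miss n A x y z \<or> miss n A x y d \<or> miss n A x z d \<or> miss n A y z d"
proof -
  have dist: "distinct [x, y, z]" "distinct [x, y, d]" "distinct [x, z, d]" "distinct [y, z, d]"
    using assms by auto
  consider "cls n A d = cls n A x" | "arc n A d x" | "arc n A x d"
    using arc_total by metis
  then show ?thesis
  proof cases
    case 1 then show ?thesis using missI(1)[OF dist(2)] assms(5) by metis
  next
    case 2 then show ?thesis using missI(4)[OF dist(2)] arc_top(1)[OF assms(1,2,5)] by metis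
  next
    case 3
    then have 4: "arc n A y d" using arc_top(2)[OF assms(1,2,5)] by metis
    consider "cls n A z = cls n A x" | "arc n A z x" "arc n A z y" | "arc n A x z" | "arc n A y z"
      using arc_total assms(5) by metis
    then show ?thesis
    proof cases
      case 1 then show ?thesis using missI(1)[OF dist(1)] assms(5) by metis
    next
      case 2 then show ?thesis using missI(4)[OF dist(1)] by metis
    next
      case c: 3 then show ?thesis using missI(2)[OF dist(3)] 3 by metis
    next
      case c: 4 then show ?thesis using missI(2)[OF dist(4)] 4 by metis
    qed
  qed
qed

text \<open>If all three colours occur and \<open>a\<close> and \<open>d\<close> share one, then both triangles on \<open>b\<close>, \<open>c\<close> and one of
\<open>a\<close>, \<open>d\<close> would have to be directed cycles. Using the arc between \<open>b\<close> and \<open>c\<close> in the same direction, they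
make \<open>b\<close> or \<open>c\<close> a vertex with arcs to both \<open>a\<close> and \<open>d\<close>.\<close>

lemma four_same_top:
  assumes "distinct [a, b, c, d]" "cls n A d = cls n A a" "cls n A a \<noteq> cls n A b"
    "cls n A a \<noteq> cls n A c" "cls n A b \<noteq> cls n A c"
  shows "miss n A a b c \<or> miss n A a b d \<or> miss n A a c d \<or> miss n A b c d"
proof -
  have dist: "distinct [a, b, c]" "distinct [a, b, d]" "distinct [a, c, d]" "distinct [b, c, d]"
    using assms by auto
  have "miss n A a b c \<or> arc n A a b \<and> arc n A b c \<and> arc n A c a \<or> arc n A b a \<and> arc n A c b \<and> arc n A a c"
    using missI[OF dist(1)] arc_total assms(3-5) by metis
  moreover have "miss n A b c d \<or> arc n A d b \<and> arc n A b c \<and> arc n A c d \<or> arc n A b d \<and> arc n A c b \<and> arc n A d c"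
    using missI[OF dist(4)] arc_total assms(2-5) by metis
  ultimately show ?thesis
    using missI(3)[OF dist(2)] missI(3)[OF dist(3)] arc_not_sym by metis
qed

lemma four_top:
  assumes "a < d" "b < d" "c < d" "distinct [a, b, c]"
  shows "miss n A a b c \<or> miss n A a b d \<or> miss n A a c d \<or> miss n A b c d"
proof -
  consider "cls n A a = cls n A b" | "cls n A a = cls n A c" | "cls n A b = cls n A c"
    | "cls n A a \<noteq> cls n A b" "cls n A a \<noteq> cls n A c" "cls n A b \<noteq> cls n A c"
      "cls n A d = cls n A a \<or> cls n A d = cls n A b \<or> cls n A d = cls n A c"
    using cls_cases[of n A] by metis
  then show ?thesis
  proof cases
    case 1
    have "miss n A a b c \<or> miss n A a b d \<or> miss n A a c d \<or> miss n A b c d"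
      by (rule four_two_same) (use 1 assms in auto)
    then show ?thesis .
  next
    case 2
    have "miss n A a c b \<or> miss n A a c d \<or> miss n A a b d \<or> miss n A c b d"
      by (rule four_two_same) (use 2 assms in auto)
    then show ?thesis by (metis miss_perms)
  next
    case 3
    have "miss n A b c a \<or> miss n A b c d \<or> miss n A b a d \<or> miss n A c a d"
      by (rule four_two_same) (use 3 assms in auto)
    then show ?thesis by (metis miss_perms)
  next
    case 4
    from 4(4) show ?thesis
    proof (elim disjE)
      assume "cls n A d = cls n A a"
      then show ?thesis by (intro four_same_top) (use 4 assms in auto)
    next
      assume "cls n A d = cls n A b"
      then have "miss n A b a c \<or> miss n A b a d \<or> miss n A b c d \<or> miss n A a c d"
        by (intro four_same_top) (use 4 assms in auto)
      then show ?thesis by (metis miss_perms)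
    next
      assume "cls n A d = cls n A c"
      then have "miss n A c a b \<or> miss n A c a d \<or> miss n A c b d \<or> miss n A a b d"
        by (intro four_same_top) (use 4 assms in auto)
      then show ?thesis by (metis miss_perms)
    qed
  qed
qed

lemma four_set:
  assumes "F \<subseteq> {..<n}" "card F = 4"
  shows "\<exists>G. G \<subset> F \<and> G \<in> missing n A"
proof -
  have fin: "finite F" using assms by (metis card.infinite zero_neq_numeral)
  define d where "d = Max F"
  have d: "d \<in> F" unfolding d_def using fin assms by (metis Max_in card.empty zero_neq_numeral)
  have "card (F - {d}) = 3" using d assms fin by simp
  then obtain a b c where abc: "F - {d} = {a, b, c}" "distinct [a, b, c]"
    by (metis card_3_iff distinct_length_2_or_more distinct_singleton)
  have lt: "a < d" "b < d" "c < d"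
    using abc fin unfolding d_def by (metis Diff_iff Max_ge insertCI le_neq_implies_less)+
  have dn: "d < n" using d assms by auto
  have F: "F = {a, b, c, d}" using abc d by auto
  have m: "{a,b,c} \<in> missing n A \<longleftrightarrow> miss n A a b c" "{a,b,d} \<in> missing n A \<longleftrightarrow> miss n A a b d"
    "{a,c,d} \<in> missing n A \<longleftrightarrow> miss n A a c d" "{b,c,d} \<in> missing n A \<longleftrightarrow> miss n A b c d"
    by (rule miss_missing; use lt dn abc(2) in simp)+
  have p: "{a,b,c} \<subset> F" "{a,b,d} \<subset> F" "{a,c,d} \<subset> F" "{b,c,d} \<subset> F"
    using abc(2) lt unfolding F by auto
  from four_top[OF lt abc(2), of n A] show ?thesis
    unfolding m[symmetric]
    by (elim disjE) (intro exI conjI, rule p, assumption)+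
qed

section \<open>Counting triangles\<close>

definition outs :: "nat \<Rightarrow> nat set \<Rightarrow> nat \<Rightarrow> nat set" where
  "outs n A v = {u. u < n \<and> arc n A v u}"

definition members :: "nat \<Rightarrow> nat set \<Rightarrow> nat \<Rightarrow> nat set" where
  "members n A r = {t. t < n \<and> cls n A t = r}"

lemma finite_outs [simp]: "finite (outs n A v)" and finite_members [simp]: "finite (members n A r)"
  unfolding outs_def members_def by auto

text \<open>A missing triple is monochromatic, or it consists of a vertex and two of its out-neighbours; the
latter vertex is unique since there are no opposite arcs.\<close>

lemma missing_eq:
  "missing n A = (\<Union>r\<in>{..<3}. {F. F \<subseteq> members n A r \<and> card F = 3})
     \<union> (\<lambda>(v, B). insert v B) ` (SIGMA v:{..<n}. {B. B \<subseteq> outs n A v \<and> card B = 2})"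
    (is "_ = ?M1 \<union> ?M2")
proof (intro equalityI subsetI)
  fix F assume "F \<in> missing n A"
  then obtain u v w where F: "F = {u, v, w}" "u < n" "v < n" "w < n" and m: "miss n A u v w"
    unfolding missing_def by blast
  have d: "u \<noteq> v" "u \<noteq> w" "v \<noteq> w" using m unfolding miss_def by auto
  have src: "F \<in> ?M2" if "F = {x, y, z}" "x < n" "y < n" "z < n" "y \<noteq> z" "arc n A x y" "arc n A x z" for x y z
  proof (rule image_eqI[of _ _ "(x, {y, z})"])
    show "F = (case (x, {y, z}) of (v, B) \<Rightarrow> insert v B)" using that by simp
    show "(x, {y, z}) \<in> (SIGMA v:{..<n}. {B. B \<subseteq> outs n A v \<and> card B = 2})"
      using that by (simp add: outs_def)
  qed
  from m consider "cls n A u = cls n A v" "cls n A v = cls n A w" | "arc n A u v" "arc n A u w"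
    | "arc n A v u" "arc n A v w" | "arc n A w u" "arc n A w v"
    unfolding miss_def by blast
  then show "F \<in> ?M1 \<union> ?M2"
  proof cases
    case 1
    have "F \<subseteq> members n A (cls n A u)" "card F = 3" using 1 F d by (auto simp: members_def)
    moreover have "cls n A u < 3" unfolding cls_def by simp
    ultimately show ?thesis by blast
  next
    case 2 then show ?thesis using src[of u v w] F d by simp
  next
    case 3 then show ?thesis using src[of v u w] F d by (simp add: insert_commute)
  next
    case 4 then show ?thesis using src[of w u v] F d by (simp add: insert_commute)
  qed
next
  fix F assume "F \<in> ?M1 \<union> ?M2"
  then consider r where "F \<subseteq> members n A r" "card F = 3"
    | v B where "v < n" "B \<subseteq> outs n A v" "card B = 2" "F = insert v B" by auto
  then show "F \<in> missing n A"
  proof cases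
    case 1
    then obtain u v w where F: "F = {u, v, w}" "u \<noteq> v" "u \<noteq> w" "v \<noteq> w" by (auto simp: card_3_iff)
    have "distinct [u, v, w]" using F by simp
    moreover have "u < n" "v < n" "w < n" "cls n A u = cls n A v" "cls n A v = cls n A w"
      using 1 F by (auto simp: members_def)
    ultimately have "u < n" "v < n" "w < n" "miss n A u v w" using missI(1) by blast+
    then show ?thesis unfolding missing_def F by blast
  next
    case 2
    then obtain u w where B: "B = {u, w}" "u \<noteq> w" by (auto simp: card_2_iff)
    with 2 have a: "u < n" "w < n" "arc n A v u" "arc n A v w" by (auto simp: outs_def)
    then have "v \<noteq> u" "v \<noteq> w" using arc_cls by blast+
    then have "miss n A v u w" using a B by (intro missI) auto
    then show ?thesis unfolding missing_def using 2 B a by blast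
  qed
qed

lemma card_missing:
  "card (missing n A) = (\<Sum>r<3. card (members n A r) choose 3) + (\<Sum>v<n. card (outs n A v) choose 2)"
proof -
  let ?M1 = "\<Union>r\<in>{..<3}. {F. F \<subseteq> members n A r \<and> card F = 3}"
  let ?S = "SIGMA v:{..<n}. {B. B \<subseteq> outs n A v \<and> card B = 2}"
  let ?f = "\<lambda>(v, B). insert v (B :: nat set)"
  have fin: "finite {B. B \<subseteq> X \<and> card B = k}" if "finite X" for X :: "nat set" and k
    using that by simp
  have c1: "card ?M1 = (\<Sum>r<3. card (members n A r) choose 3)"
  proof (subst card_UN_disjoint)
    show "\<forall>i\<in>{..<3}. \<forall>j\<in>{..<3}. i \<noteq> j \<longrightarrow>
      {F. F \<subseteq> members n A i \<and> card F = 3} \<inter> {F. F \<subseteq> members n A j \<and> card F = 3} = {}"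
    proof (intro ballI impI)
      fix i j :: nat assume "i \<noteq> j"
      then have "members n A i \<inter> members n A j = {}" by (auto simp: members_def)
      then have e: "F = {}" if "F \<subseteq> members n A i" "F \<subseteq> members n A j" for F using that by blast
      show "{F. F \<subseteq> members n A i \<and> card F = 3} \<inter> {F. F \<subseteq> members n A j \<and> card F = 3} = {}"
      proof (rule equals0I)
        fix F assume "F \<in> {F. F \<subseteq> members n A i \<and> card F = 3} \<inter> {F. F \<subseteq> members n A j \<and> card F = 3}"
        then have "F \<subseteq> members n A i" "F \<subseteq> members n A j" "card F = 3" by auto
        then show False using e[of F] by simp
      qed
    qed
  next
    show "(\<Sum>r\<in>{..<3}. card {F. F \<subseteq> members n A r \<and> card F = 3}) = (\<Sum>r<3. card (members n A r) choose 3)"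
      by (intro sum.cong refl n_subsets finite_members)
  next
    show "\<forall>i\<in>{..<3}. finite {F. F \<subseteq> members n A i \<and> card F = 3}"
      using fin[OF finite_members] by (intro ballI)
  qed simp
  have src: "v = w" if "v < n" "w < n" "B \<subseteq> outs n A v" "C \<subseteq> outs n A w" "insert v B = insert w C" for v w B C
  proof (rule ccontr)
    assume ne: "v \<noteq> w"
    have "w \<in> insert v B" "v \<in> insert w C" using that(5) insertI1 by metis+
    then have "w \<in> outs n A v" "v \<in> outs n A w" using that(3,4) ne by auto
    then show False using arc_not_sym[of n A v w] unfolding outs_def by simp
  qed
  have notin: "v \<notin> B" if "B \<subseteq> outs n A v" for v B
  proof
    assume "v \<in> B"
    then have "v \<in> outs n A v" using that by blast
    then show False using arc_cls[of n A v v] unfolding outs_def by simp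
  qed
  have inj: "inj_on ?f ?S"
  proof (rule inj_onI, clarify)
    fix v B w C
    assume a: "v < n" "w < n" "B \<subseteq> outs n A v" "C \<subseteq> outs n A w" "insert v B = insert w C"
    have vw: "v = w" by (rule src[OF a])
    moreover have "v \<notin> B" "w \<notin> C" using notin[OF a(3)] notin[OF a(4)] by simp_all
    ultimately show "v = w \<and> B = C" using a(5) by (simp add: insert_ident)
  qed
  have "card (?f ` ?S) = card ?S" by (rule card_image[OF inj])
  also have "\<dots> = (\<Sum>v<n. card {B. B \<subseteq> outs n A v \<and> card B = 2})"
    by (intro card_SigmaI ballI fin finite_lessThan finite_outs)
  also have "\<dots> = (\<Sum>v<n. card (outs n A v) choose 2)"
    by (intro sum.cong refl n_subsets finite_outs)
  finally have c2: "card (?f ` ?S) = (\<Sum>v<n. card (outs n A v) choose 2)" .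
  have dis: "?M1 \<inter> ?f ` ?S = {}"
  proof (rule ccontr)
    assume "?M1 \<inter> ?f ` ?S \<noteq> {}"
    then obtain r v B where *: "insert v B \<subseteq> members n A r" "B \<subseteq> outs n A v" "card B = 2" by auto
    then obtain u where "u \<in> B" by fastforce
    with * have "cls n A u = cls n A v" "arc n A v u" by (auto simp: members_def outs_def)
    then show False using arc_cls by metis
  qed
  have "finite ?M1" "finite (?f ` ?S)"
    by (intro finite_UN_I finite_imageI finite_SigmaI fin finite_lessThan finite_members finite_outs)+
  then show ?thesis unfolding missing_eq using card_Un_disjoint[OF _ _ dis] c1 c2 by simp
qed

text \<open>Counting ordered pairs: each one is an arc, the reverse of an arc, or of equal colour.\<close>

lemma sum_outs:
  "2 * (\<Sum>v<n. card (outs n A v)) + (\<Sum>r<3. card (members n A r) ^ 2) = n ^ 2"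
proof -
  have c: "card (outs n A v) = (\<Sum>u<n. of_bool (arc n A v u))" for v
  proof -
    have "outs n A v = {..<n} \<inter> {u. arc n A v u}" unfolding outs_def by auto
    then show ?thesis by (simp add: sum_of_bool_eq)
  qed
  have in_out: "of_bool (arc n A v u) + of_bool (arc n A u v) + of_bool (cls n A v = cls n A u) = (1::nat)" for u v
    using arc_total[of n A v u] arc_cls[of n A u v] arc_cls[of n A v u] arc_not_sym[of n A u v] by auto
  have m: "card (members n A r) = (\<Sum>u<n. of_bool (cls n A u = r))" for r
  proof -
    have "members n A r = {..<n} \<inter> {u. cls n A u = r}" unfolding members_def by auto
    then show ?thesis by (simp add: sum_of_bool_eq)
  qed
  have "(\<Sum>r<3. card (members n A r) ^ 2) = (\<Sum>r<3. \<Sum>u<n. \<Sum>v<n. of_bool (cls n A u = r) * of_bool (cls n A v = r))"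
    by (simp only: m power2_eq_square sum_product)
  also have "\<dots> = (\<Sum>u<n. \<Sum>v<n. \<Sum>r<3. of_bool (cls n A u = r) * of_bool (cls n A v = r))"
    by (subst sum.swap, rule sum.cong[OF refl], subst sum.swap, rule refl)
  also have "\<dots> = (\<Sum>u<n. \<Sum>v<n. of_bool (cls n A u = cls n A v))"
  proof (intro sum.cong refl)
    fix u v
    show "(\<Sum>r<3. of_bool (cls n A u = r) * of_bool (cls n A v = r)) = (of_bool (cls n A u = cls n A v) :: nat)"
      using cls_cases[of n A u] cls_cases[of n A v] by (auto simp: numeral_3_eq_3)
  qed
  finally have s: "(\<Sum>r<3. card (members n A r) ^ 2) = (\<Sum>u<n. \<Sum>v<n. of_bool (cls n A u = cls n A v))" .
  have sw: "(\<Sum>v<n. \<Sum>u<n. of_bool (arc n A v u)) = (\<Sum>v<n. \<Sum>u<n. (of_bool (arc n A u v) :: nat))"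
    by (rule sum.swap)
  have "2 * (\<Sum>v<n. card (outs n A v)) = (\<Sum>v<n. \<Sum>u<n. of_bool (arc n A v u)) + (\<Sum>v<n. \<Sum>u<n. of_bool (arc n A u v))"
    unfolding sw[symmetric] by (simp only: c mult_2)
  then have "2 * (\<Sum>v<n. card (outs n A v)) + (\<Sum>r<3. card (members n A r) ^ 2)
    = (\<Sum>v<n. \<Sum>u<n. of_bool (arc n A v u) + of_bool (arc n A u v) + of_bool (cls n A v = cls n A u))"
    unfolding s sum.distrib by simp
  also have "\<dots> = (\<Sum>v<n. \<Sum>u<n. 1)"
    by (intro sum.cong refl in_out)
  finally show ?thesis by (simp add: power2_eq_square)
qed

lemma residue_in_three: assumes "(r::nat) < 3" shows "card {q \<in> {b..<b + 3}. q mod 3 = r} = 1"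
proof -
  have "\<exists>q0. b \<le> q0 \<and> q0 < b + 3 \<and> q0 mod 3 = r" using assms by presburger
  then obtain q0 where q0: "b \<le> q0" "q0 < b + 3" "q0 mod 3 = r" by blast
  have uq: "q = q0" if "b \<le> q" "q < b + 3" "q mod 3 = r" for q
  proof -
    have "q = 3 * (q div 3) + r" "q0 = 3 * (q0 div 3) + r"
      using that q0 mult_div_mod_eq by metis+
    then have "q div 3 = q0 div 3" using that q0 by linarith
    then show ?thesis using \<open>q = _\<close> \<open>q0 = _\<close> by simp
  qed
  have "{q \<in> {b..<b + 3}. q mod 3 = r} = {q0}"
  proof (intro equalityI subsetI)
    fix q assume "q \<in> {q \<in> {b..<b + 3}. q mod 3 = r}"
    then have "b \<le> q" "q < b + 3" "q mod 3 = r" by simp_all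
    then have "q = q0" by (rule uq)
    then show "q \<in> {q0}" by simp
  qed (use q0 in simp)
  then show ?thesis by simp
qed

lemma window3: assumes "(r::nat) < 3" shows "card {q \<in> {a..<a + 3 * m}. q mod 3 = r} = m"
proof (induction m)
  case (Suc m)
  have "{q \<in> {a..<a + 3 * Suc m}. q mod 3 = r} =
     {q \<in> {a..<a + 3 * m}. q mod 3 = r} \<union> {q \<in> {a + 3 * m..<a + 3 * m + 3}. q mod 3 = r}"
    by auto
  then show ?case
    using Suc residue_in_three[OF assms, of "a + 3 * m"] by (simp add: card_Un_disjoint disjoint_iff)
qed simp

lemma window:
  assumes "(r::nat) < 3" "n = 3 * m + j"
  shows "card {q \<in> {a..<a + n}. q mod 3 = r} = m + card {q \<in> {a + 3 * m..<a + n}. q mod 3 = r}"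
proof -
  have "{q \<in> {a..<a + n}. q mod 3 = r} =
     {q \<in> {a..<a + 3 * m}. q mod 3 = r} \<union> {q \<in> {a + 3 * m..<a + n}. q mod 3 = r}"
    using assms by auto
  then show ?thesis
    using window3[OF assms(1), of a m] by (simp add: card_Un_disjoint disjoint_iff)
qed

lemma card_filter_bij:
  assumes "bij_betw f S T" shows "card {x \<in> S. P (f x)} = card {y \<in> T. P y}"
proof -
  have "inj_on f {x \<in> S. P (f x)}" using assms unfolding bij_betw_def by (auto intro: inj_on_subset)
  moreover have "f ` {x \<in> S. P (f x)} = {y \<in> T. P y}" using assms unfolding bij_betw_def by auto
  ultimately show ?thesis by (metis card_image)
qed

lemma mult_mod3:
  assumes "(n::nat) mod 3 \<noteq> 0" "r < 3" shows "(n * q) mod 3 = r \<longleftrightarrow> q mod 3 = (n * r) mod 3"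
proof -
  have n: "n mod 3 = 1 \<or> n mod 3 = 2" and q: "q mod 3 = 0 \<or> q mod 3 = 1 \<or> q mod 3 = 2"
    and r: "r = 0 \<or> r = 1 \<or> r = 2" using assms by linarith+
  have "(n * q) mod 3 = ((n mod 3) * (q mod 3)) mod 3" "(n * r) mod 3 = ((n mod 3) * (r mod 3)) mod 3"
    by (simp_all add: mod_mult_eq)
  then show ?thesis using n q r by auto
qed

lemma card_members:
  assumes "n = 3 * m + j" "j = 1 \<or> j = 2" "r < 3"
  shows "card (members n A r) = m + card {q \<in> {3 * m..<n}. q mod 3 = (n * r) mod 3}"
proof -
  have n0: "n mod 3 \<noteq> 0" using assms by presburger
  have "members n A r = {t \<in> {..<n}. (n * idx n A t) mod 3 = r}"
    unfolding members_def cls_def by auto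
  then have "card (members n A r) = card {q \<in> {..<n}. (n * q) mod 3 = r}"
    using card_filter_bij[OF bij_idx, where P = "\<lambda>q. (n * q) mod 3 = r"] by simp
  also have "\<dots> = card {q \<in> {0..<0 + n}. q mod 3 = (n * r) mod 3}"
    using mult_mod3[OF n0 assms(3)] by (simp add: atLeast0LessThan)
  also have "\<dots> = m + card {q \<in> {0 + 3 * m..<0 + n}. q mod 3 = (n * r) mod 3}"
    by (rule window) (use assms in auto)
  finally show ?thesis by simp
qed

lemma card_members_1:
  assumes "n = 3 * m + 1"
  shows "card (members n A 0) = m + 1" "card (members n A 1) = m" "card (members n A 2) = m"
proof -
  have s: "{q \<in> {3 * m..<n}. q mod 3 = x} = (if x = 0 then {3 * m} else {})" for x
    using assms by (auto simp: le_less_Suc_eq)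
  have "(n * 1) mod 3 = 1" "(n * 2) mod 3 = 2" using assms by presburger+
  then show "card (members n A 0) = m + 1" "card (members n A 1) = m" "card (members n A 2) = m"
    using card_members[of n m 1 _ A] assms unfolding s by simp_all
qed

lemma card_members_2:
  assumes "n = 3 * m + 2"
  shows "card (members n A 0) = m + 1" "card (members n A 1) = m" "card (members n A 2) = m + 1"
proof -
  have i: "{3 * m..<n} = {3 * m, 3 * m + 1}" using assms by auto
  have r: "(n * 0) mod 3 = 0" "(n * 1) mod 3 = 2" "(n * 2) mod 3 = 1" using assms by presburger+
  have s: "{q \<in> {3 * m..<n}. q mod 3 = 0} = {3 * m}" "{q \<in> {3 * m..<n}. q mod 3 = 1} = {3 * m + 1}"
      "{q \<in> {3 * m..<n}. q mod 3 = 2} = {}"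
    unfolding i by auto
  show "card (members n A 0) = m + 1" "card (members n A 1) = m" "card (members n A 2) = m + 1"
    using card_members[OF assms, of 0 A] card_members[OF assms, of 1 A] card_members[OF assms, of 2 A]
    unfolding r s by simp_all
qed

text \<open>Between \<open>v\<close> and the earlier or equally directed vertices, arcs are governed by the residue of the
place. For later vertices at the other end the arcs turn around; moving them
by \<open>n\<close>, beyond the end at which \<open>v\<close> was placed, changes their residue so as to make up for that, and closes up
the occupied places to an interval again.\<close>

lemma arcs_unrolled:
  assumes "v < n" "n mod 3 \<noteq> 0"
  shows "\<exists>\<phi> w. bij_betw \<phi> {..<n} {w..<w + n} \<and>
    (\<forall>u<n. arc n A v u \<longleftrightarrow> (n * \<phi> u) mod 3 = (cls n A v + 2) mod 3)"
proof -
  \<comment> \<open>The vertices that arrive after \<open>v\<close> at the end opposite to it.\<close>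
  define far where "far u \<longleftrightarrow> \<not> (u \<le> v \<or> (u \<in> A \<longleftrightarrow> v \<in> A))" for u
  \<comment> \<open>For \<open>v\<close> at the right, the far vertices are moved up by \<open>n\<close>; for \<open>v\<close> at the left the others
    are moved up instead, which amounts to moving the far ones down.\<close>
  define \<phi> where "\<phi> u = (if far u = (v \<in> A) then idx n A u + n else idx n A u)" for u
  define w where "w = (if v \<in> A then left_end n A v else right_end n A v + 1)"
  have lt: "idx n A u < n" if "u < n" for u using idx_lt[OF that] .
  have hv: "right_end n A v < n" "left_end n A v \<le> right_end n A v"
    using lt[OF assms(1)] idx_bounds[OF assms(1), of A] right_left_end[OF assms(1), of A] assms(1)
    by (auto simp: right_end_def)
  have "\<phi> u \<in> {w..<w + n}" if u: "u < n" for u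
  proof (cases "u \<le> v")
    case True
    then have "left_end n A v \<le> idx n A u" "idx n A u \<le> right_end n A v"
      using idx_bounds[OF u, of A] left_end_mono[OF True, of n A] right_end_mono[OF True, of n A] by linarith+
    then show ?thesis using True hv unfolding \<phi>_def far_def w_def by auto
  next
    case False
    then have "u \<in> A \<Longrightarrow> right_end n A v < idx n A u" "u \<notin> A \<Longrightarrow> idx n A u < left_end n A v"
      using right_end_less[of v u n A] left_end_less[of v u n A] u by (simp_all add: idx_ends)
    then show ?thesis using False hv lt[OF u] unfolding \<phi>_def far_def w_def by auto
  qed
  then have sub: "\<phi> ` {..<n} \<subseteq> {w..<w + n}" by auto
  have inj: "inj_on \<phi> {..<n}"
  proof (rule inj_onI)
    fix x y assume xy: "x \<in> {..<n}" "y \<in> {..<n}" "\<phi> x = \<phi> y"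
    then have "idx n A x < n" "idx n A y < n" using lt by auto
    then have "idx n A x = idx n A y" using xy(3) unfolding \<phi>_def by (auto split: if_splits)
    then show "x = y" using inj_onD[OF inj_idx] xy by blast
  qed
  have "\<phi> ` {..<n} = {w..<w + n}"
    by (rule card_subset_eq[OF _ sub]) (simp_all add: card_image[OF inj])
  then have bij: "bij_betw \<phi> {..<n} {w..<w + n}" using inj unfolding bij_betw_def by blast
  have n2: "(n * n) mod 3 = 1"
  proof -
    have "n mod 3 = 1 \<or> n mod 3 = 2" using assms(2) by linarith
    moreover have "(n * n) mod 3 = ((n mod 3) * (n mod 3)) mod 3" by (simp add: mod_mult_eq)
    ultimately show ?thesis by auto
  qed
  have shift: "(n * (idx n A u + n)) mod 3 = (cls n A u + 1) mod 3" for u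
  proof -
    have "(n * (idx n A u + n)) mod 3 = ((n * idx n A u) mod 3 + (n * n) mod 3) mod 3"
      by (simp add: distrib_left mod_add_eq)
    then show ?thesis unfolding n2 cls_def .
  qed
  have "arc n A v u \<longleftrightarrow> (n * \<phi> u) mod 3 = (cls n A v + 2) mod 3" if "u < n" for u
  proof (cases "far u = (v \<in> A)")
    case True
    then have "max v u \<notin> A" unfolding far_def by (auto simp: max_def)
    then have "arc n A v u \<longleftrightarrow> cls n A u = (cls n A v + 1) mod 3" unfolding arc_def by simp
    moreover have "(n * \<phi> u) mod 3 = (cls n A u + 1) mod 3" using True shift unfolding \<phi>_def by simp
    ultimately show ?thesis using cls_cases[of n A u] cls_cases[of n A v] by auto
  next
    case False
    then have "max v u \<in> A" unfolding far_def by (auto simp: max_def)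
    then have "arc n A v u \<longleftrightarrow> cls n A u = (cls n A v + 2) mod 3" unfolding arc_def by simp
    then show ?thesis using False unfolding \<phi>_def cls_def by simp
  qed
  then show ?thesis using bij by blast
qed

lemma card_outs:
  assumes "n = 3 * m + j" "j = 1 \<or> j = 2" "v < n"
  shows "card (outs n A v) = m \<or> card (outs n A v) = m + 1"
proof -
  have n0: "n mod 3 \<noteq> 0" using assms by presburger
  obtain \<phi> w where bij: "bij_betw \<phi> {..<n} {w..<w + n}"
    and arc: "\<And>u. u < n \<Longrightarrow> arc n A v u \<longleftrightarrow> (n * \<phi> u) mod 3 = (cls n A v + 2) mod 3"
    using arcs_unrolled[OF assms(3) n0, of A] by blast
  define r where "r = (n * ((cls n A v + 2) mod 3)) mod 3"
  have "outs n A v = {u \<in> {..<n}. \<phi> u mod 3 = r}"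
    unfolding outs_def r_def using arc mult_mod3[OF n0, of "(cls n A v + 2) mod 3"] by auto
  then have "card (outs n A v) = card {q \<in> {w..<w + n}. q mod 3 = r}"
    using card_filter_bij[OF bij, where P = "\<lambda>q. q mod 3 = r"] by simp
  also have "\<dots> = m + card {q \<in> {w + 3 * m..<w + n}. q mod 3 = r}"
    by (rule window[OF _ assms(1)]) (simp add: r_def)
  finally have c: "card (outs n A v) = m + card {q \<in> {w + 3 * m..<w + n}. q mod 3 = r}" .
  have "card {q \<in> {w + 3 * m..<w + n}. q mod 3 = r} \<le> 1"
  proof (rule card_le_Suc0_iff_eq[THEN iffD2, unfolded One_nat_def[symmetric]])
    show "\<forall>x\<in>{q \<in> {w + 3 * m..<w + n}. q mod 3 = r}. \<forall>y\<in>{q \<in> {w + 3 * m..<w + n}. q mod 3 = r}. x = y"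
    proof (intro ballI)
      fix x y assume *: "x \<in> {q \<in> {w + 3 * m..<w + n}. q mod 3 = r}" "y \<in> {q \<in> {w + 3 * m..<w + n}. q mod 3 = r}"
      then have e: "x = 3 * (x div 3) + r" "y = 3 * (y div 3) + r"
        using mult_div_mod_eq[of 3 x] mult_div_mod_eq[of 3 y] by simp_all
      have xy: "x < y + 2" "y < x + 2" using * assms(1,2) by auto
      have "x div 3 = y div 3" using e xy by linarith
      then show "x = y" using e by simp
    qed
  qed simp
  then show ?thesis using c by linarith
qed

lemma choose_3_real: "real (k choose 3) = real k * (real k - 1) * (real k - 2) / 6"
proof (induction k)
  case (Suc k)
  have "real (k choose 2) = real k * (real k - 1) / 2"
    by (induction k) (simp_all add: numeral_2_eq_2 field_simps)
  then have "real (Suc k choose 3) = real k * (real k - 1) / 2 + real k * (real k - 1) * (real k - 2) / 6"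
    using Suc by (simp add: numeral_3_eq_3 numeral_2_eq_2)
  then show ?case by (simp add: field_simps)
qed simp

text \<open>On two adjacent values a quadratic function is linear, so the sum over all out-degrees of their
binomial coefficients depends on the number of arcs only.\<close>

lemma choose_2_linear:
  assumes "k = m \<or> k = m + 1" shows "2 * (k choose 2) + m * (m + 1) = 2 * m * k"
proof -
  have c: "2 * (j choose 2) = j * (j - 1)" for j :: nat
    by (induction j) (auto simp: numeral_2_eq_2 algebra_simps)
  show ?thesis using assms by (cases m) (auto simp: c algebra_simps)
qed

lemma triangle_count:
  assumes "n = 3 * m + j" "j = 1 \<or> j = 2"
  shows "real (n choose 3) - real (card (missing n A)) = turan_bound n"
proof -
  let ?o = "\<lambda>v. card (outs n A v)" and ?s = "\<lambda>r. card (members n A r)"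
  have "(\<Sum>v<n. 2 * (?o v choose 2) + m * (m + 1)) = (\<Sum>v<n. 2 * m * ?o v)"
    by (intro sum.cong refl choose_2_linear card_outs[OF assms]) simp
  then have "2 * (\<Sum>v<n. ?o v choose 2) + n * (m * (m + 1)) = 2 * m * (\<Sum>v<n. ?o v)"
    by (simp add: sum.distrib sum_distrib_left)
  then have e1: "2 * real (\<Sum>v<n. ?o v choose 2) + real n * (m * (real m + 1)) = 2 * real m * real (\<Sum>v<n. ?o v)"
    by (metis (no_types) of_nat_add of_nat_mult of_nat_numeral of_nat_1)
  have "2 * real (\<Sum>v<n. ?o v) + real (\<Sum>r<3. ?s r ^ 2) = real n ^ 2"
    using sum_outs[of n A] by (metis of_nat_add of_nat_mult of_nat_numeral of_nat_power)
  then have "real n ^ 2 - real (\<Sum>r<3. ?s r ^ 2) = 2 * real (\<Sum>v<n. ?o v)" by linarith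
  then have e2: "2 * real m * real (\<Sum>v<n. ?o v) = real m * (real n ^ 2 - real (\<Sum>r<3. ?s r ^ 2))"
    by (simp only: mult.assoc mult.left_commute)
  have sq: "real (\<Sum>r<3. ?s r ^ 2) = real (?s 0) ^ 2 + real (?s 1) ^ 2 + real (?s 2) ^ 2"
    by (simp add: numeral_3_eq_3 numeral_2_eq_2)
  have ch: "real (\<Sum>r<3. ?s r choose 3) = real (?s 0 choose 3) + real (?s 1 choose 3) + real (?s 2 choose 3)"
    by (simp add: numeral_3_eq_3 numeral_2_eq_2)
  have ms: "real (card (missing n A)) = real (\<Sum>r<3. ?s r choose 3) + real (\<Sum>v<n. ?o v choose 2)"
    unfolding card_missing by simp
  from assms(2) show ?thesis
  proof
    assume j: "j = 1"
    have d: "n div 3 = m" "n mod 3 = 1" using assms(1) j by presburger+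
    have t: "turan_bound n = 5/2 * real m ^ 3 + real m ^ 2 - 1/2 * real m"
      unfolding turan_bound_def d Let_def by simp
    have n: "n = 3 * m + 1" using assms(1) j by simp
    note s = card_members_1[OF n, of A]
    show ?thesis using e1 e2 ms unfolding t sq ch s choose_3_real
      by (simp add: n field_simps power2_eq_square power3_eq_cube)
  next
    assume j: "j = 2"
    have d: "n div 3 = m" "n mod 3 = 2" using assms(1) j by presburger+
    have t: "turan_bound n = 5/2 * real m ^ 3 + 7/2 * real m ^ 2 + real m"
      unfolding turan_bound_def d Let_def by simp
    have n: "n = 3 * m + 2" using assms(1) j by simp
    note s = card_members_2[OF n, of A]
    show ?thesis using e1 e2 ms unfolding t sq ch s choose_3_real
      by (simp add: n field_simps power2_eq_square power3_eq_cube)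
  qed
qed

section \<open>The complex of a word\<close>

definition word_complex :: "nat \<Rightarrow> nat set \<Rightarrow> nat set set" where
  "word_complex n A = {F. F \<subseteq> {..<n} \<and> card F \<le> 3 \<and> F \<notin> missing n A}"

text \<open>A minimal non-face with more than three vertices would contain a missing triple properly.\<close>

lemma word_complex_attains:
  assumes "n = 3 * m + j" "j = 1 \<or> j = 2"
  shows "attains_turan_bound {..<n} (word_complex n A)"
  unfolding attains_turan_bound_def
proof (intro conjI ballI allI impI)
  show "simplicial_complex_on {..<n} (word_complex n A)"
    unfolding simplicial_complex_on_def
  proof (intro conjI ballI allI impI)
    show "{} \<in> word_complex n A" using missing_card3[of "{}" n A] unfolding word_complex_def by auto
    fix F G assume F: "F \<in> word_complex n A" and G: "G \<subseteq> F"
    have fin: "finite F" using F unfolding word_complex_def by (auto intro: finite_subset)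
    have "G \<notin> missing n A"
    proof
      assume g: "G \<in> missing n A"
      then have "card G = 3" using missing_card3 by blast
      then have "G = F" using F G fin card_seteq[of F G] unfolding word_complex_def by auto
      then show False using F g unfolding word_complex_def by blast
    qed
    then show "G \<in> word_complex n A"
      using F G card_mono[OF fin G] unfolding word_complex_def by auto
  qed (auto simp: word_complex_def)
next
  fix F assume "F \<in> word_complex n A" then show "card F < 4" unfolding word_complex_def by auto
next
  fix F assume F: "minimal_nonface {..<n} (word_complex n A) F"
  have "card F \<le> 3"
  proof (rule ccontr)
    assume "\<not> card F \<le> 3"
    then obtain H where H: "H \<subseteq> F" "card H = 4" using obtain_subset_with_card_n[of 4 F] by auto
    then have "H \<subseteq> {..<n}" using F unfolding minimal_nonface_def by blast
    from four_set[OF this H(2), of A] obtain G where "G \<subset> F" "G \<in> missing n A" using H by blast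
    then show False using F unfolding minimal_nonface_def word_complex_def by blast
  qed
  then have "F \<in> missing n A" using F unfolding minimal_nonface_def word_complex_def by blast
  then show "card F = 3" using missing_card3 by blast
next
  have "triangles (word_complex n A) = {F. F \<subseteq> {..<n} \<and> card F = 3} - missing n A"
    unfolding triangles_def word_complex_def by auto
  moreover have "missing n A \<subseteq> {F. F \<subseteq> {..<n} \<and> card F = 3}" using missing_card3 by blast
  moreover have fin: "finite {F. F \<subseteq> {..<n} \<and> card F = 3}" by simp
  ultimately have t: "card (triangles (word_complex n A)) = card {F. F \<subseteq> {..<n} \<and> card F = 3} - card (missing n A)"
    by (metis card_Diff_subset finite_subset)
  have "card (missing n A) \<le> card {F. F \<subseteq> {..<n} \<and> card F = 3}"
    using card_mono[OF fin] missing_card3[of _ n A] by blast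
  moreover have "card {F. F \<subseteq> {..<n} \<and> card F = 3} = n choose 3" using n_subsets[of "{..<n}" 3] by simp
  ultimately show "real (card (triangles (word_complex n A))) = turan_bound (card {..<n})"
    using triangle_count[OF assms, of A] t by simp
qed

lemma complex_isomorphic_sym:
  assumes "complex_isomorphic V C W D" shows "complex_isomorphic W D V C"
proof -
  obtain f where f: "bij_betw f V W" "\<And>F. F \<subseteq> V \<Longrightarrow> F \<in> C \<longleftrightarrow> f ` F \<in> D"
    using assms unfolding complex_isomorphic_def by blast
  have h: "bij_betw (inv_into V f) W V" by (rule bij_betw_inv_into[OF f(1)])
  have "G \<in> D \<longleftrightarrow> inv_into V f ` G \<in> C" if G: "G \<subseteq> W" for G
  proof -
    have "inv_into V f ` G \<subseteq> V" using h G unfolding bij_betw_def by blast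
    moreover have "f ` inv_into V f ` G = G" using f(1) G by (metis bij_betw_def image_inv_into_cancel)
    ultimately show ?thesis using f(2) by metis
  qed
  then show ?thesis using h unfolding complex_isomorphic_def by blast
qed

lemma complex_isomorphic_refl: "complex_isomorphic V C V C"
  unfolding complex_isomorphic_def by (rule exI[of _ id]) simp

definition triple_iso where
  "triple_iso n A B f \<longleftrightarrow> bij_betw f {..<n} {..<n} \<and>
    (\<forall>u<n. \<forall>v<n. \<forall>w<n. miss n A u v w \<longleftrightarrow> miss n B (f u) (f v) (f w))"

lemma complex_iso_triple:
  assumes "complex_isomorphic {..<n} (word_complex n A) {..<n} (word_complex n B)"
  shows "\<exists>f. triple_iso n A B f"
proof -
  obtain f where f: "bij_betw f {..<n} {..<n}"
    and iso: "\<And>F. F \<subseteq> {..<n} \<Longrightarrow> F \<in> word_complex n A \<longleftrightarrow> f ` F \<in> word_complex n B"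
    using assms unfolding complex_isomorphic_def by blast
  have inj: "inj_on f {..<n}" and fn: "\<And>u. u < n \<Longrightarrow> f u < n" using f unfolding bij_betw_def by auto
  have "miss n A u v w \<longleftrightarrow> miss n B (f u) (f v) (f w)" if "u < n" "v < n" "w < n" for u v w
  proof (cases "distinct [u, v, w]")
    case True
    then have d: "distinct [f u, f v, f w]" using inj that unfolding inj_on_def by auto
    have "{u, v, w} \<in> word_complex n A \<longleftrightarrow> {u, v, w} \<notin> missing n A"
      using that True unfolding word_complex_def by auto
    moreover have "f ` {u, v, w} \<in> word_complex n B \<longleftrightarrow> {f u, f v, f w} \<notin> missing n B"
      using fn that d unfolding word_complex_def by auto
    ultimately show ?thesis
      using iso[of "{u, v, w}"] miss_missing[OF True that] miss_missing[OF d] fn that by auto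
  next
    case False
    then have "\<not> distinct [f u, f v, f w]" by auto
    then show ?thesis using False unfolding miss_def by blast
  qed
  then show ?thesis using f unfolding triple_iso_def by blast
qed

section \<open>Frames and the exchange of twins\<close>

text \<open>One of the three vertices of a frame, together with its successor. Here \<open>T\<close> stands for the missing
triples, \<open>X0\<close>, \<open>X1\<close>, \<open>X2\<close> for the colour classes below the frame and \<open>a\<close> for the arcs.
The missing triples through \<open>P0\<close> join it to the pairs within \<open>X0\<close> and within \<open>X2\<close>
and to the arcs that leave \<open>X1\<close>. All properties of a frame are copies of
these under rotation of the indices, apart from the two about all three indices at once.\<close>

locale frame_vertex =
  fixes T :: "'a \<Rightarrow> 'a \<Rightarrow> 'a \<Rightarrow> bool" and P0 P1 :: 'a and X0 X1 X2 :: "'a set"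
    and a :: "'a \<Rightarrow> 'a \<Rightarrow> bool"
  assumes sym: "T u v w \<Longrightarrow> T v u w" "T u v w \<Longrightarrow> T u w v"
    and PP: "v \<in> X0 \<Longrightarrow> T P0 P1 v" "v \<in> X1 \<Longrightarrow> \<not> T P0 P1 v" "v \<in> X2 \<Longrightarrow> \<not> T P0 P1 v"
    and L00: "u \<in> X0 \<Longrightarrow> v \<in> X0 \<Longrightarrow> u \<noteq> v \<Longrightarrow> T P0 u v"
    and L22: "u \<in> X2 \<Longrightarrow> v \<in> X2 \<Longrightarrow> u \<noteq> v \<Longrightarrow> T P0 u v"
    and L11: "u \<in> X1 \<Longrightarrow> v \<in> X1 \<Longrightarrow> \<not> T P0 u v"
    and L02: "u \<in> X0 \<Longrightarrow> v \<in> X2 \<Longrightarrow> \<not> T P0 u v"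
    and L10: "u \<in> X1 \<Longrightarrow> v \<in> X0 \<Longrightarrow> T P0 u v \<longleftrightarrow> a u v"
    and L12: "u \<in> X1 \<Longrightarrow> v \<in> X2 \<Longrightarrow> T P0 u v \<longleftrightarrow> a u v"
    and a01: "u \<in> X0 \<Longrightarrow> v \<in> X1 \<Longrightarrow> a v u \<longleftrightarrow> \<not> a u v"
    and X000: "u \<in> X0 \<Longrightarrow> v \<in> X0 \<Longrightarrow> w \<in> X0 \<Longrightarrow> distinct [u, v, w] \<Longrightarrow> T u v w"
    and X001: "u \<in> X0 \<Longrightarrow> v \<in> X0 \<Longrightarrow> w \<in> X1 \<Longrightarrow> u \<noteq> v \<Longrightarrow> T u v w \<longleftrightarrow> a w u \<and> a w v"
    and X002: "u \<in> X0 \<Longrightarrow> v \<in> X0 \<Longrightarrow> w \<in> X2 \<Longrightarrow> u \<noteq> v \<Longrightarrow> T u v w \<longleftrightarrow> a w u \<and> a w v"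
    and disj: "X0 \<inter> X1 = {}" "P0 \<notin> X0" "P0 \<notin> X1" "P0 \<notin> X2" "P0 \<noteq> P1"

text \<open>A frame abstracts three vertices \<open>P0\<close>, \<open>P1\<close>, \<open>P2\<close>, one of each colour, that arrive last and are placed
at the right: \<open>P0\<close> has arcs to everything in \<open>X2\<close> and receives arcs from everything
in \<open>X1\<close>, and similarly for the others.\<close>

locale frame = t0: frame_vertex T P0 P1 X0 X1 X2 a + t1: frame_vertex T P1 P2 X1 X2 X0 a
    + t2: frame_vertex T P2 P0 X2 X0 X1 a
  for T :: "'a \<Rightarrow> 'a \<Rightarrow> 'a \<Rightarrow> bool" and P0 P1 P2 X0 X1 X2 a +
  assumes PPP: "\<not> T P0 P1 P2"
    and X012: "u \<in> X0 \<Longrightarrow> v \<in> X1 \<Longrightarrow> w \<in> X2 \<Longrightarrow>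
      T u v w \<longleftrightarrow> \<not> (a u v \<and> a v w \<and> a w u) \<and> \<not> (a v u \<and> a w v \<and> a u w)"
begin

lemma T_comm: "T u v w \<longleftrightarrow> T v u w" "T u v w \<longleftrightarrow> T u w v"
  using t0.sym by blast+

lemma rotate: "frame T P1 P2 P0 X1 X2 X0 a"
proof
  show "\<not> T P1 P2 P0" using PPP T_comm by metis
  fix u v w assume *: "u \<in> X1" "v \<in> X2" "w \<in> X0"
  have "T u v w \<longleftrightarrow> T w u v" using T_comm by metis
  then show "T u v w \<longleftrightarrow> \<not> (a u v \<and> a v w \<and> a w u) \<and> \<not> (a v u \<and> a w v \<and> a u w)"
    using X012[OF *(3,1,2)] by blast
qed

lemma a_conv: "u \<in> X0 \<Longrightarrow> v \<in> X1 \<Longrightarrow> a v u \<longleftrightarrow> \<not> a u v" "u \<in> X1 \<Longrightarrow> v \<in> X2 \<Longrightarrow> a v u \<longleftrightarrow> \<not> a u v"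
  "u \<in> X0 \<Longrightarrow> v \<in> X2 \<Longrightarrow> a v u \<longleftrightarrow> \<not> a u v"
  using t0.a01 t1.a01 t2.a01 by metis+

lemma mirror_vertex: "frame_vertex T P0 P2 X2 X1 X0 a"
proof
  show "T u v w \<Longrightarrow> T v u w" "T u v w \<Longrightarrow> T u w v" for u v w using T_comm by metis+
  show "v \<in> X2 \<Longrightarrow> T P0 P2 v" "v \<in> X1 \<Longrightarrow> \<not> T P0 P2 v" "v \<in> X0 \<Longrightarrow> \<not> T P0 P2 v" for v
    using t2.PP T_comm by metis+
  show "u \<in> X2 \<Longrightarrow> v \<in> X0 \<Longrightarrow> \<not> T P0 u v" for u v
    using t0.L02 T_comm by metis
  show "u \<in> X2 \<Longrightarrow> v \<in> X1 \<Longrightarrow> a v u \<longleftrightarrow> \<not> a u v" for u v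
    using t1.a01 by metis
  show "X2 \<inter> X1 = {}" "P0 \<noteq> P2" using t1.disj t2.disj by auto
qed (use t0.L00 t0.L22 t0.L11 t0.L10 t0.L12 t2.X000 t2.X001 t2.X002 t0.disj in auto)

text \<open>If vertices that arrive last are placed at the left instead, the missing triples are the
same for suitable colours. Therefore frames have not only the rotations but also the reflections of a triangle
as symmetries, which halves the case analyses below.\<close>

lemma mirror: "frame T P0 P2 P1 X2 X1 X0 a"
proof -
  interpret r: frame T P1 P2 P0 X1 X2 X0 a by (rule rotate)
  interpret rr: frame T P2 P0 P1 X2 X0 X1 a by (rule r.rotate)
  have "\<not> T P0 P2 P1" using PPP T_comm by metis
  moreover have "T u v w \<longleftrightarrow> \<not> (a u v \<and> a v w \<and> a w u) \<and> \<not> (a v u \<and> a w v \<and> a u w)"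
    if "u \<in> X2" "v \<in> X1" "w \<in> X0" for u v w
  proof -
    have "T u v w \<longleftrightarrow> T w v u" using T_comm by metis
    then show ?thesis using X012[OF that(3,2,1)] by blast
  qed
  ultimately show ?thesis
    using mirror_vertex r.mirror_vertex rr.mirror_vertex by (intro frame.intro frame_axioms.intro)
qed

end

text \<open>Twins \<open>p\<close> and \<open>q\<close> can be swapped without changing the missing triples.\<close>

definition twin :: "('a \<Rightarrow> 'a \<Rightarrow> 'a \<Rightarrow> bool) \<Rightarrow> 'a set \<Rightarrow> 'a \<Rightarrow> 'a \<Rightarrow> bool" where
  "twin T V p q \<longleftrightarrow> (\<forall>u\<in>V - {p, q}. \<forall>v\<in>V - {p, q}. u \<noteq> v \<longrightarrow> (T p u v \<longleftrightarrow> T q u v))"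

text \<open>The traces that a frame \<open>Q\<close> leaves in the missing triples, without reference to the order
of its vertices, to colours or to arcs. The mark \<open>\<omega> u\<close> stands for the colour of \<open>u\<close>: it is the
vertex of \<open>Q\<close> that does not form missing triples with \<open>u\<close> and another vertex of \<open>Q\<close>. Vertices with
equal marks are joined by missing triples to the two other vertices of \<open>Q\<close>, vertices with different
marks to exactly one vertex of \<open>Q\<close>. Being formulated in terms of \<open>T\<close> only, this is
preserved by isomorphisms.\<close>

definition marks :: "('a \<Rightarrow> 'a \<Rightarrow> 'a \<Rightarrow> bool) \<Rightarrow> 'a set \<Rightarrow> 'a set \<Rightarrow> ('a \<Rightarrow> 'a) \<Rightarrow> bool" where
  "marks T V Q \<omega> \<longleftrightarrow> Q \<subseteq> V \<and> card Q = 3 \<and>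
     (\<forall>p\<in>Q. \<forall>q\<in>Q. \<forall>r\<in>Q. distinct [p, q, r] \<longrightarrow> \<not> T p q r) \<and>
     (\<forall>u\<in>V - Q. \<omega> u \<in> Q) \<and>
     (\<forall>u\<in>V - Q. \<forall>q\<in>Q. \<forall>r\<in>Q. q \<noteq> r \<longrightarrow> (T q r u \<longleftrightarrow> \<omega> u \<noteq> q \<and> \<omega> u \<noteq> r)) \<and>
     (\<forall>u\<in>V - Q. \<forall>v\<in>V - Q. u \<noteq> v \<longrightarrow> \<omega> u = \<omega> v \<longrightarrow> (\<forall>q\<in>Q. T q u v \<longleftrightarrow> q \<noteq> \<omega> u)) \<and>
     (\<forall>u\<in>V - Q. \<forall>v\<in>V - Q. \<omega> u \<noteq> \<omega> v \<longrightarrow> (\<exists>!q. q \<in> Q \<and> T q u v))"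

lemma marksD:
  assumes "marks T V Q \<omega>"
  shows "Q \<subseteq> V" "card Q = 3"
    and "p \<in> Q \<Longrightarrow> q \<in> Q \<Longrightarrow> r \<in> Q \<Longrightarrow> distinct [p, q, r] \<Longrightarrow> \<not> T p q r"
    and "u \<in> V - Q \<Longrightarrow> \<omega> u \<in> Q"
    and "u \<in> V - Q \<Longrightarrow> q \<in> Q \<Longrightarrow> r \<in> Q \<Longrightarrow> q \<noteq> r \<Longrightarrow> T q r u \<longleftrightarrow> \<omega> u \<noteq> q \<and> \<omega> u \<noteq> r"
    and "u \<in> V - Q \<Longrightarrow> v \<in> V - Q \<Longrightarrow> u \<noteq> v \<Longrightarrow> \<omega> u = \<omega> v \<Longrightarrow> q \<in> Q \<Longrightarrow> T q u v \<longleftrightarrow> q \<noteq> \<omega> u"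
    and "u \<in> V - Q \<Longrightarrow> v \<in> V - Q \<Longrightarrow> \<omega> u \<noteq> \<omega> v \<Longrightarrow> \<exists>!q. q \<in> Q \<and> T q u v"
proof -
  note m = assms[unfolded marks_def]
  note m2 = m[THEN conjunct2]
  note m3 = m2[THEN conjunct2]
  note m4 = m3[THEN conjunct2]
  note m5 = m4[THEN conjunct2]
  note m6 = m5[THEN conjunct2]
  note m7 = m6[THEN conjunct2]
  show "Q \<subseteq> V" by (rule m[THEN conjunct1])
  show "card Q = 3" by (rule m2[THEN conjunct1])
  show "p \<in> Q \<Longrightarrow> q \<in> Q \<Longrightarrow> r \<in> Q \<Longrightarrow> distinct [p, q, r] \<Longrightarrow> \<not> T p q r"
    by (rule m3[THEN conjunct1, rule_format])
  show "u \<in> V - Q \<Longrightarrow> \<omega> u \<in> Q" by (rule m4[THEN conjunct1, rule_format])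
  show "u \<in> V - Q \<Longrightarrow> q \<in> Q \<Longrightarrow> r \<in> Q \<Longrightarrow> q \<noteq> r \<Longrightarrow> T q r u \<longleftrightarrow> \<omega> u \<noteq> q \<and> \<omega> u \<noteq> r"
    by (rule m5[THEN conjunct1, rule_format])
  show "u \<in> V - Q \<Longrightarrow> v \<in> V - Q \<Longrightarrow> u \<noteq> v \<Longrightarrow> \<omega> u = \<omega> v \<Longrightarrow> q \<in> Q \<Longrightarrow> T q u v \<longleftrightarrow> q \<noteq> \<omega> u"
    by (rule m6[THEN conjunct1, rule_format])
  show "u \<in> V - Q \<Longrightarrow> v \<in> V - Q \<Longrightarrow> \<omega> u \<noteq> \<omega> v \<Longrightarrow> \<exists>!q. q \<in> Q \<and> T q u v"
    by (rule m7[rule_format])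
qed

context frame
begin

abbreviation V where "V \<equiv> {P0, P1, P2} \<union> X0 \<union> X1 \<union> X2"

lemma twin_sym_cases:
  assumes "\<And>u v. u \<in> V - {p, q} \<Longrightarrow> v \<in> V - {p, q} \<Longrightarrow> u \<noteq> v \<Longrightarrow> R u v \<or> R v u"
    and "\<And>u v. R u v \<Longrightarrow> u \<in> V - {p, q} \<Longrightarrow> v \<in> V - {p, q} \<Longrightarrow> u \<noteq> v \<Longrightarrow> T p u v \<longleftrightarrow> T q u v"
  shows "twin T V p q"
  unfolding twin_def using assms T_comm by metis

text \<open>A vertex that behaves towards everything else like one placed last at the right is a twin of
the frame vertex of its colour.\<close>

lemma twin_top:
  assumes q: "q \<in> X0" and "\<And>v. v \<in> X1 \<Longrightarrow> a v q" and "\<And>v. v \<in> X2 \<Longrightarrow> a q v"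
  shows "twin T V P0 q"
proof (rule twin_sym_cases[where R = "\<lambda>u v. u = P1 \<or> u = P2 \<and> v \<noteq> P1 \<or> u \<in> X0 \<and> v \<in> X0 \<union> X1 \<union> X2 \<or>
      u \<in> X1 \<and> v \<in> X1 \<union> X2 \<or> u \<in> X2 \<and> v \<in> X2"])
  note in1 = assms(2)
  note out2 = assms(3)
  have n1: "\<not> a q v" if "v \<in> X1" for v using in1 a_conv(1)[OF q that] that by blast
  have n2: "\<not> a v q" if "v \<in> X2" for v using out2 a_conv(3)[OF q that] that by blast
  fix u v assume R: "u = P1 \<or> u = P2 \<and> v \<noteq> P1 \<or> u \<in> X0 \<and> v \<in> X0 \<union> X1 \<union> X2 \<or>
      u \<in> X1 \<and> v \<in> X1 \<union> X2 \<or> u \<in> X2 \<and> v \<in> X2"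
    and uv: "u \<in> V - {P0, q}" "v \<in> V - {P0, q}" "u \<noteq> v"
  have "u = P1 \<and> v = P2 \<or> u = P1 \<and> v \<in> X0 \<or> u = P1 \<and> v \<in> X1 \<or> u = P1 \<and> v \<in> X2 \<or>
      u = P2 \<and> v \<in> X0 \<or> u = P2 \<and> v \<in> X1 \<or> u = P2 \<and> v \<in> X2 \<or>
      u \<in> X0 \<and> v \<in> X0 \<or> u \<in> X0 \<and> v \<in> X1 \<or> u \<in> X0 \<and> v \<in> X2 \<or>
      u \<in> X1 \<and> v \<in> X1 \<or> u \<in> X1 \<and> v \<in> X2 \<or> u \<in> X2 \<and> v \<in> X2"
    using R uv(2,3) by (elim disjE conjE) auto
  then show "T P0 u v \<longleftrightarrow> T q u v"
  proof (elim disjE conjE, goal_cases)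
    case 1
    then have "\<not> T P1 P2 q" using t1.PP(3) q by blast
    then show ?thesis using 1 PPP T_comm by metis
  next
    case 2
    then have "T P0 P1 v" "T P1 q v" using t0.PP(1) t1.L22 q uv by auto
    then show ?thesis using 2 T_comm by metis
  next
    case 3
    then have "\<not> T P0 P1 v" "\<not> T P1 v q" using t0.PP(2) t1.L02 q by auto
    then show ?thesis using 3 T_comm by metis
  next
    case 4
    then have "\<not> T P0 P1 v" "\<not> T P1 v q" using t0.PP(3) t1.L12 q n2 by auto
    then show ?thesis using 4 T_comm by metis
  next
    case 5
    then have "\<not> T P2 P0 v" "\<not> T P2 q v" using t2.PP(2) t2.L11 q by auto
    then show ?thesis using 5 T_comm by metis
  next
    case 6
    then have "\<not> T P2 P0 v" "\<not> T P2 q v" using t2.PP(3) t2.L12[OF q] n1 by auto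
    then show ?thesis using 6 T_comm by metis
  next
    case 7
    then have "T P2 P0 v" "T P2 q v" using t2.PP(1) t2.L10[OF q] out2 by auto
    then show ?thesis using 7 T_comm by metis
  next
    case 8
    then have "T P0 u v" "T q u v" using t0.L00 t0.X000[of q u v] q uv by auto
    then show ?thesis by simp
  next
    case 9
    then have "T P0 v u \<longleftrightarrow> a v u" "T q u v \<longleftrightarrow> a v q \<and> a v u" using t0.L10 t0.X001[of q u v] q uv by auto
    then show ?thesis using in1[OF 9(2)] T_comm by metis
  next
    case 10
    then have "\<not> T P0 u v" "T q u v \<longleftrightarrow> a v q \<and> a v u" using t0.L02 t0.X002[of q u v] q uv by auto
    then show ?thesis using n2[OF 10(2)] by metis
  next
    case 11
    then have "\<not> T P0 u v" "T u v q \<longleftrightarrow> a q u \<and> a q v" using t0.L11 t1.X002[of u v q] q uv by auto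
    then show ?thesis using n1[OF 11(1)] T_comm by metis
  next
    case 12
    then have "T P0 u v \<longleftrightarrow> a u v" using t0.L12 by auto
    then show ?thesis using X012[OF q 12] in1[OF 12(1)] out2[OF 12(2)] n1[OF 12(1)] a_conv(2)[OF 12] by auto
  next
    case 13
    then have "T P0 u v" "T u v q \<longleftrightarrow> a q u \<and> a q v" using t0.L22 t2.X001[of u v q] q uv by auto
    then show ?thesis using out2 13 T_comm by metis
  qed
qed blast

lemma distinct_points: "P0 \<noteq> P1" "P1 \<noteq> P2" "P0 \<noteq> P2"
  "X0 \<inter> X1 = {}" "X1 \<inter> X2 = {}" "X0 \<inter> X2 = {}"
  "{P0, P1, P2} \<inter> X0 = {}" "{P0, P1, P2} \<inter> X1 = {}" "{P0, P1, P2} \<inter> X2 = {}"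
  using t0.disj t1.disj t2.disj by auto

lemma twin_top1:
  assumes "q \<in> X1" "\<And>v. v \<in> X2 \<Longrightarrow> a v q" "\<And>v. v \<in> X0 \<Longrightarrow> a q v"
  shows "twin T V P1 q"
proof -
  interpret r: frame T P1 P2 P0 X1 X2 X0 a by (rule rotate)
  have "r.V = V" by auto
  then show ?thesis using r.twin_top[OF assms] by simp
qed

text \<open>In the next lemmas, \<open>Q\<close> is a triple that carries marks, and differs from the frame. The marks
of the frame vertices outside \<open>Q\<close> can be computed, and comparing them with those of the other vertices determines
all arcs at the moved vertices; one of these turns out to be a twin of a frame vertex. Here a single frame
vertex has been replaced.\<close>

lemma one_moved:
  assumes good: "marks T V {P1, P2, q} \<omega>" and q: "q \<in> X0"
  shows "twin T V P0 q"
proof (rule twin_top[OF q])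
  let ?Q = "{P1, P2, q}"
  note w0 = marksD(4)[OF good] and w3 = marksD(5)[OF good] and w1 = marksD(6)[OF good] and w2 = marksD(7)[OF good]
  note dp = distinct_points
  have qn: "q \<noteq> P0" "q \<noteq> P1" "q \<noteq> P2" using q dp by auto
  have P0: "P0 \<in> V - ?Q" using dp qn by auto
  have "T P0 P1 q" using t0.PP(1) q by blast
  then have "T P1 q P0" using T_comm by metis
  then have wP: "\<omega> P0 = P2" using w3[OF P0, of P1 q] w0[OF P0] qn by auto
  {
    fix v assume v: "v \<in> X1"
    then have vV: "v \<in> V - ?Q" using dp q by auto
    have "T P1 P2 v" using t1.PP(1) v by blast
    then have "\<omega> v = q" using w3[OF vV, of P1 P2] w0[OF vV] dp by auto
    then obtain q' where q': "q' \<in> ?Q" "T q' P0 v" using w2[OF P0 vV] wP qn by auto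
    have "\<not> T P1 P0 v" "\<not> T P2 P0 v" using t0.PP(2) t2.PP(3) v T_comm(1)[of P1 P0] by blast+
    then have "T q P0 v" using q' by auto
    then have "T P0 v q" using T_comm by metis
    then show "a v q" using t0.L10[OF v q] by blast
  next
    fix v assume v: "v \<in> X2"
    then have vV: "v \<in> V - ?Q" using dp q by auto
    have ne: "P0 \<noteq> v" using v dp by auto
    show "a q v"
    proof (rule ccontr)
      assume "\<not> a q v"
      then have "a v q" using a_conv(3)[OF q v] by blast
      then have "T P1 v q" using t1.L12[OF v q] by blast
      then have "T P1 q v" using T_comm by metis
      then have "\<omega> v = P2" using w3[OF vV, of P1 q] w0[OF vV] qn by auto
      then have "T q P0 v" using w1[OF P0 vV ne, of q] wP qn by auto
      then have "T P0 q v" using T_comm by metis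
      then show False using t0.L02[OF q v] by blast
    qed
  }
qed

lemma two_moved_12:
  assumes good: "marks T V {P0, q, r} \<omega>" and q: "q \<in> X1" and r: "r \<in> X2"
  shows "twin T V P1 q"
proof (rule twin_top1[OF q])
  let ?Q = "{P0, q, r}"
  note w0 = marksD(4)[OF good] and w3 = marksD(5)[OF good] and w1 = marksD(6)[OF good]
  note dp = distinct_points
  have n: "q \<noteq> P0" "q \<noteq> P1" "q \<noteq> P2" "r \<noteq> P0" "r \<noteq> P1" "r \<noteq> P2" "q \<noteq> r" using q r dp by auto
  have P1: "P1 \<in> V - ?Q" using dp n by auto
  have "\<not> T P0 q r" using marksD(3)[OF good, of P0 q r] n by auto
  then have rq: "a r q" using t0.L12[OF q r] a_conv(2)[OF q r] by blast
  then have "T P1 r q" using t1.L10[OF r q] by blast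
  then have "T q r P1" using T_comm by metis
  then have wP: "\<omega> P1 = P0" using w3[OF P1, of q r] w0[OF P1] n by auto
  {
    fix v assume v: "v \<in> X2"
    show "a v q"
    proof (cases "v = r")
      case False
      then have vV: "v \<in> V - ?Q" using v dp q by auto
      have "T P0 r v" using t0.L22[OF r v] False by blast
      then have "\<omega> v = q" using w3[OF vV, of P0 r] w0[OF vV] n by auto
      then have "\<not> T P0 q v" using w3[OF vV, of P0 q] n by auto
      then show ?thesis using t0.L12[OF q v] a_conv(2)[OF q v] by blast
    qed (use rq in simp)
  next
    fix v assume v: "v \<in> X0"
    then have vV: "v \<in> V - ?Q" using dp q r by auto
    have ne: "P1 \<noteq> v" using v dp by auto
    show "a q v"
    proof (rule ccontr)
      assume "\<not> a q v"
      then have "\<not> T P0 q v" using t0.L10[OF q v] by blast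
      moreover have "\<not> T P0 r v" using t0.L02[OF v r] T_comm(2)[of P0] by blast
      ultimately have "\<omega> v = P0" using w3[OF vV, of P0 q] w3[OF vV, of P0 r] n by auto
      then have "T q P1 v" using w1[OF P1 vV ne, of q] wP n by auto
      then have "T P1 q v" using T_comm by metis
      then show False using t1.L02[OF q v] by blast
    qed
  }
qed

lemma two_moved_02:
  assumes good: "marks T V {P0, q, r} \<omega>" and q: "q \<in> X0" and r: "r \<in> X2"
  shows False
proof -
  let ?Q = "{P0, q, r}"
  note w0 = marksD(4)[OF good] and w3 = marksD(5)[OF good]
  note dp = distinct_points
  have n: "q \<noteq> P0" "q \<noteq> P1" "q \<noteq> P2" "r \<noteq> P0" "r \<noteq> P1" "r \<noteq> P2" "q \<noteq> r" using q r dp by auto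
  have P: "P1 \<in> V - ?Q" "P2 \<in> V - ?Q" using dp n by auto
  have "T P0 P1 q" "T P2 P0 r" using t0.PP(1) q t2.PP(1) r by blast+
  then have 1: "T P0 q P1" "T P0 r P2" using T_comm by metis+
  have "a r q \<or> a q r" using a_conv(3)[OF q r] by blast
  then have "T P1 r q \<or> T P2 q r" using t1.L12[OF r q] t2.L10[OF q r] by blast
  then have "T q r P1 \<or> T q r P2" using T_comm by metis
  then show False
    using 1 w3[OF P(1), of P0 q] w3[OF P(1), of q r] w3[OF P(2), of P0 r] w3[OF P(2), of q r]
      w0[OF P(1)] w0[OF P(2)] n by auto
qed

text \<open>Two moved vertices of equal colour: one of them behaves as if placed last at the right, the other
as if placed last at the left. Which is which is decided by the vertices in \<open>X0\<close> and \<open>X2\<close>, so these classes must not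
be empty.\<close>

lemma two_moved_11:
  assumes good: "marks T V {P0, q, r} \<omega>" and q: "q \<in> X1" and r: "r \<in> X1" and qr: "q \<noteq> r"
    and ne: "X0 \<noteq> {}" "X2 \<noteq> {}"
  shows "twin T V P1 q \<or> twin T V P1 r"
proof -
  let ?Q = "{P0, q, r}"
  note w0 = marksD(4)[OF good] and w3 = marksD(5)[OF good] and w1 = marksD(6)[OF good]
  note dp = distinct_points
  have n: "q \<noteq> P0" "q \<noteq> P1" "q \<noteq> P2" "r \<noteq> P0" "r \<noteq> P1" "r \<noteq> P2" using q r dp by auto
  have P: "P1 \<in> V - ?Q" "P2 \<in> V - ?Q" using dp n by auto
  have "T P1 q r" "T P2 q r" using t1.L00[OF q r qr] t2.L22[OF q r qr] by blast+
  then have "T q r P1" "T q r P2" using T_comm by metis+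
  then have wP: "\<omega> P1 = P0" "\<omega> P2 = P0"
    using w3[OF P(1), of q r] w0[OF P(1)] w3[OF P(2), of q r] w0[OF P(2)] n qr by auto
  have inV: "v \<in> V - ?Q" if "v \<in> X0 \<union> X2" for v using that dp q r by auto
  have "\<omega> v \<noteq> P0" if v: "v \<in> X0" for v
  proof
    assume "\<omega> v = P0"
    then have "T q P1 v" using w1[OF P(1) inV, of v q] wP n v dp by auto
    then have "T P1 q v" using T_comm by metis
    then show False using t1.L02[OF q v] by blast
  qed
  moreover have "\<omega> v \<noteq> P0" if v: "v \<in> X2" for v
  proof
    assume "\<omega> v = P0"
    then have "T q P2 v" using w1[OF P(2) inV, of v q] wP n v dp by auto
    then have "T P2 v q" using T_comm by metis
    then show False using t2.L02[OF v q] by blast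
  qed
  ultimately have wqr: "\<omega> v = q \<or> \<omega> v = r" if "v \<in> X0 \<union> X2" for v
    using that w0[OF inV[OF that]] by auto
  \<comment> \<open>No missing triple contains \<open>P0\<close> and vertices from both \<open>X0\<close> and \<open>X2\<close>.\<close>
  have diff: "\<omega> u \<noteq> \<omega> v" if "u \<in> X0" "v \<in> X2" for u v
  proof
    assume e: "\<omega> u = \<omega> v"
    have "u \<noteq> v" using that dp by auto
    then have "T P0 u v" using w1[of u v P0] inV[of u] inV[of v] wqr[of u] e that n by auto
    then show False using t0.L02[OF that] by blast
  qed
  obtain x where x: "x \<in> X0" using ne by blast
  obtain y where y: "y \<in> X2" using ne by blast
  have top: "twin T V P1 s" if s: "s \<in> {q, r}" "\<omega> y = s" for s
  proof (rule twin_top1)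
    show sX: "s \<in> X1" using s q r by auto
    have sP: "s \<noteq> P0" using s n by auto
    fix v
    { assume v: "v \<in> X2"
      have "\<omega> v = s" using diff[OF x v] diff[OF x y] wqr[of x] wqr[of v] wqr[of y] x v y s by auto
      then have "\<not> T P0 s v" using w3[OF inV, of v P0 s] v s sP by auto
      then show "a v s" using t0.L12[OF sX v] a_conv(2)[OF sX v] by blast
    next
      assume v: "v \<in> X0"
      have "\<omega> v \<noteq> s" using diff[OF v y] s by auto
      moreover have "\<omega> v \<noteq> P0" using wqr[of v] v n by auto
      ultimately have "T P0 s v" using w3[OF inV, of v P0 s] v s sP by auto
      then show "a s v" using t0.L10[OF sX v] by blast
    }
  qed
  show ?thesis using top wqr[of y] y by blast
qed

text \<open>The three moved vertices are cyclically joined like the frame vertices. The other direction is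
reduced to this one by reflection.\<close>

lemma three_moved:
  assumes good: "marks T V {q0, q1, q2} \<omega>" and q: "q0 \<in> X0" "q1 \<in> X1" "q2 \<in> X2"
    and cyc: "a q1 q0" "a q0 q2" "a q2 q1"
  shows "twin T V P1 q1"
proof -
  let ?Q = "{q0, q1, q2}"
  note w0 = marksD(4)[OF good] and w3 = marksD(5)[OF good] and w1 = marksD(6)[OF good]
  note dp = distinct_points
  have n: "q0 \<noteq> q1" "q1 \<noteq> q2" "q0 \<noteq> q2" "{P0, P1, P2} \<inter> ?Q = {}" using q dp by auto
  have P1: "P1 \<in> V - ?Q" using n by auto
  have "T P1 q2 q1" using t1.L10[OF q(3,2)] cyc by blast
  then have "T q1 q2 P1" using T_comm by metis
  then have wP: "\<omega> P1 = q0" using w3[OF P1, of q1 q2] w0[OF P1] n by auto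
  \<comment> \<open>The marks of \<open>P1\<close> and \<open>v\<close> differ, for otherwise \<open>q1\<close> would form a missing triple with
    them, which the frame rules out.\<close>
  have X0: "a q1 v \<and> a v q2" if v: "v \<in> X0" "v \<noteq> q0" for v
  proof -
    have vV: "v \<in> V - ?Q" using v q dp by auto
    have t01: "T q0 q1 v \<longleftrightarrow> a q1 v"
      using t0.X001[OF q(1) v(1) q(2)] v(2) cyc T_comm(2)[of q0 q1 v] by auto
    have t02: "\<not> T q0 q2 v"
      using t0.X002[OF q(1) v(1) q(3)] v(2) cyc a_conv(3)[OF q(1,3)] T_comm(2)[of q0 q2 v] by auto
    have "a q1 v"
    proof (rule ccontr)
      assume "\<not> a q1 v"
      then have "\<omega> v = q0" using t01 t02 w3[OF vV, of q0 q1] w3[OF vV, of q0 q2] n by auto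
      then have "T q1 P1 v" using w1[OF P1 vV, of q1] wP n v dp by auto
      then have "T P1 q1 v" using T_comm by metis
      then show False using t1.L02[OF q(2) v(1)] by blast
    qed
    moreover have "\<omega> v = q2" using t01 calculation w3[OF vV, of q0 q1] w0[OF vV] n by auto
    then have "\<not> T q1 q2 v" using w3[OF vV, of q1 q2] n by auto
    then have "\<not> T v q1 q2" using T_comm by metis
    then have "a v q2" using X012[OF v(1) q(2,3)] calculation a_conv(1)[OF v(1) q(2)] by auto
    ultimately show ?thesis by blast
  qed
  have X2: "a v q1" if v: "v \<in> X2" "v \<noteq> q2" for v
  proof -
    have vV: "v \<in> V - ?Q" using v q dp by auto
    have P0: "P0 \<in> V - ?Q" using n by auto
    have "T P0 q1 q0" using t0.L10[OF q(2,1)] cyc by blast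
    then have "T q0 q1 P0" using T_comm by metis
    then have wP0: "\<omega> P0 = q2" using w3[OF P0, of q0 q1] w0[OF P0] n by auto
    have t20: "T q2 q0 v \<longleftrightarrow> a q0 v"
      using t2.X001[OF q(3) v(1) q(1)] v(2) cyc T_comm(2)[of q2 q0 v] by auto
    have t21: "\<not> T q2 q1 v"
      using t2.X002[OF q(3) v(1) q(2)] v(2) cyc a_conv(2)[OF q(2,3)] T_comm(2)[of q2 q1 v] by auto
    have "a q0 v"
    proof (rule ccontr)
      assume "\<not> a q0 v"
      then have "\<omega> v = q2" using t20 t21 w3[OF vV, of q2 q0] w3[OF vV, of q2 q1] n by auto
      then have "T q0 P0 v" using w1[OF P0 vV, of q0] wP0 n v dp by auto
      then have "T P0 q0 v" using T_comm by metis
      then show False using t0.L02[OF q(1) v(1)] by blast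
    qed
    moreover have "\<omega> v = q1" using t20 calculation w3[OF vV, of q2 q0] w0[OF vV] n by auto
    then have "\<not> T q0 q1 v" using w3[OF vV, of q0 q1] n by auto
    then show ?thesis using X012[OF q(1,2) v(1)] calculation a_conv(3)[OF q(1) v(1)] by auto
  qed
  show ?thesis by (rule twin_top1[OF q(2)]) (use X0 X2 cyc in blast)+
qed

lemma three_moved_any:
  assumes good: "marks T V {q0, q1, q2} \<omega>" and q: "q0 \<in> X0" "q1 \<in> X1" "q2 \<in> X2"
  shows "twin T V P1 q1 \<or> twin T V P2 q1"
proof -
  note dp = distinct_points
  have "\<not> T q0 q1 q2" by (rule marksD(3)[OF good]) (use q dp in auto)
  then consider "a q1 q0" "a q0 q2" "a q2 q1" | "a q0 q1" "a q2 q0" "a q1 q2"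
    using X012[OF q] by blast
  then show ?thesis
  proof cases
    case 1 then show ?thesis using three_moved[OF good q] by blast
  next
    case 2
    interpret m: frame T P0 P2 P1 X2 X1 X0 a by (rule mirror)
    have e: "m.V = V" by auto
    have "marks T m.V {q2, q1, q0} \<omega>" using good unfolding e by (simp add: insert_commute)
    from m.three_moved[OF this q(3,2,1)] 2 show ?thesis unfolding e by blast
  qed
qed

definition exchangeable where
  "exchangeable Q \<longleftrightarrow> (\<exists>p\<in>{P0, P1, P2} - Q. \<exists>q\<in>Q - {P0, P1, P2}. twin T V p q)"

lemma exchangeable_one:
  assumes good: "marks T V Q \<omega>" and Q: "P0 \<notin> Q" "P1 \<in> Q" "P2 \<in> Q"
  shows "exchangeable Q"
proof -
  note dp = distinct_points
  have "card (Q - {P1, P2}) = 1" using marksD(2)[OF good] Q dp by (simp add: card_Diff_subset)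
  then obtain q where qd: "Q - {P1, P2} = {q}" by (auto simp: card_1_singleton_iff)
  then have Qe: "Q = {P1, P2, q}" and qn: "q \<noteq> P1" "q \<noteq> P2" using Q by auto
  have "q \<in> V" using marksD(1)[OF good] Qe by auto
  moreover have "q \<notin> X1"
  proof
    assume "q \<in> X1"
    then have "T P1 P2 q" using t1.PP(1) by blast
    then show False using marksD(3)[OF good, of P1 P2 q] Qe qn dp by auto
  qed
  ultimately consider "q \<in> X0" | "q \<in> X2" using qn Qe Q by auto
  then have "twin T V P0 q"
  proof cases
    case 1 then show ?thesis using one_moved good unfolding Qe by blast
  next
    case 2
    interpret m: frame T P0 P2 P1 X2 X1 X0 a by (rule mirror)
    have e: "m.V = V" by auto
    have "marks T m.V {P2, P1, q} \<omega>" using good unfolding e Qe by (simp add: insert_commute)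
    from m.one_moved[OF this 2] show ?thesis unfolding e .
  qed
  then show ?thesis unfolding exchangeable_def using Qe qn Q by auto
qed

lemma exchangeable_two:
  assumes good: "marks T V Q \<omega>" and Q: "P0 \<in> Q" "P1 \<notin> Q" "P2 \<notin> Q" and ne: "X0 \<noteq> {}" "X2 \<noteq> {}"
  shows "exchangeable Q"
proof -
  note dp = distinct_points
  have "card (Q - {P0}) = 2" using marksD(2)[OF good] Q by simp
  then obtain q r where qd: "Q - {P0} = {q, r}" and qr: "q \<noteq> r" by (auto simp: card_2_iff)
  then have Qe: "Q = {P0, q, r}" and n: "q \<noteq> P0" "r \<noteq> P0" using Q by auto
  have qrV: "q \<in> X0 \<union> X1 \<union> X2" "r \<in> X0 \<union> X1 \<union> X2" using marksD(1)[OF good] Qe Q n by auto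
  interpret m: frame T P0 P2 P1 X2 X1 X0 a by (rule mirror)
  have e: "m.V = V" by auto
  have g: "marks T V {P0, q, r} \<omega>" "marks T V {P0, r, q} \<omega>"
    using good unfolding Qe by (simp_all add: insert_commute)
  note g' = g[folded e]
  have face: "\<not> T P0 q r" "\<not> T P0 r q" using marksD(3)[OF good] Qe n qr by auto
  then have "\<not> (q \<in> X0 \<and> r \<in> X0)" "\<not> (q \<in> X2 \<and> r \<in> X2)"
    using t0.L00 t0.L22 qr by blast+
  then consider "q \<in> X1" "r \<in> X1" | "q \<in> X1" "r \<in> X2" | "q \<in> X2" "r \<in> X1" | "q \<in> X1" "r \<in> X0"
    | "q \<in> X0" "r \<in> X1" | "q \<in> X0" "r \<in> X2" | "q \<in> X2" "r \<in> X0" using qrV by blast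
  then have "\<exists>p\<in>{P1, P2}. \<exists>s\<in>{q, r}. twin T V p s"
  proof cases
    case 1 then show ?thesis using two_moved_11[OF g(1) _ _ qr ne] by blast
  next
    case 2 then show ?thesis using two_moved_12[OF g(1)] by blast
  next
    case 3 then show ?thesis using two_moved_12[OF g(2)] by blast
  next
    case 4 then show ?thesis using m.two_moved_12[OF g'(1)] unfolding e by blast
  next
    case 5 then show ?thesis using m.two_moved_12[OF g'(2)] unfolding e by blast
  next
    case 6 then show ?thesis using two_moved_02[OF g(1)] by blast
  next
    case 7 then show ?thesis using two_moved_02[OF g(2)] by blast
  qed
  then obtain p s where ps: "p \<in> {P1, P2}" "s \<in> {q, r}" "twin T V p s" by blast
  then have "p \<in> {P0, P1, P2} - Q" "s \<in> Q - {P0, P1, P2}" using Q Qe qrV dp by auto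
  then show ?thesis unfolding exchangeable_def using ps(3) by blast
qed

text \<open>Two frame vertices outside \<open>Q\<close> must be covered by a missing triple with a vertex of \<open>Q\<close>, which
lies in the class determined by these two. So \<open>Q\<close> has one vertex of each colour.\<close>

lemma exchangeable_three:
  assumes good: "marks T V Q \<omega>" and Q: "P0 \<notin> Q" "P1 \<notin> Q" "P2 \<notin> Q"
  shows "exchangeable Q"
proof -
  note dp = distinct_points
  have P: "P0 \<in> V - Q" "P1 \<in> V - Q" "P2 \<in> V - Q" using Q by auto
  have cov: "\<exists>q\<in>Q. T q u v" if "u \<in> V - Q" "v \<in> V - Q" "u \<noteq> v" for u v
  proof (cases "\<omega> u = \<omega> v")
    case True
    have "\<not> Q \<subseteq> {\<omega> u}" using marksD(2)[OF good] card_mono[of "{\<omega> u}" Q] by auto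
    then obtain q where "q \<in> Q" "q \<noteq> \<omega> u" by blast
    then show ?thesis using marksD(6)[OF good that True] by blast
  next
    case False then show ?thesis using marksD(7)[OF good that(1,2)] by blast
  qed
  have QX: "Q \<subseteq> X0 \<union> X1 \<union> X2" using marksD(1)[OF good] Q by auto
  obtain q0 where q0: "q0 \<in> Q" "T q0 P0 P1" using cov[OF P(1,2) dp(1)] by blast
  obtain q1 where q1: "q1 \<in> Q" "T q1 P1 P2" using cov[OF P(2,3) dp(2)] by blast
  obtain q2 where q2: "q2 \<in> Q" "T q2 P2 P0" using cov[OF P(3,1) dp(3)[symmetric]] by blast
  have "T P0 P1 q0" "T P1 P2 q1" "T P2 P0 q2" using q0 q1 q2 T_comm by metis+
  then have "q0 \<notin> X1 \<union> X2" "q1 \<notin> X2 \<union> X0" "q2 \<notin> X0 \<union> X1"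
    using t0.PP(2,3) t1.PP(2,3) t2.PP(2,3) by auto
  then have q: "q0 \<in> Q" "q1 \<in> Q" "q2 \<in> Q" "q0 \<in> X0" "q1 \<in> X1" "q2 \<in> X2"
    using QX q0 q1 q2 by auto
  have "q0 \<noteq> q1" "q1 \<noteq> q2" "q0 \<noteq> q2" using q(4-6) dp(4-6) by blast+
  then have "card {q0, q1, q2} = 3" by simp
  then have "{q0, q1, q2} = Q"
    using marksD(2)[OF good] q by (intro card_subset_eq) (auto intro: card_ge_0_finite)
  then have "twin T V P1 q1 \<or> twin T V P2 q1" using three_moved_any good q by blast
  then obtain p where ps: "p \<in> {P1, P2}" "twin T V p q1" by blast
  then have "p \<in> {P0, P1, P2} - Q" "q1 \<in> Q - {P0, P1, P2}" using Q q dp by auto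
  then show ?thesis unfolding exchangeable_def using ps(2) by blast
qed

text \<open>Any other triple that looks like a frame is obtained from the frame by replacing vertices by twins; this gives
the first such vertex.\<close>

lemma exchange:
  assumes good: "marks T V Q \<omega>" and ne: "X0 \<noteq> {}" "X1 \<noteq> {}" "X2 \<noteq> {}" and Q: "Q \<noteq> {P0, P1, P2}"
  shows "\<exists>p\<in>{P0, P1, P2} - Q. \<exists>q\<in>Q - {P0, P1, P2}. twin T V p q"
proof -
  interpret r: frame T P1 P2 P0 X1 X2 X0 a by (rule rotate)
  interpret rr: frame T P2 P0 P1 X2 X0 X1 a by (rule r.rotate)
  have e: "r.V = V" "rr.V = V" by auto
  have s: "{P1, P2, P0} = {P0, P1, P2}" "{P2, P0, P1} = {P0, P1, P2}" by auto
  note g = good[folded e(1)] good[folded e(2)]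
  have "card {P0, P1, P2} = 3" using distinct_points(1-3) by simp
  then have "\<not> {P0, P1, P2} \<subseteq> Q"
    using marksD(2)[OF good] Q by (metis card_ge_0_finite card_subset_eq zero_less_numeral)
  then have "P0 \<notin> Q \<and> P1 \<in> Q \<and> P2 \<in> Q \<or> P1 \<notin> Q \<and> P2 \<in> Q \<and> P0 \<in> Q \<or> P2 \<notin> Q \<and> P0 \<in> Q \<and> P1 \<in> Q
    \<or> P0 \<in> Q \<and> P1 \<notin> Q \<and> P2 \<notin> Q \<or> P1 \<in> Q \<and> P2 \<notin> Q \<and> P0 \<notin> Q \<or> P2 \<in> Q \<and> P0 \<notin> Q \<and> P1 \<notin> Q
    \<or> P0 \<notin> Q \<and> P1 \<notin> Q \<and> P2 \<notin> Q" by auto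
  then have "exchangeable Q \<or> r.exchangeable Q \<or> rr.exchangeable Q"
  proof (elim disjE conjE, goal_cases)
    case 1 then show ?case using exchangeable_one[OF good] by simp
  next
    case 2 then show ?case using r.exchangeable_one[OF g(1)] by simp
  next
    case 3 then show ?case using rr.exchangeable_one[OF g(2)] by simp
  next
    case 4 then show ?case using exchangeable_two[OF good] ne by simp
  next
    case 5 then show ?case using r.exchangeable_two[OF g(1)] ne by simp
  next
    case 6 then show ?case using rr.exchangeable_two[OF g(2)] ne by simp
  next
    case 7 then show ?case using exchangeable_three[OF good] by simp
  qed
  moreover have "{P0, P1, P2} \<union> X1 \<union> X2 \<union> X0 = V" "{P0, P1, P2} \<union> X2 \<union> X0 \<union> X1 = V" by auto
  ultimately show ?thesis unfolding exchangeable_def r.exchangeable_def rr.exchangeable_def s by simp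
qed

lemma pair01: "u \<in> X0 \<Longrightarrow> v \<in> X1 \<Longrightarrow> T P0 u v \<longleftrightarrow> a v u" "u \<in> X0 \<Longrightarrow> v \<in> X1 \<Longrightarrow> \<not> T P1 u v"
  "u \<in> X0 \<Longrightarrow> v \<in> X1 \<Longrightarrow> T P2 u v \<longleftrightarrow> a u v"
  using t0.L10[of v u] t1.L02[of v u] t2.L12[of u v] T_comm(2) by blast+

text \<open>The marks of the frame itself: \<open>mark u\<close> is the frame vertex whose missing triples record the arcs
that leave the class of \<open>u\<close>.\<close>

definition mark where "mark u = (if u \<in> X0 then P2 else if u \<in> X1 then P0 else P1)"

lemma mark_simps: "u \<in> X0 \<Longrightarrow> mark u = P2" "u \<in> X1 \<Longrightarrow> mark u = P0" "u \<in> X2 \<Longrightarrow> mark u = P1"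
  using distinct_points unfolding mark_def by auto

lemma mark_arc:
  assumes "u \<in> X0 \<union> X1 \<union> X2" "v \<in> X0 \<union> X1 \<union> X2" "mark u \<noteq> mark v"
  shows "T (mark u) u v \<longleftrightarrow> a u v"
proof -
  interpret r: frame T P1 P2 P0 X1 X2 X0 a by (rule rotate)
  interpret rr: frame T P2 P0 P1 X2 X0 X1 a by (rule r.rotate)
  have u3: "u \<in> X0 \<or> u \<in> X1 \<or> u \<in> X2" and v3: "v \<in> X0 \<or> v \<in> X1 \<or> v \<in> X2" using assms by auto
  have "u \<in> X0 \<and> v \<in> X1 \<or> u \<in> X1 \<and> v \<in> X2 \<or> u \<in> X2 \<and> v \<in> X0 \<or>
      v \<in> X0 \<and> u \<in> X1 \<or> v \<in> X1 \<and> u \<in> X2 \<or> v \<in> X2 \<and> u \<in> X0"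
    using u3 v3 assms(3) by (auto simp: mark_simps)
  then show ?thesis
  proof (elim disjE conjE)
    assume "u \<in> X0" "v \<in> X1" then show ?thesis using pair01(3)[of u v] by (simp add: mark_simps)
  next
    assume "u \<in> X1" "v \<in> X2" then show ?thesis using r.pair01(3)[of u v] by (simp add: mark_simps)
  next
    assume "u \<in> X2" "v \<in> X0" then show ?thesis using rr.pair01(3)[of u v] by (simp add: mark_simps)
  next
    assume "v \<in> X0" "u \<in> X1" then show ?thesis using pair01(1)[of v u] T_comm(2)[of _ u v] by (simp add: mark_simps)
  next
    assume "v \<in> X1" "u \<in> X2" then show ?thesis using r.pair01(1)[of v u] T_comm(2)[of _ u v] by (simp add: mark_simps)
  next
    assume "v \<in> X2" "u \<in> X0" then show ?thesis using rr.pair01(1)[of v u] T_comm(2)[of _ u v] by (simp add: mark_simps)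
  qed
qed

lemma marks_mark: "marks T V {P0, P1, P2} mark"
  unfolding marks_def
proof (intro conjI ballI impI)
  interpret r: frame T P1 P2 P0 X1 X2 X0 a by (rule rotate)
  interpret rr: frame T P2 P0 P1 X2 X0 X1 a by (rule r.rotate)
  note dp = distinct_points
  show "{P0, P1, P2} \<subseteq> V" by auto
  show "card {P0, P1, P2} = 3" using dp(1-3) by simp
  show "\<not> T p q r" if "p \<in> {P0, P1, P2}" "q \<in> {P0, P1, P2}" "r \<in> {P0, P1, P2}" "distinct [p, q, r]" for p q r
  proof -
    have "\<not> T P0 P2 P1" "\<not> T P1 P0 P2" "\<not> T P1 P2 P0" "\<not> T P2 P0 P1" "\<not> T P2 P1 P0"
      using PPP T_comm by metis+
    then show ?thesis using PPP that by auto
  qed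
  fix u assume u: "u \<in> V - {P0, P1, P2}"
  then have u3: "u \<in> X0 \<or> u \<in> X1 \<or> u \<in> X2" by auto
  show "mark u \<in> {P0, P1, P2}" unfolding mark_def by simp
  {
    fix q r assume qr: "q \<in> {P0, P1, P2}" "r \<in> {P0, P1, P2}" "q \<noteq> r"
    have s: "T P1 P0 u = T P0 P1 u" "T P2 P1 u = T P1 P2 u" "T P0 P2 u = T P2 P0 u" using T_comm by metis+
    from u3 show "T q r u \<longleftrightarrow> mark u \<noteq> q \<and> mark u \<noteq> r"
    proof (elim disjE)
      assume "u \<in> X0"
      then show ?thesis using qr s t0.PP(1)[of u] t1.PP(3)[of u] t2.PP(2)[of u] dp(1-3) by (auto simp: mark_simps)
    next
      assume "u \<in> X1"
      then show ?thesis using qr s t0.PP(2)[of u] t1.PP(1)[of u] t2.PP(3)[of u] dp(1-3) by (auto simp: mark_simps)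
    next
      assume "u \<in> X2"
      then show ?thesis using qr s t0.PP(3)[of u] t1.PP(2)[of u] t2.PP(1)[of u] dp(1-3) by (auto simp: mark_simps)
    qed
  next
    fix v q assume v: "v \<in> V - {P0, P1, P2}" "u \<noteq> v" "mark u = mark v" "q \<in> {P0, P1, P2}"
    then have v3: "v \<in> X0 \<or> v \<in> X1 \<or> v \<in> X2" by auto
    have "u \<in> X0 \<and> v \<in> X0 \<or> u \<in> X1 \<and> v \<in> X1 \<or> u \<in> X2 \<and> v \<in> X2"
      using u3 v3 v(3) dp(1-3) by (auto simp: mark_simps)
    then show "T q u v \<longleftrightarrow> q \<noteq> mark u"
    proof (elim disjE conjE)
      assume "u \<in> X0" "v \<in> X0"
      then show ?thesis using v(2,4) t0.L00[of u v] t1.L22[of u v] t2.L11[of u v] dp(1-3) by (auto simp: mark_simps)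
    next
      assume "u \<in> X1" "v \<in> X1"
      then show ?thesis using v(2,4) t1.L00[of u v] t2.L22[of u v] t0.L11[of u v] dp(1-3) by (auto simp: mark_simps)
    next
      assume "u \<in> X2" "v \<in> X2"
      then show ?thesis using v(2,4) t2.L00[of u v] t0.L22[of u v] t1.L11[of u v] dp(1-3) by (auto simp: mark_simps)
    qed
  next
    fix v assume v: "v \<in> V - {P0, P1, P2}" "mark u \<noteq> mark v"
    then have v3: "v \<in> X0 \<or> v \<in> X1 \<or> v \<in> X2" by auto
    have one: "\<exists>!q. q \<in> {P0, P1, P2} \<and> T q u v" if "\<exists>b. T P0 u v = b \<and> T P1 u v = (\<not> b) \<and> \<not> T P2 u v \<or>
      T P1 u v = b \<and> T P2 u v = (\<not> b) \<and> \<not> T P0 u v \<or> T P2 u v = b \<and> T P0 u v = (\<not> b) \<and> \<not> T P1 u v"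
      using that dp(1-3) by auto
    have "u \<in> X0 \<and> v \<in> X1 \<or> u \<in> X1 \<and> v \<in> X2 \<or> u \<in> X2 \<and> v \<in> X0 \<or>
      v \<in> X0 \<and> u \<in> X1 \<or> v \<in> X1 \<and> u \<in> X2 \<or> v \<in> X2 \<and> u \<in> X0"
      using u3 v3 v(2) by (auto simp: mark_simps)
    then show "\<exists>!q. q \<in> {P0, P1, P2} \<and> T q u v"
    proof (elim disjE conjE)
      assume "u \<in> X0" "v \<in> X1"
      then show ?thesis using pair01[of u v] a_conv(1)[of u v] by (intro one) auto
    next
      assume "u \<in> X1" "v \<in> X2"
      then show ?thesis using r.pair01[of u v] a_conv(2)[of u v] by (intro one) auto
    next
      assume "u \<in> X2" "v \<in> X0"
      then show ?thesis using rr.pair01[of u v] a_conv(3)[of v u] by (intro one) auto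
    next
      assume "v \<in> X0" "u \<in> X1"
      then show ?thesis using pair01[of v u] a_conv(1)[of v u] T_comm(2)[of _ u v] by (intro one) auto
    next
      assume "v \<in> X1" "u \<in> X2"
      then show ?thesis using r.pair01[of v u] a_conv(2)[of v u] T_comm(2)[of _ u v] by (intro one) auto
    next
      assume "v \<in> X2" "u \<in> X0"
      then show ?thesis using rr.pair01[of v u] a_conv(3)[of u v] T_comm(2)[of _ u v] by (intro one) auto
    qed
  }
qed

end

section \<open>Crowned words\<close>

lemma miss_same2:
  assumes "distinct [u, v, w]" "cls n A u = cls n A v" "cls n A w \<noteq> cls n A u"
  shows "miss n A u v w \<longleftrightarrow> arc n A w u \<and> arc n A w v"
  using assms arc_cls[of n A u v] arc_cls[of n A v u] unfolding miss_def by auto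

lemma miss_diff:
  assumes "cls n A u \<noteq> cls n A v" "cls n A v \<noteq> cls n A w" "cls n A u \<noteq> cls n A w"
  shows "miss n A u v w \<longleftrightarrow> \<not> (arc n A u v \<and> arc n A v w \<and> arc n A w u)
    \<and> \<not> (arc n A v u \<and> arc n A w v \<and> arc n A u w)"
proof -
  have "arc n A v u \<longleftrightarrow> \<not> arc n A u v" "arc n A w v \<longleftrightarrow> \<not> arc n A v w" "arc n A w u \<longleftrightarrow> \<not> arc n A u w"
    using assms arc_total arc_not_sym by metis+
  moreover have "distinct [u, v, w]" using assms by auto
  ultimately show ?thesis using assms(1) unfolding miss_def by auto
qed

text \<open>Vertices in \<open>A\<close> that arrive after all of \<open>{..<N}\<close> send arcs to one colour class
and receive arcs from another one, so the missing triples through them can be read off.\<close>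

lemma word_frame_vertex:
  assumes p: "p0 \<in> A" "p1 \<in> A" "N \<le> p0" "N \<le> p1" "p0 \<noteq> p1"
    and p1: "cls n A p1 = (cls n A p0 + 1) mod 3" and r: "r = cls n A p0" "r1 = (r + 1) mod 3" "r2 = (r + 2) mod 3"
  shows "frame_vertex (miss n A) p0 p1 {t. t < N \<and> cls n A t = r} {t. t < N \<and> cls n A t = r1} {t. t < N \<and> cls n A t = r2} (arc n A)"
proof -
  have rs: "r \<noteq> r1" "r1 \<noteq> r2" "r \<noteq> r2" "(r + 2) mod 3 = r2" "(r1 + 2) mod 3 = r" "(r2 + 2) mod 3 = r1"
    using cls_cases[of n A p0] r by auto
  have c: "cls n A p0 = r" "cls n A p1 = r1" using r p1 by auto
  have out: "arc n A p0 u \<longleftrightarrow> cls n A u = r2" "arc n A u p0 \<longleftrightarrow> (cls n A u + 2) mod 3 = r"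
    "arc n A p1 u \<longleftrightarrow> cls n A u = r" "arc n A u p1 \<longleftrightarrow> (cls n A u + 2) mod 3 = r1" if "u < N" for u
    using that p c rs(4-6) unfolding arc_def by (auto simp: max_def)
  have "max p0 p1 \<in> A" using p by (simp add: max_def)
  then have pp: "arc n A p1 p0" "\<not> arc n A p0 p1"
    using c rs(4-6) arc_not_sym[of n A p1 p0] unfolding arc_def by (auto simp: max.commute)
  note same = miss_same2 and diff = miss_diff
  note perm = miss_perm[of n A]
  show ?thesis
  proof
    fix u v w
    show "miss n A u v w \<Longrightarrow> miss n A v u w" "miss n A u v w \<Longrightarrow> miss n A u w v" using perm by metis+
    show "p0 \<notin> {t. t < N \<and> cls n A t = r}" "p0 \<notin> {t. t < N \<and> cls n A t = r1}" "p0 \<notin> {t. t < N \<and> cls n A t = r2}"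
      "p0 \<noteq> p1" "{t. t < N \<and> cls n A t = r} \<inter> {t. t < N \<and> cls n A t = r1} = {}" using p rs by auto
    show "miss n A p0 p1 v" if "v \<in> {t. t < N \<and> cls n A t = r}"
      using same[of p0 v p1 n A] that p c rs pp out[of v] perm(2)[of p0 p1 v] by auto
    show "\<not> miss n A p0 p1 v" if "v \<in> {t. t < N \<and> cls n A t = r1}"
      using same[of p1 v p0 n A] that p c rs pp out[of v] perm(1)[of p0 p1 v] perm(2)[of p1 p0 v] by auto
    show "\<not> miss n A p0 p1 v" if "v \<in> {t. t < N \<and> cls n A t = r2}"
      using diff[of n A p0 p1 v] that c rs pp out[of v] by auto
    show "miss n A p0 u v" if "u \<in> {t. t < N \<and> cls n A t = r}" "v \<in> {t. t < N \<and> cls n A t = r}" "u \<noteq> v"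
      using missI(1)[of p0 u v n A] that p c by auto
    show "miss n A p0 u v" if "u \<in> {t. t < N \<and> cls n A t = r2}" "v \<in> {t. t < N \<and> cls n A t = r2}" "u \<noteq> v"
      using missI(2)[of p0 u v n A] that p out[of u] out[of v] by auto
    show "\<not> miss n A p0 u v" if "u \<in> {t. t < N \<and> cls n A t = r1}" "v \<in> {t. t < N \<and> cls n A t = r1}"
    proof (cases "u = v")
      case False
      then show ?thesis
        using same[of u v p0 n A] that p c rs out[of u] perm(1)[of p0 u v] perm(2)[of u p0 v] by auto
    qed (simp add: miss_def)
    show "\<not> miss n A p0 u v" if "u \<in> {t. t < N \<and> cls n A t = r}" "v \<in> {t. t < N \<and> cls n A t = r2}"
    proof -
      have "u \<noteq> v" using that rs by auto
      then show ?thesis using same[of p0 u v n A] that p c rs out[of v] by auto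
    qed
    show "miss n A p0 u v \<longleftrightarrow> arc n A u v" if "u \<in> {t. t < N \<and> cls n A t = r1}" "v \<in> {t. t < N \<and> cls n A t = r}"
    proof -
      have "u \<noteq> v" using that rs by auto
      then show ?thesis using same[of p0 v u n A] that p c rs out[of u] perm(2)[of p0 u v] by auto
    qed
    show "miss n A p0 u v \<longleftrightarrow> arc n A u v" if "u \<in> {t. t < N \<and> cls n A t = r1}" "v \<in> {t. t < N \<and> cls n A t = r2}"
      using diff[of n A p0 u v] that c rs out[of u] out[of v] arc_total[of n A u v] arc_not_sym[of n A u v] by auto
    show "arc n A v u \<longleftrightarrow> \<not> arc n A u v" if "u \<in> {t. t < N \<and> cls n A t = r}" "v \<in> {t. t < N \<and> cls n A t = r1}"
      using that rs arc_total[of n A u v] arc_not_sym[of n A u v] by auto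
    show "miss n A u v w" if "u \<in> {t. t < N \<and> cls n A t = r}" "v \<in> {t. t < N \<and> cls n A t = r}"
      "w \<in> {t. t < N \<and> cls n A t = r}" "distinct [u, v, w]"
      using missI(1)[OF that(4)] that by auto
    show "miss n A u v w \<longleftrightarrow> arc n A w u \<and> arc n A w v" if "u \<in> {t. t < N \<and> cls n A t = r}"
      "v \<in> {t. t < N \<and> cls n A t = r}" "w \<in> {t. t < N \<and> cls n A t = r1}" "u \<noteq> v"
    proof -
      have "distinct [u, v, w]" using that rs by auto
      then show ?thesis using same[of u v w n A] that rs by auto
    qed
    show "miss n A u v w \<longleftrightarrow> arc n A w u \<and> arc n A w v" if "u \<in> {t. t < N \<and> cls n A t = r}"
      "v \<in> {t. t < N \<and> cls n A t = r}" "w \<in> {t. t < N \<and> cls n A t = r2}" "u \<noteq> v"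
    proof -
      have "distinct [u, v, w]" using that rs by auto
      then show ?thesis using same[of u v w n A] that rs by auto
    qed
  qed
qed

definition crown where "crown N A = A \<union> {N, N + 1, N + (2::nat)}"

lemma crown_above:
  assumes "A \<subseteq> {1..<N}" "t < N"
  shows "card {s \<in> crown N A. t < s \<and> s < N + 3} = card {s \<in> A. t < s \<and> s < N} + 3"
    and "{s. s \<notin> crown N A \<and> t < s \<and> s < N + 3} = {s. s \<notin> A \<and> t < s \<and> s < N}"
proof -
  have "{s \<in> crown N A. t < s \<and> s < N + 3} = {s \<in> A. t < s \<and> s < N} \<union> {N, N + 1, N + 2}"
    using assms unfolding crown_def by auto
  then show "card {s \<in> crown N A. t < s \<and> s < N + 3} = card {s \<in> A. t < s \<and> s < N} + 3"
    by (simp add: card_Un_disjoint)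
  show "{s. s \<notin> crown N A \<and> t < s \<and> s < N + 3} = {s. s \<notin> A \<and> t < s \<and> s < N}"
    using assms unfolding crown_def by auto
qed

lemma crown_mem: "A \<subseteq> {1..<N} \<Longrightarrow> t < N \<Longrightarrow> t \<in> crown N A \<longleftrightarrow> t \<in> A" unfolding crown_def by auto

lemma idx_crown: assumes "A \<subseteq> {1..<N}" "t < N" shows "idx (N + 3) (crown N A) t = idx N A t"
  using crown_above[OF assms] crown_mem[OF assms] unfolding idx_def by simp

lemma idx_crown_top: assumes "N \<le> t" "t < N + 3" shows "idx (N + 3) (crown N A) t = t"
proof -
  have "t \<in> crown N A" using assms unfolding crown_def by auto
  moreover have "{s. s \<notin> crown N A \<and> t < s \<and> s < N + 3} = {}" using assms unfolding crown_def by auto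
  ultimately have "idx (N + 3) (crown N A) t = right_end (N + 3) (crown N A) t" "left_end (N + 3) (crown N A) t = 0"
    unfolding idx_ends left_end_def by simp_all
  then show ?thesis using right_left_end[OF assms(2), of "crown N A"] by simp
qed

lemma cls_crown: assumes "A \<subseteq> {1..<N}" "t < N" shows "cls (N + 3) (crown N A) t = cls N A t"
proof -
  have "((N + 3) * i) mod 3 = (N * i) mod 3" for i by (simp add: distrib_right)
  then show ?thesis unfolding cls_def idx_crown[OF assms] .
qed

lemma arc_crown: assumes "A \<subseteq> {1..<N}" "u < N" "v < N" shows "arc (N + 3) (crown N A) u v \<longleftrightarrow> arc N A u v"
  using crown_mem[of A N "max u v"] assms unfolding arc_def by (simp add: cls_crown)

lemma crown_frame:
  assumes A: "A \<subseteq> {1..<N}" and N: "N mod 3 \<noteq> 0"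
  obtains p0 p1 p2 where "{p0, p1, p2} = {N, N + 1, N + 2}"
    "frame (miss (N + 3) (crown N A)) p0 p1 p2 {t. t < N \<and> cls N A t = 0} {t. t < N \<and> cls N A t = 1}
      {t. t < N \<and> cls N A t = 2} (arc (N + 3) (crown N A))"
proof -
  let ?n = "N + 3" and ?A = "crown N A"
  have n0: "?n mod 3 \<noteq> 0" using N by simp
  have ex: "\<exists>p. N \<le> p \<and> p < ?n \<and> cls ?n ?A p = r" if "r < 3" for r
  proof -
    have "(?n * r) mod 3 < 3" by simp
    then obtain p where p: "N \<le> p" "p < N + 3" "p mod 3 = (?n * r) mod 3"
      using residue_in_three[of "(?n * r) mod 3" N] by (auto simp: card_1_singleton_iff set_eq_iff)
    then have "cls ?n ?A p = r" unfolding cls_def using idx_crown_top[OF p(1,2)] mult_mod3[OF n0 that] by simp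
    then show ?thesis using p by blast
  qed
  obtain p0 where p0: "N \<le> p0" "p0 < ?n" "cls ?n ?A p0 = 0" using ex[of 0] by auto
  obtain p1 where p1: "N \<le> p1" "p1 < ?n" "cls ?n ?A p1 = 1" using ex[of 1] by auto
  obtain p2 where p2: "N \<le> p2" "p2 < ?n" "cls ?n ?A p2 = 2" using ex[of 2] by auto
  have d: "p0 \<noteq> p1" "p1 \<noteq> p2" "p2 \<noteq> p0" using p0 p1 p2 by auto
  have mem: "p0 \<in> ?A" "p1 \<in> ?A" "p2 \<in> ?A" using p0 p1 p2 unfolding crown_def by auto
  have sub: "{p0, p1, p2} \<subseteq> {N, N + 1, N + 2}" using p0 p1 p2 by auto
  have set: "{p0, p1, p2} = {N, N + 1, N + 2}" by (rule card_subset_eq[OF _ sub]) (use d in simp_all)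
  have X: "{t. t < N \<and> cls ?n ?A t = r} = {t. t < N \<and> cls N A t = r}" for r
    using cls_crown[OF A] by auto
  interpret t0: frame_vertex "miss ?n ?A" p0 p1 "{t. t < N \<and> cls N A t = 0}" "{t. t < N \<and> cls N A t = 1}" "{t. t < N \<and> cls N A t = 2}" "arc ?n ?A"
    unfolding X[symmetric] by (rule word_frame_vertex) (use p0 p1 d mem in auto)
  interpret t1: frame_vertex "miss ?n ?A" p1 p2 "{t. t < N \<and> cls N A t = 1}" "{t. t < N \<and> cls N A t = 2}" "{t. t < N \<and> cls N A t = 0}" "arc ?n ?A"
    unfolding X[symmetric] by (rule word_frame_vertex) (use p1 p2 d mem in auto)
  interpret t2: frame_vertex "miss ?n ?A" p2 p0 "{t. t < N \<and> cls N A t = 2}" "{t. t < N \<and> cls N A t = 0}" "{t. t < N \<and> cls N A t = 1}" "arc ?n ?A"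
    unfolding X[symmetric] by (rule word_frame_vertex) (use p2 p0 d mem in auto)
  have "max p0 p1 \<in> ?A" "max p1 p2 \<in> ?A" "max p2 p0 \<in> ?A" using mem by (simp_all add: max_def)
  then have arcs: "arc ?n ?A p1 p0" "arc ?n ?A p0 p2" "arc ?n ?A p2 p1"
    using p0 p1 p2 unfolding arc_def by (simp_all add: max.commute)
  have "frame (miss ?n ?A) p0 p1 p2 {t. t < N \<and> cls N A t = 0} {t. t < N \<and> cls N A t = 1}
      {t. t < N \<and> cls N A t = 2} (arc ?n ?A)"
  proof
    show "\<not> miss ?n ?A p0 p1 p2" using miss_diff[of ?n ?A p0 p1 p2] p0 p1 p2 arcs by auto
    fix u v w
    assume "u \<in> {t. t < N \<and> cls N A t = 0}" "v \<in> {t. t < N \<and> cls N A t = 1}" "w \<in> {t. t < N \<and> cls N A t = 2}"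
    then show "miss ?n ?A u v w \<longleftrightarrow> \<not> (arc ?n ?A u v \<and> arc ?n ?A v w \<and> arc ?n ?A w u) \<and>
      \<not> (arc ?n ?A v u \<and> arc ?n ?A w v \<and> arc ?n ?A u w)"
      by (intro miss_diff) (use cls_crown[OF A] in auto)
  qed
  then show thesis using that set by blast
qed

lemma crown_points:
  assumes "{p0, p1, p2} = {N, N + 1, N + 2}"
  shows "{p0, p1, p2} \<union> {t. t < N \<and> cls N A t = 0} \<union> {t. t < N \<and> cls N A t = 1} \<union> {t. t < N \<and> cls N A t = 2} = {..<N + 3}"
proof -
  have "{..<N + 3} = {N, N + 1, N + 2} \<union> {..<N}" by auto
  moreover have "{..<N} = {t. t < N \<and> cls N A t = 0} \<union> {t. t < N \<and> cls N A t = 1} \<union> {t. t < N \<and> cls N A t = 2}"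
    using cls_cases[of N A] by blast
  ultimately show ?thesis unfolding assms by blast
qed

lemma crown_marks:
  assumes A: "A \<subseteq> {1..<N}" and N: "N mod 3 \<noteq> 0"
  obtains \<omega> where "marks (miss (N + 3) (crown N A)) {..<N + 3} {N, N + 1, N + 2} \<omega>"
    "\<And>u v. u < N \<Longrightarrow> v < N \<Longrightarrow> \<omega> u = \<omega> v \<longleftrightarrow> cls N A u = cls N A v"
    "\<And>u v. u < N \<Longrightarrow> v < N \<Longrightarrow> cls N A u \<noteq> cls N A v \<Longrightarrow> miss (N + 3) (crown N A) (\<omega> u) u v \<longleftrightarrow> arc N A u v"
proof -
  let ?n = "N + 3" and ?A = "crown N A" and ?P = "{N, N + 1, N + 2}"
  let ?X = "\<lambda>r. {t. t < N \<and> cls N A t = r}"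
  obtain p0 p1 p2 where P: "{p0, p1, p2} = ?P"
    and fr: "frame (miss ?n ?A) p0 p1 p2 (?X 0) (?X 1) (?X 2) (arc ?n ?A)"
    by (rule crown_frame[OF A N])
  interpret frame "miss ?n ?A" p0 p1 p2 "?X 0" "?X 1" "?X 2" "arc ?n ?A" by (rule fr)
  have inX: "u \<in> ?X 0 \<union> ?X 1 \<union> ?X 2" if "u < N" for u using that cls_cases[of N A u] by auto
  have mk: "mark u = mark v \<longleftrightarrow> cls N A u = cls N A v" if "u < N" "v < N" for u v
    using that inX[OF that(1)] inX[OF that(2)] distinct_points(1-3) mark_simps[of u] mark_simps[of v] by auto
  show thesis
  proof (rule that[of mark])
    show "marks (miss ?n ?A) {..<?n} ?P mark" using marks_mark unfolding crown_points[OF P] unfolding P .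
    show "mark u = mark v \<longleftrightarrow> cls N A u = cls N A v" if "u < N" "v < N" for u v using mk[OF that] .
    show "miss ?n ?A (mark u) u v \<longleftrightarrow> arc N A u v" if "u < N" "v < N" "cls N A u \<noteq> cls N A v" for u v
      using mark_arc[OF inX inX] that mk arc_crown[OF A] by blast
  qed
qed

text \<open>With at least three vertices below the crown all colours occur there, as required in
\<open>exchange\<close>.\<close>

lemma crown_exchange:
  assumes A: "A \<subseteq> {1..<N}" and N: "N = 3 * m + j" "j = 1 \<or> j = 2" "m \<ge> 1"
    and Q: "marks (miss (N + 3) (crown N A)) {..<N + 3} Q \<omega>" "Q \<noteq> {N, N + 1, N + 2}"
  shows "\<exists>p\<in>{N, N + 1, N + 2} - Q. \<exists>q\<in>Q - {N, N + 1, N + 2}. twin (miss (N + 3) (crown N A)) {..<N + 3} p q"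
proof -
  let ?n = "N + 3" and ?A = "crown N A" and ?P = "{N, N + 1, N + 2}"
  let ?X = "\<lambda>r. {t. t < N \<and> cls N A t = r}"
  have N0: "N mod 3 \<noteq> 0" using N by presburger
  obtain p0 p1 p2 where P: "{p0, p1, p2} = ?P"
    and fr: "frame (miss ?n ?A) p0 p1 p2 (?X 0) (?X 1) (?X 2) (arc ?n ?A)"
    by (rule crown_frame[OF A N0])
  interpret frame "miss ?n ?A" p0 p1 p2 "?X 0" "?X 1" "?X 2" "arc ?n ?A" by (rule fr)
  have ne: "?X r \<noteq> {}" if "r < 3" for r
  proof -
    have "card (members N A r) \<ge> m" using card_members[OF N(1,2) that, of A] by simp
    then have "members N A r \<noteq> {}" using N(3) by auto
    then show ?thesis unfolding members_def by auto
  qed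
  show ?thesis
    using exchange[of Q \<omega>, unfolded crown_points[OF P], unfolded P] Q ne[of 0] ne[of 1] ne[of 2] by simp
qed

definition swap where "swap p q x = (if x = p then q else if x = q then p else x)"

lemma twin_swap_imp:
  assumes tw: "twin (miss n A) {..<n} p q" and pq: "p < n" "q < n"
    and m: "miss n A u v w" and n: "u < n" "v < n" "w < n"
  shows "miss n A (swap p q u) (swap p q v) (swap p q w)"
proof -
  have d: "distinct [u, v, w]" using m unfolding miss_def by blast
  have H: "miss n A q (swap p q x) (swap p q y)" if "miss n A p x y" "x < n" "y < n" for x y
  proof -
    have d: "p \<noteq> x" "p \<noteq> y" "x \<noteq> y" using that unfolding miss_def by auto
    consider "x = q" | "y = q" | "x \<noteq> q" "y \<noteq> q" by blast
    then show ?thesis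
    proof cases
      case 1 then show ?thesis using that d miss_perms[OF that(1)] by (simp add: swap_def)
    next
      case 2 then show ?thesis using that d miss_perms[OF that(1)] by (simp add: swap_def)
    next
      case 3
      then have "miss n A p x y \<longleftrightarrow> miss n A q x y" using tw that d unfolding twin_def by auto
      then show ?thesis using 3 d that by (simp add: swap_def)
    qed
  qed
  have H': "miss n A p (swap p q x) (swap p q y)" if "miss n A q x y" "x < n" "y < n" for x y
  proof -
    have d: "q \<noteq> x" "q \<noteq> y" "x \<noteq> y" using that unfolding miss_def by auto
    consider "x = p" | "y = p" | "x \<noteq> p" "y \<noteq> p" by blast
    then show ?thesis
    proof cases
      case 1 then show ?thesis using that d miss_perms[OF that(1)] by (simp add: swap_def)
    next
      case 2 then show ?thesis using that d miss_perms[OF that(1)] by (simp add: swap_def)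
    next
      case 3
      then have "miss n A p x y \<longleftrightarrow> miss n A q x y" using tw that d unfolding twin_def by auto
      then show ?thesis using 3 d that by (simp add: swap_def)
    qed
  qed
  have sp: "swap p q p = q" "swap p q q = p" by (auto simp: swap_def)
  note mp = miss_perms[OF m]
  consider "u = p" | "v = p" | "w = p" | "u = q" | "v = q" | "w = q" | "{u, v, w} \<inter> {p, q} = {}" by blast
  then show ?thesis
  proof cases
    case 1 then show ?thesis using H[of v w] m n sp by simp
  next
    case 2 then show ?thesis using H[of u w] mp n sp miss_perms[of n A q] by simp
  next
    case 3 then show ?thesis using H[of u v] mp n sp miss_perms[of n A q] by simp
  next
    case 4 then show ?thesis using H'[of v w] m n sp by simp
  next
    case 5 then show ?thesis using H'[of u w] mp n sp miss_perms[of n A p] by simp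
  next
    case 6 then show ?thesis using H'[of u v] mp n sp miss_perms[of n A p] by simp
  next
    case 7 then show ?thesis using m by (auto simp: swap_def)
  qed
qed

lemma swap_swap: "swap p q (swap p q x) = x" unfolding swap_def by auto
lemma swap_lt: "p < n \<Longrightarrow> q < n \<Longrightarrow> x < n \<Longrightarrow> swap p q x < n" for n :: nat unfolding swap_def by auto

lemma twin_swap:
  assumes tw: "twin (miss n A) {..<n} p q" and pq: "p < n" "q < n"
  shows "triple_iso n A A (swap p q)"
proof -
  have "bij_betw (swap p q) {..<n} {..<n}"
    by (rule bij_betw_byWitness[where f' = "swap p q"]) (use swap_swap swap_lt pq in auto)
  moreover have "miss n A u v w \<longleftrightarrow> miss n A (swap p q u) (swap p q v) (swap p q w)"
    if "u < n" "v < n" "w < n" for u v w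
    using twin_swap_imp[OF assms _ that]
      twin_swap_imp[OF assms _ swap_lt[OF pq that(1)] swap_lt[OF pq that(2)] swap_lt[OF pq that(3)]]
    unfolding swap_swap by blast
  ultimately show ?thesis unfolding triple_iso_def by blast
qed

lemma triple_iso_comp: assumes "triple_iso n A B f" "triple_iso n B C g" shows "triple_iso n A C (g \<circ> f)"
proof -
  have "f u < n" if "u < n" for u using assms(1) that unfolding triple_iso_def bij_betw_def by auto
  then show ?thesis using assms unfolding triple_iso_def by (auto intro: bij_betw_trans)
qed

lemma marks_transport:
  assumes f: "triple_iso n A B f" and m: "marks (miss n A) {..<n} P \<omega>"
  shows "marks (miss n B) {..<n} (f ` P) (\<lambda>x. f (\<omega> (inv_into {..<n} f x)))"
proof -
  let ?h = "inv_into {..<n} f"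
  have bij: "bij_betw f {..<n} {..<n}" using f unfolding triple_iso_def by blast
  have inj: "inj_on f {..<n}" using bij unfolding bij_betw_def by blast
  have T: "miss n A u v w \<longleftrightarrow> miss n B (f u) (f v) (f w)" if "u < n" "v < n" "w < n" for u v w
    using f that unfolding triple_iso_def by blast
  have P: "P \<subseteq> {..<n}" "card P = 3" using marksD(1,2)[OF m] by auto
  have Pn: "p < n" if "p \<in> P" for p using P that by auto
  have h: "?h u < n" "f (?h u) = u" if "u < n" for u
    using bij_betwE[OF bij_betw_inv_into[OF bij]] bij_betw_inv_into_right[OF bij] that by auto
  have hV: "?h u \<in> {..<n} - P" if "u \<in> {..<n} - f ` P" for u
    using h[of u] that imageI[of "?h u" P f] by auto
  have eq: "f x = f y \<longleftrightarrow> x = y" if "x < n" "y < n" for x y using inj that unfolding inj_on_def by auto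
  note w0 = marksD(4)[OF m, OF hV]
  show ?thesis unfolding marks_def
  proof (intro conjI ballI impI)
    show "f ` P \<subseteq> {..<n}" using bij P unfolding bij_betw_def by blast
    show "card (f ` P) = 3" using P inj by (metis card_image inj_on_subset)
    show "\<not> miss n B p q r" if pqr: "p \<in> f ` P" "q \<in> f ` P" "r \<in> f ` P" "distinct [p, q, r]" for p q r
    proof -
      obtain x y z where x: "x \<in> P" "y \<in> P" "z \<in> P" "p = f x" "q = f y" "r = f z" using pqr by blast
      then have "distinct [x, y, z]" using pqr by auto
      then show ?thesis using marksD(3)[OF m x(1-3)] T[of x y z] Pn x by auto
    qed
    fix u assume u: "u \<in> {..<n} - f ` P"
    then have un: "u < n" by simp
    show "f (\<omega> (?h u)) \<in> f ` P" using w0[OF u] by blast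
    { fix q r assume qr: "q \<in> f ` P" "r \<in> f ` P" "q \<noteq> r"
      then obtain x y where x: "x \<in> P" "y \<in> P" "q = f x" "r = f y" by blast
      then have "x \<noteq> y" using qr by auto
      then show "miss n B q r u \<longleftrightarrow> f (\<omega> (?h u)) \<noteq> q \<and> f (\<omega> (?h u)) \<noteq> r"
        using marksD(5)[OF m hV[OF u] x(1,2)] T[of x y "?h u"] Pn w0[OF u] h[OF un] eq x by simp
    next
      fix v q assume v: "v \<in> {..<n} - f ` P" "u \<noteq> v" "f (\<omega> (?h u)) = f (\<omega> (?h v))" "q \<in> f ` P"
      then have vn: "v < n" by simp
      obtain x where x: "x \<in> P" "q = f x" using v by blast
      have "\<omega> (?h u) = \<omega> (?h v)" using v(3) eq Pn w0[OF u] w0[OF v(1)] by simp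
      moreover have "?h u \<noteq> ?h v" using h(2)[OF un] h(2)[OF vn] v(2) by metis
      ultimately show "miss n B q u v \<longleftrightarrow> q \<noteq> f (\<omega> (?h u))"
        using marksD(6)[OF m hV[OF u] hV[OF v(1)], of x] T[of x "?h u" "?h v"] Pn w0[OF u] h[OF un] h[OF vn] eq x by simp
    next
      fix v assume v: "v \<in> {..<n} - f ` P" "f (\<omega> (?h u)) \<noteq> f (\<omega> (?h v))"
      then have vn: "v < n" by simp
      have "\<omega> (?h u) \<noteq> \<omega> (?h v)" using v(2) by metis
      then have ex1: "\<exists>!q. q \<in> P \<and> miss n A q (?h u) (?h v)" using marksD(7)[OF m hV[OF u] hV[OF v(1)]] by blast
      have tr: "miss n A x (?h u) (?h v) \<longleftrightarrow> miss n B (f x) u v" if "x \<in> P" for x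
        using T[of x "?h u" "?h v"] h[OF un] h[OF vn] Pn[OF that] by simp
      from ex1 obtain x where x: "x \<in> P" "miss n A x (?h u) (?h v)"
        and un: "\<And>y. y \<in> P \<Longrightarrow> miss n A y (?h u) (?h v) \<Longrightarrow> y = x" by blast
      show "\<exists>!q. q \<in> f ` P \<and> miss n B q u v"
      proof (rule ex1I[of _ "f x"])
        show "f x \<in> f ` P \<and> miss n B (f x) u v" using x tr by blast
        fix q assume "q \<in> f ` P \<and> miss n B q u v"
        then show "q = f x" using tr un by blast
      qed
    }
  qed
qed

text \<open>Each swap of twins moves the image of the crown closer to the crown.\<close>

lemma align:
  assumes B: "B \<subseteq> {1..<N}" and A: "A \<subseteq> {1..<N}" and N: "N = 3 * m + j" "j = 1 \<or> j = 2" "m \<ge> 1"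
    and f: "triple_iso (N + 3) (crown N A) (crown N B) f"
  shows "\<exists>g. triple_iso (N + 3) (crown N A) (crown N B) g \<and> g ` {N, N + 1, N + 2} = {N, N + 1, N + 2}"
  using f
proof (induction "card (f ` {N, N + 1, N + 2} - {N, N + 1, N + 2})" arbitrary: f rule: less_induct)
  case less
  let ?P = "{N, N + 1, N + 2}"
  have N0: "N mod 3 \<noteq> 0" using N by presburger
  obtain \<omega> where mA: "marks (miss (N + 3) (crown N A)) {..<N + 3} ?P \<omega>" by (rule crown_marks[OF A N0])
  note Q = marks_transport[OF less.prems mA]
  show ?case
  proof (cases "f ` ?P = ?P")
    case False
    have "\<exists>p\<in>?P - f ` ?P. \<exists>q\<in>f ` ?P - ?P. twin (miss (N + 3) (crown N B)) {..<N + 3} p q"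
      by (rule crown_exchange[OF B N Q False])
    then obtain p q where pq: "p \<in> ?P - f ` ?P" "q \<in> f ` ?P - ?P"
      and tw: "twin (miss (N + 3) (crown N B)) {..<N + 3} p q" by blast
    have n: "p < N + 3" "q < N + 3" using pq marksD(1)[OF Q] by auto
    let ?g = "swap p q \<circ> f"
    have "swap p q ` (f ` ?P) = insert p (f ` ?P - {q})"
    proof (intro equalityI subsetI)
      fix y assume "y \<in> swap p q ` (f ` ?P)"
      then obtain x where x: "x \<in> f ` ?P" "y = swap p q x" by blast
      then have "x \<noteq> p" using pq by blast
      then show "y \<in> insert p (f ` ?P - {q})" using x unfolding swap_def by (auto split: if_splits)
    next
      fix y assume y: "y \<in> insert p (f ` ?P - {q})"
      then have "swap p q y \<in> f ` ?P" using pq unfolding swap_def by (auto split: if_splits)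
      then show "y \<in> swap p q ` (f ` ?P)" using swap_swap[of p q y] by (metis imageI)
    qed
    then have "?g ` ?P = insert p (f ` ?P - {q})" by (simp only: image_comp)
    then have e: "?g ` ?P - ?P = (f ` ?P - ?P) - {q}" using pq(1) by blast
    have "card (?g ` ?P - ?P) < card (f ` ?P - ?P)"
      unfolding e by (rule card_Diff1_less[OF _ pq(2)]) simp
    then show ?thesis using less.hyps triple_iso_comp[OF less.prems twin_swap[OF tw n]] by blast
  qed (use less.prems in blast)
qed

section \<open>Recovering the word from its signs\<close>

text \<open>Put the vertex \<open>t\<close> at the coordinate \<open>t\<close> or \<open>-t\<close> according to its side. Then the later one of two vertices
is at the left iff the sum of their coordinates is negative, and this is preserved when one of them moves to the left.\<close>

lemma not_up_mono:
  assumes "idx n A u' \<le> idx n A u" "u < n" "u' < n" "v < n" "u \<noteq> v" "u' \<noteq> v" "max u v \<notin> A"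
  shows "max u' v \<notin> A"
proof (cases "u' = u")
  case False
  then have lt: "idx n A u' < idx n A u" using assms(1-3) inj_onD[OF inj_idx, of n A u' u] by force
  have 1: "\<not> (u < u' \<and> u' \<in> A)" using idx_less_iff[of u u' n A] lt assms by auto
  have 2: "u' < u \<Longrightarrow> u \<in> A" using idx_less_iff[of u' u n A] lt assms by auto
  show ?thesis using 1 2 assms(5-7) False by (auto simp: max_def split: if_splits)
qed (use assms in simp)

lemma not_up_mono2:
  assumes "idx n A u' \<le> idx n A u" "idx n A v' \<le> idx n A v" "u < n" "u' < n" "v < n" "v' < n"
    and "idx n A u' mod 3 = idx n A u mod 3" "idx n A v' mod 3 = idx n A v mod 3"
    and "idx n A u mod 3 \<noteq> idx n A v mod 3" "max u v \<notin> A"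
  shows "max u' v' \<notin> A"
proof -
  have d: "u \<noteq> v" "u' \<noteq> v" "u' \<noteq> v'" using assms by auto
  have "max u' v \<notin> A" using not_up_mono[of n A u' u v] assms d by simp
  then have "max v u' \<notin> A" by (simp add: max.commute)
  then have "max v' u' \<notin> A" using not_up_mono[of n A v' v u'] assms d by metis
  then show ?thesis by (simp add: max.commute)
qed

definition sign_iso :: "nat \<Rightarrow> nat set \<Rightarrow> nat set \<Rightarrow> (nat \<Rightarrow> nat) \<Rightarrow> bool" where
  "sign_iso n A B g \<longleftrightarrow> bij_betw g {..<n} {..<n} \<and>
     (\<forall>u<n. idx n B (g u) mod 3 = idx n A u mod 3) \<and>
     (\<forall>u<n. \<forall>v<n. idx n A u mod 3 \<noteq> idx n A v mod 3 \<longrightarrow> (max u v \<in> A \<longleftrightarrow> max (g u) (g v) \<in> B))"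

definition same_signs :: "nat \<Rightarrow> nat set \<Rightarrow> nat set \<Rightarrow> bool" where
  "same_signs n A B \<longleftrightarrow> (\<forall>u<n. \<forall>v<n. \<forall>u'<n. \<forall>v'<n.
     idx n B u' = idx n A u \<longrightarrow> idx n B v' = idx n A v \<longrightarrow> idx n A u mod 3 \<noteq> idx n A v mod 3 \<longrightarrow>
     (max u v \<in> A \<longleftrightarrow> max u' v' \<in> B))"

text \<open>Pigeonhole: the vertices of the same colour up to \<open>u\<close> are one more than the places of that colour
strictly before \<open>u\<close>, so they cannot all be mapped there.\<close>

lemma push_up:
  assumes g: "sign_iso n A B g" and u: "u < n"
  shows "\<exists>x<n. idx n A x mod 3 = idx n A u mod 3 \<and> idx n A x \<le> idx n A u \<and> idx n A u \<le> idx n B (g x)"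
proof (rule ccontr)
  assume *: "\<not> ?thesis"
  let ?i = "idx n A u"
  define U where "U = {x \<in> {..<n}. idx n A x mod 3 = ?i mod 3 \<and> idx n A x \<le> ?i}"
  define W where "W = {q. q mod 3 = ?i mod 3 \<and> q < ?i}"
  have bij: "bij_betw g {..<n} {..<n}" using g unfolding sign_iso_def by blast
  have gn: "g x < n" if "x < n" for x using bij that unfolding bij_betw_def by auto
  have "card U = card {q \<in> {..<n}. q mod 3 = ?i mod 3 \<and> q \<le> ?i}"
    unfolding U_def using card_filter_bij[OF bij_idx, where P = "\<lambda>q. q mod 3 = ?i mod 3 \<and> q \<le> ?i"] .
  also have "{q \<in> {..<n}. q mod 3 = ?i mod 3 \<and> q \<le> ?i} = insert ?i W"
    unfolding W_def using idx_lt[OF u, of A] by auto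
  also have "card \<dots> = Suc (card W)" unfolding W_def by simp
  finally have cU: "card U = Suc (card W)" .
  have "(\<lambda>x. idx n B (g x)) ` U \<subseteq> W"
  proof
    fix y assume "y \<in> (\<lambda>x. idx n B (g x)) ` U"
    then obtain x where x: "x < n" "idx n A x mod 3 = ?i mod 3" "idx n A x \<le> ?i" "y = idx n B (g x)"
      unfolding U_def by auto
    then have "idx n B (g x) mod 3 = ?i mod 3" using g unfolding sign_iso_def by metis
    moreover have "idx n B (g x) < ?i" using * x by auto
    ultimately show "y \<in> W" unfolding W_def x(4) by blast
  qed
  moreover have "inj_on (\<lambda>x. idx n B (g x)) U"
  proof (rule inj_onI)
    fix x y assume xy: "x \<in> U" "y \<in> U" "idx n B (g x) = idx n B (g y)"
    then have "x < n" "y < n" unfolding U_def by auto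
    then have "g x = g y" using inj_onD[OF inj_idx xy(3)] gn by simp
    then show "x = y" using bij \<open>x < n\<close> \<open>y < n\<close> unfolding bij_betw_def inj_on_def by auto
  qed
  moreover have "finite W" unfolding W_def by simp
  ultimately have "card U \<le> card W" by (metis card_inj_on_le)
  then show False using cU by simp
qed

text \<open>By \<open>not_up_mono\<close>, for two fixed colours the pairs whose later vertex is at the left form a
Young diagram. If \<open>(i, j)\<close> is a cell, then so is every cell of the rectangle that it spans. Some row up to \<open>i\<close> is
mapped to a row not before \<open>i\<close>, and the same holds for columns; so the image contains a cell that is not before \<open>(i, j)\<close>
in either direction, and therefore \<open>(i, j)\<close> itself.\<close>

lemma sign_iso_left_pairs:
  assumes g: "sign_iso n A B g" and n: "u < n" "v < n" "u' < n" "v' < n"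
    and e: "idx n B u' = idx n A u" "idx n B v' = idx n A v" and k: "idx n A u mod 3 \<noteq> idx n A v mod 3"
    and up: "max u v \<notin> A"
  shows "max u' v' \<notin> B"
proof -
  obtain x where x: "x < n" "idx n A x mod 3 = idx n A u mod 3" "idx n A x \<le> idx n A u" "idx n A u \<le> idx n B (g x)"
    using push_up[OF g n(1)] by blast
  obtain y where y: "y < n" "idx n A y mod 3 = idx n A v mod 3" "idx n A y \<le> idx n A v" "idx n A v \<le> idx n B (g y)"
    using push_up[OF g n(2)] by blast
  have gn: "g x < n" "g y < n" using g x y unfolding sign_iso_def bij_betw_def by auto
  have gk: "idx n B (g x) mod 3 = idx n A x mod 3" "idx n B (g y) mod 3 = idx n A y mod 3"
    using g x y unfolding sign_iso_def by blast+
  have "max x y \<notin> A"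
    by (rule not_up_mono2[OF x(3) y(3) n(1) x(1) n(2) y(1) x(2) y(2) k up])
  moreover have "max x y \<in> A \<longleftrightarrow> max (g x) (g y) \<in> B"
    using g x(1,2) y(1,2) k unfolding sign_iso_def by metis
  ultimately have upB: "max (g x) (g y) \<notin> B" by blast
  show ?thesis
  proof (rule not_up_mono2[of n B u' "g x" v' "g y"])
    show "idx n B u' \<le> idx n B (g x)" "idx n B v' \<le> idx n B (g y)" using e x(4) y(4) by simp_all
    show "idx n B u' mod 3 = idx n B (g x) mod 3" "idx n B v' mod 3 = idx n B (g y) mod 3"
      using e gk x(2) y(2) by simp_all
    show "idx n B (g x) mod 3 \<noteq> idx n B (g y) mod 3" using gk x(2) y(2) k by simp
  qed (fact gn n upB)+
qed

lemma sign_iso_inv: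
  assumes g: "sign_iso n A B g"
  shows "sign_iso n B A (inv_into {..<n} g)"
proof -
  let ?h = "inv_into {..<n} g"
  have bij: "bij_betw g {..<n} {..<n}" using g unfolding sign_iso_def by blast
  have h: "bij_betw ?h {..<n} {..<n}" by (rule bij_betw_inv_into[OF bij])
  have hn: "?h u < n" "g (?h u) = u" if "u < n" for u
    using bij_betwE[OF h] bij_betw_inv_into_right[OF bij] that by auto
  have k: "idx n A (?h u) mod 3 = idx n B u mod 3" if "u < n" for u
    using g hn[OF that] unfolding sign_iso_def by metis
  have "max u v \<in> B \<longleftrightarrow> max (?h u) (?h v) \<in> A" if "u < n" "v < n" "idx n B u mod 3 \<noteq> idx n B v mod 3" for u v
    using g hn[OF that(1)] hn[OF that(2)] k[OF that(1)] k[OF that(2)] that(3) unfolding sign_iso_def by metis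
  then show ?thesis unfolding sign_iso_def using h k by blast
qed

lemma sign_iso_same_signs: assumes "sign_iso n A B g" shows "same_signs n A B"
  unfolding same_signs_def
proof (intro allI impI)
  fix u v u' v' assume *: "u < n" "v < n" "u' < n" "v' < n" "idx n B u' = idx n A u" "idx n B v' = idx n A v"
    "idx n A u mod 3 \<noteq> idx n A v mod 3"
  show "max u v \<in> A \<longleftrightarrow> max u' v' \<in> B"
    using sign_iso_left_pairs[OF assms *] sign_iso_left_pairs[OF sign_iso_inv[OF assms] *(3,4,1,2) *(5,6)[symmetric]] * by auto
qed

lemma idx_surj: assumes "q < n" obtains t where "t < n" "idx n A t = q"
  using bij_idx[of n A] assms unfolding bij_betw_def by (metis imageE lessThan_iff)

lemma same_signs_sym: "same_signs n A B \<Longrightarrow> same_signs n B A"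
  unfolding same_signs_def by metis

lemma same_signs_trans:
  assumes "same_signs n A B" "same_signs n A C" shows "same_signs n B C"
  unfolding same_signs_def
proof (intro allI impI)
  fix u v u' v' assume *: "u < n" "v < n" "u' < n" "v' < n" "idx n C u' = idx n B u" "idx n C v' = idx n B v"
    "idx n B u mod 3 \<noteq> idx n B v mod 3"
  obtain x where x: "x < n" "idx n A x = idx n B u" using idx_surj[OF idx_lt[OF *(1)]] by metis
  obtain y where y: "y < n" "idx n A y = idx n B v" using idx_surj[OF idx_lt[OF *(2)]] by metis
  have "max x y \<in> A \<longleftrightarrow> max u v \<in> B" using assms(1) x y * unfolding same_signs_def by metis
  moreover have "max x y \<in> A \<longleftrightarrow> max u' v' \<in> C" using assms(2) x y * unfolding same_signs_def by metis
  ultimately show "max u v \<in> B \<longleftrightarrow> max u' v' \<in> C" by blast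
qed

text \<open>Two successive arrivals at opposite ends can be interchanged if they have the same colour,
which occurs at times \<open>3 * j + 2\<close> and \<open>3 * j + 3\<close>. The order right, left is excluded there.\<close>

definition normal :: "nat \<Rightarrow> nat set \<Rightarrow> bool" where
  "normal n A \<longleftrightarrow> A \<subseteq> {1..<n} \<and> (\<forall>j. 3 * j + 3 < n \<longrightarrow> 3 * j + 2 \<in> A \<longrightarrow> 3 * j + 3 \<in> A)"

text \<open>At time \<open>t\<close> the two words occupy the same places, and the leftmost and the rightmost of these disagree about
the side of the later vertex. Equal signs are only required for different colours, so these
two places must have the same colour. Comparing the rightmost place with the second from the left
in the same way shows what the previous letter of \<open>B\<close> is.\<close>

lemma last_difference:
  assumes ss: "same_signs n A B" and t: "0 < t" "t < n" "t \<in> A" "t \<notin> B"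
    and above: "\<And>s. t < s \<Longrightarrow> s < n \<Longrightarrow> s \<in> A \<longleftrightarrow> s \<in> B"
  shows "t mod 3 = 0 \<and> t - 1 \<in> B"
proof -
  have "{s. s \<notin> A \<and> t < s \<and> s < n} = {s. s \<notin> B \<and> t < s \<and> s < n}" using above by auto
  then have l: "left_end n A t = left_end n B t" unfolding left_end_def by simp
  have h: "right_end n A t = left_end n A t + t" "right_end n B t = left_end n A t + t" using right_left_end[OF t(2)] l by simp_all
  define i where "i = left_end n A t"
  have At: "idx n A t = i + t" and Bt: "idx n B t = i" using t h l by (simp_all add: idx_ends i_def)
  have img: "idx n A ` {..t} = {i..i + t}" "idx n B ` {..t} = {i..i + t}"
    using idx_image[OF t(2)] h l unfolding i_def by simp_all
  have ex: "\<exists>v<t. idx n A v = j" if "i \<le> j" "j < i + t" for j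
  proof -
    have "j \<in> idx n A ` {..t}" using img that by simp
    then obtain v where v: "v \<le> t" "idx n A v = j" by auto
    then have "v \<noteq> t" using At that by auto
    then show ?thesis using v by (intro exI[of _ v]) simp
  qed
  have "i + t \<in> idx n B ` {..t}" using img by simp
  then obtain w where "w \<le> t" and w: "idx n B w = i + t" by auto
  then have wt: "w < t" using Bt t by (cases "w = t") auto
  obtain v where v: "v < t" "idx n A v = i" using ex[of i] t by auto
  have "(i + t) mod 3 = i mod 3"
  proof (rule ccontr)
    assume ne: "(i + t) mod 3 \<noteq> i mod 3"
    have "max t v \<in> A \<longleftrightarrow> max w t \<in> B"
      using ss[unfolded same_signs_def, rule_format, of t v w t] t v w wt At Bt ne by simp
    then show False using v wt t by (simp add: max_def)
  qed
  then have t3: "t mod 3 = 0" by presburger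
  then have "t \<ge> 3" using t by presburger
  have "t - 1 \<in> B"
  proof (rule ccontr)
    assume nb: "t - 1 \<notin> B"
    have "{s. s \<notin> B \<and> t - 1 < s \<and> s < n} = insert t {s. s \<notin> B \<and> t < s \<and> s < n}" using t by auto
    then have "left_end n B (t - 1) = i + 1" unfolding i_def l unfolding left_end_def by simp
    then have B1: "idx n B (t - 1) = i + 1" using nb by (simp add: idx_ends)
    obtain x where x: "x < t" "idx n A x = i + 1" using ex[of "i + 1"] \<open>t \<ge> 3\<close> by auto
    have "w \<noteq> t - 1" using w B1 \<open>t \<ge> 3\<close> by auto
    then have m: "max w (t - 1) = t - 1" using wt by (simp add: max_def)
    have ne: "(i + t) mod 3 \<noteq> (i + 1) mod 3" using t3 by presburger
    have "max t x \<in> A \<longleftrightarrow> max w (t - 1) \<in> B"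
      using ss[unfolded same_signs_def, rule_format, of t x w "t - 1"] t x w wt At B1 ne by simp
    then show False using x m nb t by (simp add: max_def)
  qed
  then show ?thesis using t3 by blast
qed

lemma last_difference_normal:
  assumes "same_signs n A B" "normal n B" "0 < t" "t < n" "t \<in> A" "t \<notin> B"
    and "\<And>s. t < s \<Longrightarrow> s < n \<Longrightarrow> s \<in> A \<longleftrightarrow> s \<in> B"
  shows False
proof -
  have *: "t mod 3 = 0" "t - 1 \<in> B" using last_difference[OF assms(1,3-7)] by blast+
  have "3 * (t div 3 - 1) + 3 = t" "3 * (t div 3 - 1) + 2 = t - 1" using *(1) assms(3) by presburger+
  then show False using assms(2,4,6) * unfolding normal_def by metis
qed

lemma same_signs_normal:
  assumes ss: "same_signs n A B" and A: "normal n A" and B: "normal n B"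
  shows "A = B"
proof (rule ccontr)
  assume "A \<noteq> B"
  define D where "D = (A - B) \<union> (B - A)"
  have D: "D \<noteq> {}" "D \<subseteq> {1..<n}" using \<open>A \<noteq> B\<close> A B unfolding D_def normal_def by auto
  then have fin: "finite D" using finite_subset by blast
  define t where "t = Max D"
  have t: "t \<in> D" unfolding t_def using fin D by simp
  then have tn: "0 < t" "t < n" using D by auto
  have above: "s \<in> A \<longleftrightarrow> s \<in> B" if "t < s" for s
    using that Max_ge[OF fin, of s] unfolding t_def D_def by force
  from t have "t \<in> A \<and> t \<notin> B \<or> t \<in> B \<and> t \<notin> A" unfolding D_def by blast
  then show False
    using last_difference_normal[OF ss B tn] last_difference_normal[OF same_signs_sym[OF ss] A tn] above by blast
qed

text \<open>The mirror image of a word. The vertex 0 starts the path and never counts as placed at the right.\<close>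

definition flip where "flip n A = {1..<n} - (A :: nat set)"

lemma idx_flip: assumes A: "A \<subseteq> {1..<n}" and t: "t < n" shows "idx n (flip n A) t = n - 1 - idx n A t"
proof -
  have s: "{s \<in> flip n A. t < s \<and> s < n} = {s. s \<notin> A \<and> t < s \<and> s < n}"
    "{s. s \<notin> flip n A \<and> t < s \<and> s < n} = {s \<in> A. t < s \<and> s < n}"
    using A unfolding flip_def by auto
  have l: "left_end n (flip n A) t = n - 1 - right_end n A t" "right_end n (flip n A) t = n - 1 - left_end n A t"
    using card_above[OF t, of A] unfolding left_end_def right_end_def s by linarith+
  have "t \<in> flip n A \<longleftrightarrow> t \<notin> A" if "t \<noteq> 0" using that t unfolding flip_def by auto
  moreover have "0 \<notin> flip n A" "0 \<notin> A" using A unfolding flip_def by auto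
  moreover have "right_end n A 0 = left_end n A 0" using right_left_end[of 0 n A] t by simp
  ultimately show ?thesis using l by (cases "t = 0") (auto simp: idx_ends)
qed

lemma max_flip: "A \<subseteq> {1..<n} \<Longrightarrow> u < n \<Longrightarrow> v < n \<Longrightarrow> u \<noteq> v \<Longrightarrow> max u v \<in> flip n A \<longleftrightarrow> max u v \<notin> A"
  unfolding flip_def by auto

lemma idx_mod_cls:
  assumes "n mod 3 \<noteq> 0" shows "idx n A u mod 3 = (n * cls n A u) mod 3"
proof -
  have "(n * idx n A u) mod 3 = cls n A u" unfolding cls_def ..
  then show ?thesis using mult_mod3[OF assms, of "cls n A u" "idx n A u"] cls_cases[of n A u] by auto
qed

lemma arc_up:
  assumes "cls n A u \<noteq> cls n A v"
  shows "max u v \<in> A \<longleftrightarrow> (arc n A u v \<longleftrightarrow> cls n A v = (cls n A u + 2) mod 3)"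
  using assms cls_cases[of n A u] cls_cases[of n A v] unfolding arc_def by auto

lemma sign_iso_cls:
  assumes n: "n mod 3 \<noteq> 0" and g: "bij_betw g {..<n} {..<n}"
    and c: "\<And>u. u < n \<Longrightarrow> cls n B (g u) = cls n A u"
    and a: "\<And>u v. u < n \<Longrightarrow> v < n \<Longrightarrow> cls n A u \<noteq> cls n A v \<Longrightarrow> arc n A u v \<longleftrightarrow> arc n B (g u) (g v)"
  shows "sign_iso n A B g"
  unfolding sign_iso_def
proof (intro conjI allI impI)
  show "idx n B (g u) mod 3 = idx n A u mod 3" if "u < n" for u
    using c[OF that] idx_mod_cls[OF n] by metis
  fix u v assume uv: "u < n" "v < n" "idx n A u mod 3 \<noteq> idx n A v mod 3"
  then have d: "cls n A u \<noteq> cls n A v" using idx_mod_cls[OF n] by metis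
  then have d': "cls n B (g u) \<noteq> cls n B (g v)" using c uv by metis
  show "max u v \<in> A \<longleftrightarrow> max (g u) (g v) \<in> B"
    using arc_up[OF d] arc_up[OF d'] a[OF uv(1,2) d] c uv by simp
qed (rule g)

lemma cls_flip:
  assumes A: "A \<subseteq> {1..<n}" and u: "u < n"
  shows "n mod 3 = 1 \<Longrightarrow> cls n (flip n A) u = (2 * cls n A u) mod 3"
    and "n mod 3 = 2 \<Longrightarrow> cls n (flip n A) u = (2 * cls n A u + 2) mod 3"
proof -
  have i: "idx n A u < n" by (rule idx_lt[OF u])
  define i where "i = idx n A u"
  have c: "cls n (flip n A) u = (n * (n - 1 - i)) mod 3" "cls n A u = (n * i) mod 3"
    using idx_flip[OF A u] unfolding cls_def i_def by simp_all
  have e: "i + (n - 1 - i) + 1 = n" using \<open>idx n A u < n\<close> unfolding i_def by simp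
  define j where "j = n - 1 - i"
  have red: "(n * x) mod 3 = ((n mod 3) * (x mod 3)) mod 3" for x by (simp add: mod_mult_eq)
  have r: "i mod 3 = 0 \<or> i mod 3 = 1 \<or> i mod 3 = 2" "j mod 3 = 0 \<or> j mod 3 = 1 \<or> j mod 3 = 2" by auto
  have ij: "(i mod 3 + j mod 3 + 1) mod 3 = n mod 3"
  proof -
    have "(i mod 3 + j mod 3 + 1) mod 3 = (i + j + 1) mod 3" by (rule mod_add_cong[OF mod_add_eq refl])
    then show ?thesis using e unfolding j_def by simp
  qed
  show "cls n (flip n A) u = (2 * cls n A u) mod 3" if n: "n mod 3 = 1"
    using r ij unfolding c red[of i] j_def[symmetric] red[of j] n by (elim disjE) simp_all
  show "cls n (flip n A) u = (2 * cls n A u + 2) mod 3" if n: "n mod 3 = 2"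
    using r ij unfolding c red[of i] j_def[symmetric] red[of j] n by (elim disjE) simp_all
qed

text \<open>Reflecting the path reverses the order of the colours and also exchanges left and right, and the
two effects on the arcs cancel.\<close>

lemma arc_flip:
  assumes A: "A \<subseteq> {1..<n}" and uv: "u < n" "v < n" and n: "n mod 3 \<noteq> 0" and d: "cls n A u \<noteq> cls n A v"
  shows "arc n (flip n A) u v \<longleftrightarrow> arc n A u v"
proof -
  have "u \<noteq> v" using d by auto
  then have m: "max u v \<in> flip n A \<longleftrightarrow> max u v \<notin> A" by (rule max_flip[OF A uv])
  have "n mod 3 = 1 \<or> n mod 3 = 2" using n by linarith
  then show ?thesis
    using cls_flip[OF A uv(1)] cls_flip[OF A uv(2)] cls_cases[of n A u] cls_cases[of n A v] d m
    unfolding arc_def by (elim disjE) auto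
qed

text \<open>One of the three colour classes differs in size from the two others, so its colour is
preserved. The two other colours are preserved or interchanged, and in the second case the mirror image of \<open>A\<close>
has the colours required.\<close>

lemma class_map:
  assumes n: "n = 3 * m + j" "j = 1 \<or> j = 2" "m \<ge> 1" and A: "A \<subseteq> {1..<n}"
    and g: "bij_betw g {..<n} {..<n}"
    and c: "\<And>u v. u < n \<Longrightarrow> v < n \<Longrightarrow> cls n A u = cls n A v \<longleftrightarrow> cls n B (g u) = cls n B (g v)"
    and a: "\<And>u v. u < n \<Longrightarrow> v < n \<Longrightarrow> cls n A u \<noteq> cls n A v \<Longrightarrow> arc n A u v \<longleftrightarrow> arc n B (g u) (g v)"
  shows "sign_iso n A B g \<or> sign_iso n (flip n A) B g"
proof -
  have n0: "n mod 3 \<noteq> 0" using n by presburger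
  define s where "s = j - 1"
  have s: "s = 0 \<and> j = 1 \<or> s = 1 \<and> j = 2" using n unfolding s_def by auto
  have gn: "g u < n" if "u < n" for u using g that unfolding bij_betw_def by auto
  \<comment> \<open>\<open>s\<close> is the colour of the class of exceptional size.\<close>
  have size: "card (members n C r) = card (members n D s) \<longleftrightarrow> r = s" if "r < 3" for C D r
    using s
  proof
    assume j: "s = 0 \<and> j = 1"
    then have n1: "n = 3 * m + 1" using n by simp
    have "r = 0 \<or> r = 1 \<or> r = 2" using that by auto
    then show ?thesis using j card_members_1[OF n1, of C] card_members_1[OF n1, of D] by auto
  next
    assume j: "s = 1 \<and> j = 2"
    then have n1: "n = 3 * m + 2" using n by simp
    have "r = 0 \<or> r = 1 \<or> r = 2" using that by auto
    then show ?thesis using j card_members_2[OF n1, of C] card_members_2[OF n1, of D] by auto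
  qed
  have ne: "\<exists>u<n. cls n A u = r" if "r < 3" for r
  proof -
    have "card (members n A r) \<ge> m" using card_members[OF n(1,2) that, of A] by simp
    then have "members n A r \<noteq> {}" using n(3) by auto
    then show ?thesis unfolding members_def by auto
  qed
  have img: "card (members n A (cls n A u)) = card (members n B (cls n B (g u)))" if u: "u < n" for u
  proof -
    have "members n A (cls n A u) = {v \<in> {..<n}. cls n B (g v) = cls n B (g u)}"
      unfolding members_def using c[OF _ u] by auto
    also have "card \<dots> = card {v \<in> {..<n}. cls n B v = cls n B (g u)}"
      by (rule card_filter_bij[OF g])
    also have "{v \<in> {..<n}. cls n B v = cls n B (g u)} = members n B (cls n B (g u))"
      unfolding members_def by auto
    finally show ?thesis .
  qed
  have c3: "cls n C u < 3" for C u unfolding cls_def by simp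
  have special: "cls n A u = s \<longleftrightarrow> cls n B (g u) = s" if "u < n" for u
    using size[OF c3[of A u], where C = A and D = B] size[OF c3[of B "g u"], where C = B and D = B] img[OF that] by metis
  obtain x where x: "x < n" "cls n A x = (s + 1) mod 3" using ne[of "(s + 1) mod 3"] by auto
  obtain y where y: "y < n" "cls n A y = (s + 2) mod 3" using ne[of "(s + 2) mod 3"] by auto
  have xy: "cls n B (g x) \<noteq> cls n B (g y)" "cls n B (g x) \<noteq> s" "cls n B (g y) \<noteq> s"
  proof -
    have "cls n A x \<noteq> cls n A y" "cls n A x \<noteq> s" "cls n A y \<noteq> s" using s unfolding x(2) y(2) by presburger+
    then show "cls n B (g x) \<noteq> cls n B (g y)" "cls n B (g x) \<noteq> s" "cls n B (g y) \<noteq> s"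
      unfolding c[OF x(1) y(1)] special[OF x(1)] special[OF y(1)] by this+
  qed
  have image_cls: "cls n B (g u) = (if cls n A u = s then s else if cls n A u = (s + 1) mod 3 then cls n B (g x) else cls n B (g y))"
    if u: "u < n" for u
  proof -
    have "cls n A u = s \<or> cls n A u = (s + 1) mod 3 \<or> cls n A u = (s + 2) mod 3"
      using s cls_cases[of n A u] by auto
    then show ?thesis using special[OF u] c[OF u x(1), unfolded x(2)] c[OF u y(1), unfolded y(2)] by auto
  qed
  show ?thesis
  proof (cases "cls n B (g x) = (s + 1) mod 3")
    case True
    then have "cls n B (g y) = (s + 2) mod 3" using xy cls_cases[of n B "g y"] s by auto
    then have "cls n B (g u) = cls n A u" if "u < n" for u
      using image_cls[OF that] True cls_cases[of n A u] s by auto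
    then show ?thesis using sign_iso_cls[OF n0 g] a by blast
  next
    case False
    then have gx: "cls n B (g x) = (s + 2) mod 3" using xy cls_cases[of n B "g x"] s by auto
    then have gy: "cls n B (g y) = (s + 1) mod 3" using xy cls_cases[of n B "g y"] s by auto
    have fl: "cls n (flip n A) u = (2 * cls n A u + 2 * s) mod 3" if "u < n" for u
      using s
    proof
      assume j: "s = 0 \<and> j = 1"
      then have "n mod 3 = 1" using n by presburger
      then show ?thesis using cls_flip(1)[OF A that] j by simp
    next
      assume j: "s = 1 \<and> j = 2"
      then have "n mod 3 = 2" using n by presburger
      then show ?thesis using cls_flip(2)[OF A that] j by simp
    qed
    have "cls n B (g u) = cls n (flip n A) u" if "u < n" for u
      unfolding fl[OF that] using image_cls[OF that] gx gy cls_cases[of n A u] s by auto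
    moreover have "arc n (flip n A) u v \<longleftrightarrow> arc n B (g u) (g v)"
      if "u < n" "v < n" "cls n (flip n A) u \<noteq> cls n (flip n A) v" for u v
    proof -
      have "cls n A u \<noteq> cls n A v" using that fl by metis
      then show ?thesis using arc_flip[OF A that(1,2) n0] a[OF that(1,2)] by simp
    qed
    ultimately show ?thesis using sign_iso_cls[OF n0 g, of B "flip n A"] by blast
  qed
qed

section \<open>Counting isomorphism classes\<close>

lemma crown_iso_sign:
  assumes A: "A \<subseteq> {1..<N}" and B: "B \<subseteq> {1..<N}" and N: "N = 3 * m + j" "j = 1 \<or> j = 2" "m \<ge> 1"
    and f: "triple_iso (N + 3) (crown N A) (crown N B) f"
  shows "\<exists>g. sign_iso N A B g \<or> sign_iso N (flip N A) B g"
proof -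
  let ?P = "{N, N + 1, N + 2}" and ?TA = "miss (N + 3) (crown N A)" and ?TB = "miss (N + 3) (crown N B)"
  have N0: "N mod 3 \<noteq> 0" using N by presburger
  obtain g where g: "triple_iso (N + 3) (crown N A) (crown N B) g" and gP: "g ` ?P = ?P"
    using align[OF B A N f] by blast
  have bij: "bij_betw g {..<N + 3} {..<N + 3}"
    and T: "\<And>u v w. u < N + 3 \<Longrightarrow> v < N + 3 \<Longrightarrow> w < N + 3 \<Longrightarrow> ?TA u v w \<longleftrightarrow> ?TB (g u) (g v) (g w)"
    using g unfolding triple_iso_def by blast+
  have inj: "inj_on g {..<N + 3}" using bij unfolding bij_betw_def by blast
  have sN: "{..<N} = {..<N + 3} - ?P" by auto
  have "g ` {..<N} = g ` {..<N + 3} - g ` ?P"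
    unfolding sN by (rule inj_on_image_set_diff[OF inj]) auto
  then have img: "g ` {..<N} = {..<N}" using bij gP sN unfolding bij_betw_def by simp
  moreover have "inj_on g {..<N}" by (rule inj_on_subset[OF inj]) auto
  ultimately have bN: "bij_betw g {..<N} {..<N}" unfolding bij_betw_def by blast
  have gN: "g u < N" if "u < N" for u using img that by auto
  obtain \<omega>A where mA: "marks ?TA {..<N + 3} ?P \<omega>A"
    and cA: "\<And>u v. u < N \<Longrightarrow> v < N \<Longrightarrow> \<omega>A u = \<omega>A v \<longleftrightarrow> cls N A u = cls N A v"
    and aA: "\<And>u v. u < N \<Longrightarrow> v < N \<Longrightarrow> cls N A u \<noteq> cls N A v \<Longrightarrow> ?TA (\<omega>A u) u v \<longleftrightarrow> arc N A u v"
    by (rule crown_marks[OF A N0]) (rule that; blast)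
  obtain \<omega>B where mB: "marks ?TB {..<N + 3} ?P \<omega>B"
    and cB: "\<And>u v. u < N \<Longrightarrow> v < N \<Longrightarrow> \<omega>B u = \<omega>B v \<longleftrightarrow> cls N B u = cls N B v"
    and aB: "\<And>u v. u < N \<Longrightarrow> v < N \<Longrightarrow> cls N B u \<noteq> cls N B v \<Longrightarrow> ?TB (\<omega>B u) u v \<longleftrightarrow> arc N B u v"
    by (rule crown_marks[OF B N0]) (rule that; blast)
  have inV: "u \<in> {..<N + 3} - ?P" if "u < N" for u using that by auto
  have wP: "\<omega>A u \<in> ?P" "\<omega>B u \<in> ?P" if "u < N" for u using marksD(4)[OF mA inV] marksD(4)[OF mB inV] that by blast+
  have Pn: "p < N + 3" if "p \<in> ?P" for p using that by auto
  \<comment> \<open>Marks are determined by the missing triples with two crown vertices.\<close>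
  have w: "g (\<omega>A u) = \<omega>B (g u)" if u: "u < N" for u
  proof (rule ccontr)
    assume ne: "g (\<omega>A u) \<noteq> \<omega>B (g u)"
    have "\<omega>B (g u) \<in> g ` ?P" using wP(2)[OF gN[OF u]] gP by simp
    then obtain q where q: "q \<in> ?P" "\<omega>B (g u) = g q" by blast
    have qA: "\<omega>A u \<noteq> q" using ne q by auto
    have "card (?P - {\<omega>A u, q}) = 1" using wP(1)[OF u] q(1) qA by auto
    then obtain r where r: "r \<in> ?P" "r \<noteq> \<omega>A u" "r \<noteq> q" by (auto simp: card_1_singleton_iff set_eq_iff)
    have "?TA q r u" using marksD(5)[OF mA inV[OF u] q(1) r(1)] qA r by metis
    then have "?TB (g q) (g r) (g u)" using T[of q r u] Pn q r u by simp
    moreover have "g q \<in> ?P" "g r \<in> ?P" using gP q(1) r(1) by blast+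
    moreover have "g q \<noteq> g r" using inj r(3) Pn[OF q(1)] Pn[OF r(1)] unfolding inj_on_def by auto
    ultimately have "\<omega>B (g u) \<noteq> g q" using marksD(5)[OF mB inV[OF gN[OF u]], of "g q" "g r"] by blast
    then show False using q by simp
  qed
  have weq: "\<omega>A u = \<omega>A v \<longleftrightarrow> \<omega>B (g u) = \<omega>B (g v)" if "u < N" "v < N" for u v
    using w[OF that(1)] w[OF that(2)] inj_onD[OF inj, of "\<omega>A u" "\<omega>A v"] Pn wP that by auto
  have c: "cls N A u = cls N A v \<longleftrightarrow> cls N B (g u) = cls N B (g v)" if "u < N" "v < N" for u v
    using weq[OF that] cA[OF that] cB[OF gN gN, OF that] by blast
  have a: "arc N A u v \<longleftrightarrow> arc N B (g u) (g v)" if "u < N" "v < N" "cls N A u \<noteq> cls N A v" for u v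
  proof -
    have "?TA (\<omega>A u) u v \<longleftrightarrow> ?TB (g (\<omega>A u)) (g u) (g v)"
      using T[of "\<omega>A u" u v] Pn[OF wP(1)[OF that(1)]] that by simp
    then show ?thesis using aA[OF that] aB[OF gN gN, OF that(1,2)] c[OF that(1,2)] that(3) w[OF that(1)] by simp
  qed
  show ?thesis using class_map[OF N A bN c a] by blast
qed

text \<open>In particular any two words that are isomorphic to \<open>A\<close> but different from it agree, since both have the signs
of the mirror image of \<open>A\<close>.\<close>

lemma iso_normal:
  assumes A: "normal N A" and B: "normal N B" and N: "N = 3 * m + j" "j = 1 \<or> j = 2" "m \<ge> 1"
    and iso: "complex_isomorphic {..<N + 3} (word_complex (N + 3) (crown N A)) {..<N + 3} (word_complex (N + 3) (crown N B))"
  shows "A = B \<or> same_signs N (flip N A) B"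
proof -
  have sub: "A \<subseteq> {1..<N}" "B \<subseteq> {1..<N}" using A B unfolding normal_def by auto
  obtain f where "triple_iso (N + 3) (crown N A) (crown N B) f" using complex_iso_triple[OF iso] by blast
  from crown_iso_sign[OF sub N this] show ?thesis
    using sign_iso_same_signs same_signs_normal[OF _ A B] by blast
qed

lemma normal_finite: "finite {A. normal n A}"
  by (rule finite_subset[of _ "Pow {1..<n}"]) (auto simp: normal_def)

lemma normal_split:
  assumes e: "\<And>A. normal (N + k) A \<longleftrightarrow> A \<subseteq> {1..<N + k} \<and> normal N (A \<inter> {1..<N}) \<and> A \<inter> {N..<N + k} \<in> S"
    and S: "\<And>Y. Y \<in> S \<Longrightarrow> Y \<subseteq> {N..<N + k}" and N: "N \<ge> 1"
  shows "card {A. normal (N + k) A} = card {A. normal N A} * card S"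
proof -
  have "bij_betw (\<lambda>(X, Y). X \<union> Y) ({A. normal N A} \<times> S) {A. normal (N + k) A}"
  proof (rule bij_betw_byWitness[where f' = "\<lambda>A. (A \<inter> {1..<N}, A \<inter> {N..<N + k})"])
    have XY: "(X \<union> Y) \<inter> {1..<N} = X" "(X \<union> Y) \<inter> {N..<N + k} = Y" if "X \<subseteq> {1..<N}" "Y \<subseteq> {N..<N + k}" for X Y
      using that by fastforce+
    show "\<forall>a\<in>{A. normal N A} \<times> S. (\<lambda>A. (A \<inter> {1..<N}, A \<inter> {N..<N + k})) ((\<lambda>(X, Y). X \<union> Y) a) = a"
      using XY S unfolding normal_def by auto
    show "\<forall>a\<in>{A. normal (N + k) A}. (\<lambda>(X, Y). X \<union> Y) ((\<lambda>A. (A \<inter> {1..<N}, A \<inter> {N..<N + k})) a) = a"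
    proof
      fix A assume "A \<in> {A. normal (N + k) A}"
      then have "A \<subseteq> {1..<N} \<union> {N..<N + k}" unfolding normal_def by fastforce
      then show "(\<lambda>(X, Y). X \<union> Y) ((\<lambda>A. (A \<inter> {1..<N}, A \<inter> {N..<N + k})) A) = A" by auto
    qed
    show "(\<lambda>(X, Y). X \<union> Y) ` ({A. normal N A} \<times> S) \<subseteq> {A. normal (N + k) A}"
    proof (rule image_subsetI)
      fix z assume "z \<in> {A. normal N A} \<times> S"
      then obtain X Y where z: "z = (X, Y)" "normal N X" "Y \<in> S" by auto
      then have XYs: "X \<subseteq> {1..<N}" "Y \<subseteq> {N..<N + k}" using S unfolding normal_def by auto
      moreover have "{1..<N} \<subseteq> {1..<N + k}" "{N..<N + k} \<subseteq> {1..<N + k}" using N by auto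
      ultimately have "X \<union> Y \<subseteq> {1..<N + k}" by blast
      then have "normal (N + k) (X \<union> Y)" unfolding e using XY[OF XYs] z by simp
      then show "(\<lambda>(X, Y). X \<union> Y) z \<in> {A. normal (N + k) A}" using z by simp
    qed
    show "(\<lambda>A. (A \<inter> {1..<N}, A \<inter> {N..<N + k})) ` {A. normal (N + k) A} \<subseteq> {A. normal N A} \<times> S"
      using e by auto
  qed
  then have "card ({A. normal N A} \<times> S) = card {A. normal (N + k) A}" by (rule bij_betw_same_card)
  then show ?thesis by (simp add: card_cartesian_product)
qed

text \<open>The choices for three successive letters: of the eight subsets, two are excluded.\<close>

lemma card_blocks:
  assumes "distinct [a, b, c]"
  shows "card {Y \<in> Pow {a, b, c}. b \<in> Y \<longrightarrow> c \<in> Y} = 6"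
proof -
  have "{Y \<in> Pow {a, b, c}. b \<in> Y \<longrightarrow> c \<in> Y} = {{}, {a}, {c}, {a, c}, {b, c}, {a, b, c}}"
    using assms by (auto simp: Pow_insert)
  also have "card \<dots> = 6"
  proof -
    have d: "a \<noteq> b" "a \<noteq> c" "b \<noteq> c" using assms by auto
    then have "b \<notin> {a, c}" "a \<notin> {b, c}" by auto
    then have "{a, c} \<noteq> {b, c}" "{a, c} \<noteq> {a, b, c}" "{b, c} \<noteq> {a, b, c}"
      by (metis insertI1 insertI2)+
    then show ?thesis using d by simp
  qed
  finally show ?thesis .
qed

lemma card_normal_1: "card {A. normal (3 * m + 1) A} = 6 ^ m"
proof (induction m)
  case 0
  have "{A. normal 1 A} = {{}}" unfolding normal_def by auto
  then show ?case by simp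
next
  case (Suc m)
  let ?N = "3 * m + 1"
  define S where "S = {Y \<in> Pow {3 * m + 1, 3 * m + 2, 3 * m + 3}. 3 * m + 2 \<in> Y \<longrightarrow> 3 * m + 3 \<in> Y}"
  have i: "{?N..<?N + 3} = {3 * m + 1, 3 * m + 2, 3 * m + 3}" by auto
  have e: "normal (?N + 3) A \<longleftrightarrow> A \<subseteq> {1..<?N + 3} \<and> normal ?N (A \<inter> {1..<?N}) \<and> A \<inter> {?N..<?N + 3} \<in> S" for A
  proof -
    have r: "3 * j + 3 < ?N + 3 \<longleftrightarrow> 3 * j + 3 < ?N \<or> j = m" for j by presburger
    have s: "A \<inter> {?N..<?N + 3} \<in> S \<longleftrightarrow> (3 * m + 2 \<in> A \<longrightarrow> 3 * m + 3 \<in> A)" unfolding S_def i by auto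
    have "normal ?N (A \<inter> {1..<?N}) \<longleftrightarrow> (\<forall>j. 3 * j + 3 < ?N \<longrightarrow> 3 * j + 2 \<in> A \<longrightarrow> 3 * j + 3 \<in> A)"
      unfolding normal_def by auto
    then show ?thesis unfolding s unfolding normal_def r by blast
  qed
  have "card {A. normal (?N + 3) A} = card {A. normal ?N A} * card S"
    by (rule normal_split[OF e]) (auto simp: S_def)
  moreover have "card S = 6" unfolding S_def by (rule card_blocks) simp
  moreover have "3 * Suc m + 1 = ?N + 3" by simp
  ultimately show ?case using Suc by simp
qed

lemma card_normal_2: "card {A. normal (3 * m + 2) A} = 2 * 6 ^ m"
proof -
  let ?N = "3 * m + 1"
  have e: "normal (?N + 1) A \<longleftrightarrow> A \<subseteq> {1..<?N + 1} \<and> normal ?N (A \<inter> {1..<?N}) \<and> A \<inter> {?N..<?N + 1} \<in> Pow {?N}" for A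
  proof -
    have r: "3 * j + 3 < ?N + 1 \<longleftrightarrow> 3 * j + 3 < ?N" for j by presburger
    have "A \<inter> {?N..<?N + 1} \<in> Pow {?N}" by auto
    moreover have "normal ?N (A \<inter> {1..<?N}) \<longleftrightarrow> (\<forall>j. 3 * j + 3 < ?N \<longrightarrow> 3 * j + 2 \<in> A \<longrightarrow> 3 * j + 3 \<in> A)"
      unfolding normal_def by auto
    ultimately show ?thesis unfolding normal_def r by blast
  qed
  have "card {A. normal (?N + 1) A} = card {A. normal ?N A} * card (Pow {?N})"
    by (rule normal_split[OF e]) auto
  then show ?thesis using card_normal_1[of m] by (simp add: card_Pow)
qed

text \<open>Greedy choice: each selected element excludes at most one other.\<close>

lemma unrelated_half:
  assumes "finite W" and sym: "\<And>A B. r A B \<Longrightarrow> r B A"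
    and two: "\<And>A. A \<in> W \<Longrightarrow> card {B \<in> W. B \<noteq> A \<and> r A B} \<le> 1"
  shows "\<exists>S\<subseteq>W. pairwise (\<lambda>A B. \<not> r A B) S \<and> card W \<le> 2 * card S"
  using assms(1,3)
proof (induction "card W" arbitrary: W rule: less_induct)
  case less
  show ?case
  proof (cases "W = {}")
    case False
    then obtain A where A: "A \<in> W" by blast
    define D where "D = {B \<in> W. B \<noteq> A \<and> r A B}"
    define U where "U = W - insert A D"
    have fin: "finite U" "U \<subseteq> W" "finite D" using less.prems(1) unfolding U_def D_def by auto
    have lt: "card U < card W" using A less.prems(1) unfolding U_def by (intro psubset_card_mono) auto
    have "card {B \<in> U. B \<noteq> C \<and> r C B} \<le> 1" if "C \<in> U" for C
    proof -
      have "card {B \<in> U. B \<noteq> C \<and> r C B} \<le> card {B \<in> W. B \<noteq> C \<and> r C B}"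
        by (rule card_mono) (use fin less.prems(1) in auto)
      then show ?thesis using less.prems(2)[of C] that fin by fastforce
    qed
    from less.hyps[OF lt fin(1) this] obtain S where S: "S \<subseteq> U" "pairwise (\<lambda>A B. \<not> r A B) S" "card U \<le> 2 * card S"
      by blast
    have "A \<notin> S" "finite S" using S fin unfolding U_def by (auto intro: finite_subset)
    then have cS: "card (insert A S) = card S + 1" by simp
    have sep: "\<not> r A B \<and> \<not> r B A" if "B \<in> S" for B
    proof -
      have "B \<in> W" "B \<noteq> A" "B \<notin> D" using that S unfolding U_def by auto
      then show ?thesis using sym unfolding D_def by blast
    qed
    have "W = insert A D \<union> U" using A unfolding U_def D_def by auto
    then have "card W \<le> card (insert A D) + card U" by (metis card_Un_le)
    also have "card (insert A D) \<le> 2" using less.prems(2)[OF A] fin(3) unfolding D_def[symmetric]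
      by (simp add: card_insert_if)
    finally have "card W \<le> 2 * card (insert A S)" using S cS by simp
    moreover have "pairwise (\<lambda>A B. \<not> r A B) (insert A S)" using S(2) sep by (auto simp: pairwise_insert)
    moreover have "insert A S \<subseteq> W" using A S fin by auto
    ultimately show ?thesis by blast
  qed auto
qed

lemma many_complexes:
  assumes N: "N = 3 * m + j" "j = 1 \<or> j = 2" "m \<ge> 1"
  shows "\<exists>S. finite S \<and> (\<forall>C\<in>S. attains_turan_bound {..<N + 3} C) \<and>
    pairwise (\<lambda>C D. \<not> complex_isomorphic {..<N + 3} C {..<N + 3} D) S \<and>
    card {A. normal N A} \<le> 2 * card S"
proof -
  let ?H = "\<lambda>A. word_complex (N + 3) (crown N A)"
  let ?r = "\<lambda>A B. complex_isomorphic {..<N + 3} (?H A) {..<N + 3} (?H B)"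
  let ?W = "{A. normal N A}"
  have "card {B \<in> ?W. B \<noteq> A \<and> ?r A B} \<le> 1" if "A \<in> ?W" for A
  proof -
    have "B = C" if B: "B \<in> {B \<in> ?W. B \<noteq> A \<and> ?r A B}" and C: "C \<in> {B \<in> ?W. B \<noteq> A \<and> ?r A B}" for B C
    proof -
      have "same_signs N (flip N A) B" "same_signs N (flip N A) C"
        using iso_normal[OF _ _ N, of A] \<open>A \<in> ?W\<close> B C by blast+
      then have "same_signs N B C" by (rule same_signs_trans)
      then show ?thesis using same_signs_normal B C by blast
    qed
    then show ?thesis by (intro card_le_Suc0_iff_eq[THEN iffD2, unfolded One_nat_def[symmetric]])
      (auto intro: finite_subset[OF _ normal_finite])
  qed
  from unrelated_half[where r = ?r, OF normal_finite complex_isomorphic_sym this]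
  obtain S where S: "S \<subseteq> ?W" "pairwise (\<lambda>A B. \<not> ?r A B) S" "card ?W \<le> 2 * card S" by blast
  have inj: "inj_on ?H S"
  proof (rule inj_onI, rule ccontr)
    fix A B assume AB: "A \<in> S" "B \<in> S" "?H A = ?H B" "A \<noteq> B"
    then have "\<not> ?r A B" using S(2) unfolding pairwise_def by blast
    then show False using AB(3) complex_isomorphic_refl by metis
  qed
  have n: "N + 3 = 3 * (m + 1) + j" using N by simp
  show ?thesis
  proof (intro exI[of _ "?H ` S"] conjI)
    show "finite (?H ` S)" using finite_subset[OF S(1) normal_finite] by blast
    show "\<forall>C\<in>?H ` S. attains_turan_bound {..<N + 3} C" using word_complex_attains[OF n N(2)] by blast
    show "pairwise (\<lambda>C D. \<not> complex_isomorphic {..<N + 3} C {..<N + 3} D) (?H ` S)"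
      using S(2) by (auto simp: pairwise_def)
    show "card ?W \<le> 2 * card (?H ` S)" using S(3) by (simp add: card_image[OF inj])
  qed
qed

text \<open>This settles \<open>k\<close> up to 1, where the bounds do not exceed 1 and there is no room for a crown above three vertices.\<close>

lemma one_complex:
  fixes n k j :: nat
  assumes "n = 3 * k + j" "j = 1 \<or> j = 2"
  shows "\<exists>S. finite S \<and> (\<forall>C\<in>S. attains_turan_bound {..<n} C) \<and>
    pairwise (\<lambda>C D. \<not> complex_isomorphic {..<n} C {..<n} D) S \<and> card S = 1"
  by (rule exI[of _ "{word_complex n {}}"]) (simp add: word_complex_attains[OF assms])

theorem theorem1p3:
  fixes k n :: nat
  shows "(n = 3 * k + 1 \<longrightarrow>
           (\<exists>S :: nat set set set.
              finite S \<and>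
              (\<forall>C\<in>S. attains_turan_bound {..<n} C) \<and>
              pairwise (\<lambda>C D. \<not> complex_isomorphic {..<n} C {..<n} D) S \<and>
              real (card S) \<ge> 1/2 * 6 powi (int k - 1))) \<and>
         (n = 3 * k + 2 \<longrightarrow>
           (\<exists>S :: nat set set set.
              finite S \<and>
              (\<forall>C\<in>S. attains_turan_bound {..<n} C) \<and>
              pairwise (\<lambda>C D. \<not> complex_isomorphic {..<n} C {..<n} D) S \<and>
              real (card S) \<ge> 6 powi (int k - 1)))"
proof -
  have small: "(6::real) powi (int k - 1) \<le> 1" if "k \<le> 1"
  proof -
    have "k = 0 \<or> k = 1" using that by auto
    then show ?thesis by (elim disjE) (simp_all add: power_int_minus)
  qed
  have large: "(6::real) powi (int k - 1) = real (6 ^ (k - 1))" if "k \<ge> 1"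
    using that by (simp add: power_int_def nat_diff_distrib)
  show ?thesis
  proof (intro conjI impI)
    assume n: "n = 3 * k + 1"
    show "\<exists>S :: nat set set set. finite S \<and> (\<forall>C\<in>S. attains_turan_bound {..<n} C) \<and>
        pairwise (\<lambda>C D. \<not> complex_isomorphic {..<n} C {..<n} D) S \<and>
        real (card S) \<ge> 1/2 * 6 powi (int k - 1)"
    proof (cases "k \<le> 1")
      case True
      obtain S where S: "finite S" "\<forall>C\<in>S. attains_turan_bound {..<n} C"
        "pairwise (\<lambda>C D. \<not> complex_isomorphic {..<n} C {..<n} D) S" "card S = 1"
        using one_complex[OF n] by blast
      have "real (card S) \<ge> 1/2 * 6 powi (int k - 1)" using S(4) small[OF True] by simp
      then show ?thesis using S by blast
    next
      case False
      define N where "N = 3 * (k - 1) + 1"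
      have nN: "n = N + 3" using n False unfolding N_def by simp
      have k1: "k - 1 \<ge> 1" using False by simp
      obtain S where S: "finite S" "\<forall>C\<in>S. attains_turan_bound {..<N + 3} C"
        "pairwise (\<lambda>C D. \<not> complex_isomorphic {..<N + 3} C {..<N + 3} D) S" "card {A. normal N A} \<le> 2 * card S"
        using many_complexes[OF N_def _ k1] by blast
      have "6 ^ (k - 1) \<le> 2 * card S" using S(4) card_normal_1[of "k - 1"] unfolding N_def by simp
      then have "real (6 ^ (k - 1)) \<le> real (2 * card S)" by (simp only: of_nat_le_iff)
      moreover have "(6::real) powi (int k - 1) = real (6 ^ (k - 1))" using large False by simp
      ultimately have "real (card S) \<ge> 1/2 * 6 powi (int k - 1)" by simp
      then show ?thesis using S(1-3) unfolding nN by blast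
    qed
  next
    assume n: "n = 3 * k + 2"
    show "\<exists>S :: nat set set set. finite S \<and> (\<forall>C\<in>S. attains_turan_bound {..<n} C) \<and>
        pairwise (\<lambda>C D. \<not> complex_isomorphic {..<n} C {..<n} D) S \<and>
        real (card S) \<ge> 6 powi (int k - 1)"
    proof (cases "k \<le> 1")
      case True
      obtain S where S: "finite S" "\<forall>C\<in>S. attains_turan_bound {..<n} C"
        "pairwise (\<lambda>C D. \<not> complex_isomorphic {..<n} C {..<n} D) S" "card S = 1"
        using one_complex[OF n] by blast
      have "real (card S) \<ge> 6 powi (int k - 1)" using S(4) small[OF True] by simp
      then show ?thesis using S by blast
    next
      case False
      define N where "N = 3 * (k - 1) + 2"
      have nN: "n = N + 3" using n False unfolding N_def by simp
      have k1: "k - 1 \<ge> 1" using False by simp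
      obtain S where S: "finite S" "\<forall>C\<in>S. attains_turan_bound {..<N + 3} C"
        "pairwise (\<lambda>C D. \<not> complex_isomorphic {..<N + 3} C {..<N + 3} D) S" "card {A. normal N A} \<le> 2 * card S"
        using many_complexes[OF N_def _ k1] by blast
      have "6 ^ (k - 1) \<le> card S" using S(4) card_normal_2[of "k - 1"] unfolding N_def by simp
      then have "real (6 ^ (k - 1)) \<le> real (card S)" by (simp only: of_nat_le_iff)
      moreover have "(6::real) powi (int k - 1) = real (6 ^ (k - 1))" using large False by simp
      ultimately have "real (card S) \<ge> 6 powi (int k - 1)" by simp
      then show ?thesis using S(1-3) unfolding nN by blast
    qed
  qed
qed

end
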